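(* Let $R$ be a local domain of dimension $d$ and let $I=P_1\cap\cdots\cap P_r$ be an intersection of prime ideals $P_i$ of $R$ of a common height. Suppose that $R_{P_i}$ is a regular local ring for $1\le i\le r$. Let $\mathcal I=\{I^{(n)}\}$ be the symbolic filtration of $I$. Then $\ell(\mathcal I_Q)<\mathrm{ht}(Q)$ for all prime ideals $Q$ of $R$ which contain $I$ and are not one of the minimal primes $P_i$ of $I$, and $\ell(\mathcal I_{P_i})=\mathrm{ht}(P_i)=\mathrm{ht}(I)$ for all minimal primes $P_i$ of $I$.
   Context: Local rings are Noetherian. A filtration $\mathcal I=\{I_n\}_{n\in\mathbb N}$ on a ring $R$ is a descending chain of ideals $R=I_0\supset I_1\supset I_2\supset\cdots$ with $I_iI_j\subset I_{i+j}$ for all $i,j$. Its Rees ring is $R[\mathcal I]=\sum_{n\ge 0}I_nt^n\subset R[t]$ (not assumed Noetherian). For $R$ local with maximal ideal $m_R$, the analytic spread is $\ell(\mathcal I)=\dim R[\mathcal I]/m_RR[\mathcal I]$. For a prime $Q$ of $R$, $\mathcal I_Q=\{I_nR_Q\}$, a filtration on the local ring $R_Q$. For $n>0$, the $n$-th symbolic power of an ideal $I$ is $I^{(n)}=\bigcap_{\mathfrak p\in\mathrm{Ass}(R/I)}(I^nR_{\mathfrak p}\cap R)$, and $I^{(0)}=R$. *)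

theory Defs
  imports
    "HOL-Algebra.UnivPoly"
    "HOL-Algebra.Subrings"
    "HOL-Algebra.Ideal_Product"
    "HOL-Algebra.Ring_Divisibility"
    "HOL-Library.Extended_Nat"
begin

hide_const (open) Multiset.mult

section \<open>Dimension and height\<close>

definition prime_chain :: "('a, 'b) ring_scheme \<Rightarrow> nat \<Rightarrow> (nat \<Rightarrow> 'a set) \<Rightarrow> bool" where
  "prime_chain R n C \<longleftrightarrow> (\<forall>i\<le>n. primeideal (C i) R) \<and> (\<forall>i<n. C i \<subset> C (Suc i))"

text \<open>The zero ring gets dimension 0 here, as \<^typ>\<open>enat\<close> has no negative elements.\<close>

definition krull_dim :: "('a, 'b) ring_scheme \<Rightarrow> enat" where
  "krull_dim R = Sup {enat n | n. \<exists>C. prime_chain R n C}"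

definition prime_height :: "('a, 'b) ring_scheme \<Rightarrow> 'a set \<Rightarrow> enat" where
  "prime_height R Q = Sup {enat n | n. \<exists>C. prime_chain R n C \<and> C n = Q}"

definition ideal_height :: "('a, 'b) ring_scheme \<Rightarrow> 'a set \<Rightarrow> enat" where
  "ideal_height R I = (INF Q \<in> {Q. primeideal Q R \<and> I \<subseteq> Q}. prime_height R Q)"

section \<open>Local rings\<close>

text \<open>Local rings are Noetherian by convention.\<close>

locale local_ring = cring R + noetherian_ring R for R (structure) +
  assumes unique_maximal: "\<exists>!M. maximalideal M R"

definition max_ideal :: "('a, 'b) ring_scheme \<Rightarrow> 'a set" where
  "max_ideal R = (THE M. maximalideal M R)"

locale regular_local_ring = local_ring +
  assumes regular: "\<exists>A \<subseteq> carrier R. finite A \<and> max_ideal R = Idl A \<and> enat (card A) = krull_dim R"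

section \<open>Localization\<close>

text \<open>
  The fraction \<open>a / s\<close> is the class of the pair \<open>(a, s)\<close>, where \<open>(a, s)\<close> and \<open>(b, t)\<close> are
  identified if \<open>u (a t - b s) = 0\<close> for some \<open>u\<close> in the multiplicative set \<open>S\<close>.
\<close>

definition fraction :: "('a, 'b) ring_scheme \<Rightarrow> 'a set \<Rightarrow> 'a \<Rightarrow> 'a \<Rightarrow> ('a \<times> 'a) set" where
  "fraction R S a s = {(b, t). b \<in> carrier R \<and> t \<in> S \<and>
     (\<exists>u\<in>S. u \<otimes>\<^bsub>R\<^esub> (a \<otimes>\<^bsub>R\<^esub> t) = u \<otimes>\<^bsub>R\<^esub> (b \<otimes>\<^bsub>R\<^esub> s))}"

text \<open>
  The unions below are over families of equal sets: they express that the operations are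
  defined on representatives (see \<open>frac_mult\<close> and \<open>frac_add\<close>).
\<close>

definition localization :: "('a, 'b) ring_scheme \<Rightarrow> 'a set \<Rightarrow> ('a \<times> 'a) set ring" where
  "localization R S =
     \<lparr>carrier = {fraction R S a s | a s. a \<in> carrier R \<and> s \<in> S},
      mult = (\<lambda>x y. \<Union>{fraction R S (a \<otimes>\<^bsub>R\<^esub> b) (s \<otimes>\<^bsub>R\<^esub> t) | a s b t. (a, s) \<in> x \<and> (b, t) \<in> y}),
      one = fraction R S \<one>\<^bsub>R\<^esub> \<one>\<^bsub>R\<^esub>,
      zero = fraction R S \<zero>\<^bsub>R\<^esub> \<one>\<^bsub>R\<^esub>,
      add = (\<lambda>x y. \<Union>{fraction R S (a \<otimes>\<^bsub>R\<^esub> t \<oplus>\<^bsub>R\<^esub> b \<otimes>\<^bsub>R\<^esub> s) (s \<otimes>\<^bsub>R\<^esub> t) | a s b t.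
                 (a, s) \<in> x \<and> (b, t) \<in> y})\<rparr>"

definition localization_at :: "('a, 'b) ring_scheme \<Rightarrow> 'a set \<Rightarrow> ('a \<times> 'a) set ring" where
  "localization_at R Q = localization R (carrier R - Q)"

definition to_localization_at :: "('a, 'b) ring_scheme \<Rightarrow> 'a set \<Rightarrow> 'a \<Rightarrow> ('a \<times> 'a) set" where
  "to_localization_at R Q a = fraction R (carrier R - Q) a \<one>\<^bsub>R\<^esub>"

definition extend_at :: "('a, 'b) ring_scheme \<Rightarrow> 'a set \<Rightarrow> 'a set \<Rightarrow> ('a \<times> 'a) set set" where
  "extend_at R Q I = Idl\<^bsub>localization_at R Q\<^esub> (to_localization_at R Q ` I)"

definition contract_at :: "('a, 'b) ring_scheme \<Rightarrow> 'a set \<Rightarrow> ('a \<times> 'a) set set \<Rightarrow> 'a set" where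
  "contract_at R Q J = {a \<in> carrier R. to_localization_at R Q a \<in> J}"

section \<open>Symbolic powers\<close>

text \<open>The set \<open>{r \<in> carrier R. r x \<in> I}\<close> is the annihilator of the class of \<open>x\<close> in \<open>R/I\<close>.\<close>

definition associated_primes :: "('a, 'b) ring_scheme \<Rightarrow> 'a set \<Rightarrow> 'a set set" where
  "associated_primes R I =
     {Q. primeideal Q R \<and> (\<exists>x\<in>carrier R. Q = {r \<in> carrier R. r \<otimes>\<^bsub>R\<^esub> x \<in> I})}"

definition symbolic_power :: "('a, 'b) ring_scheme \<Rightarrow> 'a set \<Rightarrow> nat \<Rightarrow> 'a set" where
  "symbolic_power R I n =
     (if n = 0 then carrier R
      else {x \<in> carrier R. \<forall>Q\<in>associated_primes R I.
              x \<in> contract_at R Q (extend_at R Q (I [^]\<^bsub>ideals_set R\<^esub> n))})"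

section \<open>Filtrations and analytic spread\<close>

locale filtration = cring R for R (structure) +
  fixes F :: "nat \<Rightarrow> 'a set"
  assumes ideals: "ideal (F n) R"
    and zeroth: "F 0 = carrier R"
    and descending: "F (Suc n) \<subseteq> F n"
    and mult: "x \<in> F i \<Longrightarrow> y \<in> F j \<Longrightarrow> x \<otimes> y \<in> F (i + j)"

definition localize_filtration ::
    "('a, 'b) ring_scheme \<Rightarrow> (nat \<Rightarrow> 'a set) \<Rightarrow> 'a set \<Rightarrow> nat \<Rightarrow> ('a \<times> 'a) set set" where
  "localize_filtration R F Q n = extend_at R Q (F n)"

definition rees_ring :: "('a, 'b) ring_scheme \<Rightarrow> (nat \<Rightarrow> 'a set) \<Rightarrow> ('a, nat \<Rightarrow> 'a) up_ring" where
  "rees_ring R F = UP R\<lparr>carrier := {p \<in> carrier (UP R). \<forall>n. coeff (UP R) p n \<in> F n}\<rparr>"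

definition analytic_spread :: "('a, 'b) ring_scheme \<Rightarrow> (nat \<Rightarrow> 'a set) \<Rightarrow> enat" where
  "analytic_spread R F =
     krull_dim (rees_ring R F Quot
       (Idl\<^bsub>rees_ring R F\<^esub> ((\<lambda>a. monom (UP R) a 0) ` max_ideal R)))"

section \<open>Well-definedness\<close>

locale mult_set = cring R for R (structure) +
  fixes S
  assumes S_carrier: "S \<subseteq> carrier R"
    and S_one: "\<one> \<in> S"
    and S_mult: "s \<in> S \<Longrightarrow> t \<in> S \<Longrightarrow> s \<otimes> t \<in> S"
begin

lemma S_carr [simp]: "s \<in> S \<Longrightarrow> s \<in> carrier R"
  using S_carrier by auto

declare S_one [simp] S_mult [simp]

lemma mem_frac:
  "(b, t) \<in> fraction R S a s \<longleftrightarrow> b \<in> carrier R \<and> t \<in> S \<and> (\<exists>u\<in>S. u \<otimes> (a \<otimes> t) = u \<otimes> (b \<otimes> s))"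
  by (simp add: fraction_def)

lemma frac_trans:
  assumes "a \<in> carrier R" "s \<in> S" "b \<in> carrier R" "t \<in> S" "c \<in> carrier R" "v \<in> S"
    and "\<exists>u\<in>S. u \<otimes> (a \<otimes> t) = u \<otimes> (b \<otimes> s)" "\<exists>u\<in>S. u \<otimes> (b \<otimes> v) = u \<otimes> (c \<otimes> t)"
  shows "\<exists>u\<in>S. u \<otimes> (a \<otimes> v) = u \<otimes> (c \<otimes> s)"
proof -
  obtain u w where u: "u \<in> S" "u \<otimes> (a \<otimes> t) = u \<otimes> (b \<otimes> s)"
    and w: "w \<in> S" "w \<otimes> (b \<otimes> v) = w \<otimes> (c \<otimes> t)"
    using assms by blast
  have "(u \<otimes> w \<otimes> t) \<otimes> (a \<otimes> v) = (w \<otimes> v) \<otimes> (u \<otimes> (a \<otimes> t))"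
    using assms(1-6) u(1) w(1) by (simp add: m_ac)
  also have "\<dots> = (u \<otimes> s) \<otimes> (w \<otimes> (b \<otimes> v))"
    unfolding u(2) using assms(1-6) u(1) w(1) by (simp add: m_ac)
  also have "\<dots> = (u \<otimes> w \<otimes> t) \<otimes> (c \<otimes> s)"
    unfolding w(2) using assms(1-6) u(1) w(1) by (simp add: m_ac)
  finally show ?thesis using u(1) w(1) assms(4) S_mult by blast
qed

lemma frac_eq:
  assumes "a \<in> carrier R" "s \<in> S" "b \<in> carrier R" "t \<in> S"
  shows "fraction R S a s = fraction R S b t \<longleftrightarrow> (\<exists>u\<in>S. u \<otimes> (a \<otimes> t) = u \<otimes> (b \<otimes> s))"
proof
  assume "fraction R S a s = fraction R S b t"
  moreover have "(b, t) \<in> fraction R S b t"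
    using assms by (auto simp: mem_frac)
  ultimately have "(b, t) \<in> fraction R S a s" by simp
  then show "\<exists>u\<in>S. u \<otimes> (a \<otimes> t) = u \<otimes> (b \<otimes> s)"
    by (simp add: mem_frac)
next
  assume ab: "\<exists>u\<in>S. u \<otimes> (a \<otimes> t) = u \<otimes> (b \<otimes> s)"
  then have ba: "\<exists>u\<in>S. u \<otimes> (b \<otimes> s) = u \<otimes> (a \<otimes> t)" by metis
  show "fraction R S a s = fraction R S b t"
    using frac_trans[OF assms(3,4,1,2) _ _ ba] frac_trans[OF assms _ _ ab]
    by (auto simp: mem_frac)
qed

lemma frac_mult:
  assumes "a \<in> carrier R" "s \<in> S" "b \<in> carrier R" "t \<in> S"
  shows "fraction R S a s \<otimes>\<^bsub>localization R S\<^esub> fraction R S b t = fraction R S (a \<otimes> b) (s \<otimes> t)"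
proof -
  have "fraction R S (a' \<otimes> b') (s' \<otimes> t') = fraction R S (a \<otimes> b) (s \<otimes> t)"
    if mem: "(a', s') \<in> fraction R S a s" "(b', t') \<in> fraction R S b t" for a' s' b' t'
  proof -
    obtain u v where *: "a' \<in> carrier R" "s' \<in> S" "b' \<in> carrier R" "t' \<in> S" "u \<in> S" "v \<in> S"
      and u: "u \<otimes> (a \<otimes> s') = u \<otimes> (a' \<otimes> s)" and v: "v \<otimes> (b \<otimes> t') = v \<otimes> (b' \<otimes> t)"
      using mem unfolding mem_frac by blast
    have "(u \<otimes> v) \<otimes> (a' \<otimes> b' \<otimes> (s \<otimes> t)) = (u \<otimes> (a' \<otimes> s)) \<otimes> (v \<otimes> (b' \<otimes> t))"
      using * assms by (simp add: m_ac)
    also have "\<dots> = (u \<otimes> v) \<otimes> (a \<otimes> b \<otimes> (s' \<otimes> t'))"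
      unfolding u[symmetric] v[symmetric] using * assms by (simp add: m_ac)
    finally have "\<exists>w\<in>S. w \<otimes> ((a' \<otimes> b') \<otimes> (s \<otimes> t)) = w \<otimes> ((a \<otimes> b) \<otimes> (s' \<otimes> t'))" using *(5,6) S_mult by blast
    moreover have "a' \<otimes> b' \<in> carrier R" "s' \<otimes> t' \<in> S" "a \<otimes> b \<in> carrier R" "s \<otimes> t \<in> S"
      using * assms by simp_all
    ultimately show ?thesis
      by (simp only: frac_eq)
  qed
  moreover have "(a, s) \<in> fraction R S a s" "(b, t) \<in> fraction R S b t"
    using assms by (auto simp: mem_frac)
  ultimately have "{fraction R S (a' \<otimes> b') (s' \<otimes> t') | a' s' b' t'.
      (a', s') \<in> fraction R S a s \<and> (b', t') \<in> fraction R S b t} = {fraction R S (a \<otimes> b) (s \<otimes> t)}"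
    by blast
  then show ?thesis
    by (simp add: localization_def)
qed

lemma frac_add:
  assumes "a \<in> carrier R" "s \<in> S" "b \<in> carrier R" "t \<in> S"
  shows "fraction R S a s \<oplus>\<^bsub>localization R S\<^esub> fraction R S b t
    = fraction R S (a \<otimes> t \<oplus> b \<otimes> s) (s \<otimes> t)"
proof -
  have "fraction R S (a' \<otimes> t' \<oplus> b' \<otimes> s') (s' \<otimes> t') = fraction R S (a \<otimes> t \<oplus> b \<otimes> s) (s \<otimes> t)"
    if mem: "(a', s') \<in> fraction R S a s" "(b', t') \<in> fraction R S b t" for a' s' b' t'
  proof -
    obtain u v where *: "a' \<in> carrier R" "s' \<in> S" "b' \<in> carrier R" "t' \<in> S" "u \<in> S" "v \<in> S"
      and u: "u \<otimes> (a \<otimes> s') = u \<otimes> (a' \<otimes> s)" and v: "v \<otimes> (b \<otimes> t') = v \<otimes> (b' \<otimes> t)"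
      using mem unfolding mem_frac by blast
    have "(u \<otimes> v) \<otimes> ((a' \<otimes> t' \<oplus> b' \<otimes> s') \<otimes> (s \<otimes> t))
        = (u \<otimes> (a' \<otimes> s)) \<otimes> (v \<otimes> t \<otimes> t') \<oplus> (v \<otimes> (b' \<otimes> t)) \<otimes> (u \<otimes> s \<otimes> s')"
      using * assms by (simp add: m_ac l_distr r_distr)
    also have "\<dots> = (u \<otimes> v) \<otimes> ((a \<otimes> t \<oplus> b \<otimes> s) \<otimes> (s' \<otimes> t'))"
      unfolding u[symmetric] v[symmetric] using * assms by (simp add: m_ac l_distr r_distr)
    finally have "\<exists>w\<in>S. w \<otimes> ((a' \<otimes> t' \<oplus> b' \<otimes> s') \<otimes> (s \<otimes> t)) = w \<otimes> ((a \<otimes> t \<oplus> b \<otimes> s) \<otimes> (s' \<otimes> t'))" using *(5,6) S_mult by blast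
    moreover have "a' \<otimes> t' \<oplus> b' \<otimes> s' \<in> carrier R" "s' \<otimes> t' \<in> S" "a \<otimes> t \<oplus> b \<otimes> s \<in> carrier R" "s \<otimes> t \<in> S"
      using * assms by simp_all
    ultimately show ?thesis
      by (simp only: frac_eq)
  qed
  moreover have "(a, s) \<in> fraction R S a s" "(b, t) \<in> fraction R S b t"
    using assms by (auto simp: mem_frac)
  ultimately have "{fraction R S (a' \<otimes> t' \<oplus> b' \<otimes> s') (s' \<otimes> t') | a' s' b' t'.
      (a', s') \<in> fraction R S a s \<and> (b', t') \<in> fraction R S b t} = {fraction R S (a \<otimes> t \<oplus> b \<otimes> s) (s \<otimes> t)}"
    by blast
  then show ?thesis
    by (simp add: localization_def)
qed

lemma frac_one: "\<one>\<^bsub>localization R S\<^esub> = fraction R S \<one> \<one>"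
  and frac_zero: "\<zero>\<^bsub>localization R S\<^esub> = fraction R S \<zero> \<one>"
  and frac_carrier: "carrier (localization R S) = {fraction R S a s | a s. a \<in> carrier R \<and> s \<in> S}"
  by (simp_all add: localization_def)

lemma frac_eqI:
  assumes "a \<in> carrier R" "s \<in> S" "b \<in> carrier R" "t \<in> S" "a \<otimes> t = b \<otimes> s"
  shows "fraction R S a s = fraction R S b t"
  using assms by (subst frac_eq) auto

lemma frac_in_carrier:
  "a \<in> carrier R \<Longrightarrow> s \<in> S \<Longrightarrow> fraction R S a s \<in> carrier (localization R S)"
  unfolding frac_carrier by blast

lemma frac_cases:
  assumes "x \<in> carrier (localization R S)"
  obtains a s where "a \<in> carrier R" "s \<in> S" "x = fraction R S a s"
  using assms unfolding frac_carrier by blast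

lemma cring_localization: "cring (localization R S)"
proof (rule cringI)
  let ?L = "localization R S"
  show "abelian_group ?L"
  proof (rule abelian_groupI)
    fix x y assume "x \<in> carrier ?L" "y \<in> carrier ?L"
    then obtain a s b t where xy: "a \<in> carrier R" "s \<in> S" "x = fraction R S a s"
      "b \<in> carrier R" "t \<in> S" "y = fraction R S b t" by (metis frac_cases)
    show "x \<oplus>\<^bsub>?L\<^esub> y \<in> carrier ?L"
      using xy by (simp add: frac_add frac_in_carrier)
    show "x \<oplus>\<^bsub>?L\<^esub> y = y \<oplus>\<^bsub>?L\<^esub> x"
      using xy by (simp add: frac_add m_ac a_ac)
    fix z assume "z \<in> carrier ?L"
    then obtain c u where z: "c \<in> carrier R" "u \<in> S" "z = fraction R S c u"
      by (rule frac_cases)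
    show "x \<oplus>\<^bsub>?L\<^esub> y \<oplus>\<^bsub>?L\<^esub> z = x \<oplus>\<^bsub>?L\<^esub> (y \<oplus>\<^bsub>?L\<^esub> z)"
      using xy z by (simp add: frac_add l_distr r_distr m_ac a_ac)
  next
    show "\<zero>\<^bsub>?L\<^esub> \<in> carrier ?L"
      by (simp add: frac_zero frac_in_carrier)
    fix x assume "x \<in> carrier ?L"
    then obtain a s where x: "a \<in> carrier R" "s \<in> S" "x = fraction R S a s"
      by (rule frac_cases)
    show "\<zero>\<^bsub>?L\<^esub> \<oplus>\<^bsub>?L\<^esub> x = x"
      using x by (simp add: frac_zero frac_add)
    have "fraction R S (\<ominus> a) s \<oplus>\<^bsub>?L\<^esub> x = \<zero>\<^bsub>?L\<^esub>"
      using x by (simp add: frac_add frac_zero l_minus l_neg, subst frac_eq) auto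
    moreover have "fraction R S (\<ominus> a) s \<in> carrier ?L"
      using x by (simp add: frac_in_carrier)
    ultimately show "\<exists>y\<in>carrier ?L. y \<oplus>\<^bsub>?L\<^esub> x = \<zero>\<^bsub>?L\<^esub>"
      by blast
  qed
  show "comm_monoid ?L"
  proof (rule comm_monoidI)
    fix x y assume "x \<in> carrier ?L" "y \<in> carrier ?L"
    then obtain a s b t where xy: "a \<in> carrier R" "s \<in> S" "x = fraction R S a s"
      "b \<in> carrier R" "t \<in> S" "y = fraction R S b t" by (metis frac_cases)
    show "x \<otimes>\<^bsub>?L\<^esub> y \<in> carrier ?L"
      using xy by (simp add: frac_mult frac_in_carrier)
    show "x \<otimes>\<^bsub>?L\<^esub> y = y \<otimes>\<^bsub>?L\<^esub> x"
      using xy by (simp add: frac_mult m_ac)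
    show "\<one>\<^bsub>?L\<^esub> \<otimes>\<^bsub>?L\<^esub> x = x"
      using xy by (simp add: frac_mult frac_one)
    fix z assume "z \<in> carrier ?L"
    then obtain c u where z: "c \<in> carrier R" "u \<in> S" "z = fraction R S c u"
      by (rule frac_cases)
    show "x \<otimes>\<^bsub>?L\<^esub> y \<otimes>\<^bsub>?L\<^esub> z = x \<otimes>\<^bsub>?L\<^esub> (y \<otimes>\<^bsub>?L\<^esub> z)"
      using xy z by (simp add: frac_mult m_ac)
  next
    show "\<one>\<^bsub>?L\<^esub> \<in> carrier ?L"
      by (simp add: frac_one frac_in_carrier)
  qed
  fix x y z assume "x \<in> carrier ?L" "y \<in> carrier ?L" "z \<in> carrier ?L"
  then obtain a s b t c u where xyz: "a \<in> carrier R" "s \<in> S" "x = fraction R S a s"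
    "b \<in> carrier R" "t \<in> S" "y = fraction R S b t"
    "c \<in> carrier R" "u \<in> S" "z = fraction R S c u" by (metis frac_cases)
  then show "(x \<oplus>\<^bsub>?L\<^esub> y) \<otimes>\<^bsub>?L\<^esub> z = x \<otimes>\<^bsub>?L\<^esub> z \<oplus>\<^bsub>?L\<^esub> y \<otimes>\<^bsub>?L\<^esub> z"
    by (simp add: frac_add frac_mult)
       (rule frac_eqI, simp_all add: l_distr r_distr m_ac a_ac)
qed

lemma frac_a_inv:
  assumes "a \<in> carrier R" "s \<in> S"
  shows "\<ominus>\<^bsub>localization R S\<^esub> fraction R S a s = fraction R S (\<ominus> a) s"
proof -
  interpret L: cring "localization R S" by (rule cring_localization)
  have "fraction R S (\<ominus> a) s \<oplus>\<^bsub>localization R S\<^esub> fraction R S a s = \<zero>\<^bsub>localization R S\<^esub>"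
    using assms by (simp add: frac_add frac_zero l_minus l_neg, subst frac_eq) auto
  moreover have "fraction R S a s \<in> carrier (localization R S)"
    "fraction R S (\<ominus> a) s \<in> carrier (localization R S)"
    using assms by (simp_all add: frac_in_carrier)
  ultimately show ?thesis
    using L.minus_equality by blast
qed

lemma fraction_hom: "(\<lambda>a. fraction R S a \<one>) \<in> ring_hom R (localization R S)"
  by (rule ring_hom_memI) (auto simp: frac_in_carrier frac_mult frac_add frac_one)

lemma ideal_fractions:
  assumes "ideal J R"
  shows "ideal {fraction R S a s | a s. a \<in> J \<and> s \<in> S} (localization R S)"
proof -
  interpret J: ideal J R by fact
  interpret L: cring "localization R S" by (rule cring_localization)
  show ?thesis
  proof (rule idealI)
    show "ring (localization R S)" by (rule L.ring_axioms)
    show "subgroup {fraction R S a s | a s. a \<in> J \<and> s \<in> S} (add_monoid (localization R S))"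
    proof (rule L.add.subgroupI)
      show "{fraction R S a s | a s. a \<in> J \<and> s \<in> S} \<subseteq> carrier (localization R S)"
        by (auto simp: frac_in_carrier)
      show "{fraction R S a s | a s. a \<in> J \<and> s \<in> S} \<noteq> {}"
        using J.zero_closed S_one by blast
    next
      fix x assume "x \<in> {fraction R S a s | a s. a \<in> J \<and> s \<in> S}"
      then obtain a s where "x = fraction R S a s" "a \<in> J" "s \<in> S" by blast
      then have "\<ominus>\<^bsub>localization R S\<^esub> x = fraction R S (\<ominus> a) s" "\<ominus> a \<in> J" "s \<in> S"
        by (auto simp: frac_a_inv)
      then show "\<ominus>\<^bsub>localization R S\<^esub> x \<in> {fraction R S a s | a s. a \<in> J \<and> s \<in> S}"
        by blast
    next
      fix x y assume "x \<in> {fraction R S a s | a s. a \<in> J \<and> s \<in> S}"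
        "y \<in> {fraction R S a s | a s. a \<in> J \<and> s \<in> S}"
      then obtain a s b t where "x = fraction R S a s" "a \<in> J" "s \<in> S"
        "y = fraction R S b t" "b \<in> J" "t \<in> S" by blast
      then have "x \<oplus>\<^bsub>localization R S\<^esub> y = fraction R S (a \<otimes> t \<oplus> b \<otimes> s) (s \<otimes> t)"
        "a \<otimes> t \<oplus> b \<otimes> s \<in> J" "s \<otimes> t \<in> S"
        by (auto simp: frac_add J.I_r_closed)
      then show "x \<oplus>\<^bsub>localization R S\<^esub> y \<in> {fraction R S a s | a s. a \<in> J \<and> s \<in> S}"
        by blast
    qed
  next
    fix x y assume "x \<in> {fraction R S a s | a s. a \<in> J \<and> s \<in> S}" "y \<in> carrier (localization R S)"
    then obtain a s b t where "x = fraction R S a s" "a \<in> J" "s \<in> S"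
      "y = fraction R S b t" "b \<in> carrier R" "t \<in> S" by (auto elim: frac_cases)
    then have "y \<otimes>\<^bsub>localization R S\<^esub> x = fraction R S (b \<otimes> a) (t \<otimes> s)"
      "x \<otimes>\<^bsub>localization R S\<^esub> y = fraction R S (a \<otimes> b) (s \<otimes> t)"
      "b \<otimes> a \<in> J" "a \<otimes> b \<in> J" "s \<otimes> t \<in> S" "t \<otimes> s \<in> S"
      by (auto simp: frac_mult J.I_r_closed J.I_l_closed)
    then show "y \<otimes>\<^bsub>localization R S\<^esub> x \<in> {fraction R S a s | a s. a \<in> J \<and> s \<in> S}"
      "x \<otimes>\<^bsub>localization R S\<^esub> y \<in> {fraction R S a s | a s. a \<in> J \<and> s \<in> S}"
      by blast+
  qed
qed

lemma genideal_fractions: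
  assumes "ideal J R"
  shows "Idl\<^bsub>localization R S\<^esub> ((\<lambda>a. fraction R S a \<one>) ` J)
    = {fraction R S a s | a s. a \<in> J \<and> s \<in> S}" (is "?L = ?E")
proof
  interpret J: ideal J R by fact
  interpret L: cring "localization R S" by (rule cring_localization)
  show "?L \<subseteq> ?E"
    by (rule L.genideal_minimal[OF ideal_fractions[OF assms]]) (use S_one in blast)
  have im: "(\<lambda>a. fraction R S a \<one>) ` J \<subseteq> carrier (localization R S)"
    by (auto simp: frac_in_carrier)
  interpret E: ideal ?L "localization R S"
    by (rule L.genideal_ideal[OF im])
  show "?E \<subseteq> ?L"
  proof clarify
    fix a s assume as: "a \<in> J" "s \<in> S"
    have "fraction R S \<one> s \<otimes>\<^bsub>localization R S\<^esub> fraction R S a \<one> \<in> ?L"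
      using as L.genideal_self[OF im]
      by (intro E.I_l_closed) (auto simp: frac_in_carrier)
    then show "fraction R S a s \<in> ?L"
      using as by (simp add: frac_mult)
  qed
qed

end

lemma (in cring) mult_set_prime:
  assumes "primeideal Q R"
  shows "mult_set R (carrier R - Q)"
proof -
  interpret Q: primeideal Q R by fact
  show ?thesis
    by unfold_locales (use Q.one_imp_carrier Q.I_notcarr Q.I_prime in auto)
qed

lemma (in cring) cring_localization_at: "primeideal Q R \<Longrightarrow> cring (localization_at R Q)"
  unfolding localization_at_def by (intro mult_set.cring_localization mult_set_prime)

lemma (in cring) extend_at_eq:
  assumes "primeideal Q R" "ideal J R"
  shows "extend_at R Q J = {fraction R (carrier R - Q) a s | a s. a \<in> J \<and> s \<in> carrier R - Q}"
  using mult_set.genideal_fractions[OF mult_set_prime[OF assms(1)] assms(2)]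
  by (simp add: extend_at_def localization_at_def to_localization_at_def[abs_def])

lemma (in cring) ideal_extend_at:
  assumes "primeideal Q R" "ideal J R"
  shows "ideal (extend_at R Q J) (localization_at R Q)"
  using mult_set.ideal_fractions[OF mult_set_prime[OF assms(1)] assms(2)]
  by (simp add: extend_at_eq[OF assms] localization_at_def)

lemma (in cring) extend_at_mult:
  assumes Q: "primeideal Q R" and J: "ideal J R" "ideal K R" "ideal M R"
    and JK: "\<And>a b. a \<in> J \<Longrightarrow> b \<in> K \<Longrightarrow> a \<otimes> b \<in> M"
    and x: "x \<in> extend_at R Q J" and y: "y \<in> extend_at R Q K"
  shows "x \<otimes>\<^bsub>localization_at R Q\<^esub> y \<in> extend_at R Q M"
proof -
  interpret S: mult_set R "carrier R - Q" by (rule mult_set_prime[OF Q])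
  interpret J: ideal J R by fact
  interpret K: ideal K R by fact
  obtain a s b t where *: "x = fraction R (carrier R - Q) a s" "a \<in> J" "s \<in> carrier R - Q"
    "y = fraction R (carrier R - Q) b t" "b \<in> K" "t \<in> carrier R - Q"
    using x y unfolding extend_at_eq[OF Q J(1)] extend_at_eq[OF Q J(2)] by blast
  then have "x \<otimes>\<^bsub>localization_at R Q\<^esub> y = fraction R (carrier R - Q) (a \<otimes> b) (s \<otimes> t)"
    unfolding localization_at_def by (simp add: S.frac_mult)
  moreover have "a \<otimes> b \<in> M" "s \<otimes> t \<in> carrier R - Q"
    using * JK S.S_mult by blast+
  ultimately show ?thesis
    unfolding extend_at_eq[OF Q J(3)] by blast
qed

lemma (in filtration) filtration_localize:
  assumes Q: "primeideal Q R"
  shows "filtration (localization_at R Q) (localize_filtration R F Q)"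
proof -
  interpret L: cring "localization_at R Q" by (rule cring_localization_at[OF Q])
  show ?thesis
  proof (intro filtration.intro filtration_axioms.intro; (unfold localize_filtration_def)?)
    show "cring (localization_at R Q)" by (rule L.cring_axioms)
    fix n
    show "ideal (extend_at R Q (F n)) (localization_at R Q)"
      by (rule ideal_extend_at[OF Q ideals])
    show "extend_at R Q (F (Suc n)) \<subseteq> extend_at R Q (F n)"
      unfolding extend_at_eq[OF Q ideals] using descending by blast
  next
    show "extend_at R Q (F 0) = carrier (localization_at R Q)"
      unfolding extend_at_eq[OF Q ideals] using zeroth
      by (simp add: localization_at_def localization_def)
  next
    fix x y i j assume "x \<in> extend_at R Q (F i)" "y \<in> extend_at R Q (F j)"
    then show "x \<otimes>\<^bsub>localization_at R Q\<^esub> y \<in> extend_at R Q (F (i + j))"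
      using extend_at_mult[OF Q ideals[of i] ideals[of j] ideals[of "i + j"]] mult by blast
  qed
qed

lemma (in cring) ideal_contract_at:
  assumes Q: "primeideal Q R" and J: "ideal J (localization_at R Q)"
  shows "ideal (contract_at R Q J) R"
proof -
  interpret S: mult_set R "carrier R - Q" by (rule mult_set_prime[OF Q])
  interpret L: cring "localization_at R Q" by (rule cring_localization_at[OF Q])
  interpret h: ring_hom_ring R "localization_at R Q" "to_localization_at R Q"
    using S.fraction_hom ring_axioms L.ring_axioms unfolding localization_at_def
    by (intro ring_hom_ringI2) (simp_all add: to_localization_at_def[abs_def])
  show ?thesis
    using h.ideal_vimage[OF J] by (simp add: contract_at_def)
qed

lemma (in cring) ideal_power:
  assumes "ideal I R"
  shows "ideal (I [^]\<^bsub>ideals_set R\<^esub> (n::nat)) R"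
proof -
  interpret M: comm_monoid "ideals_set R" by (rule ideals_set_is_comm_monoid)
  show ?thesis
    using M.nat_pow_closed[of I n] assms by (simp add: ideals_set_def)
qed

lemma (in cring) filtration_symbolic:
  assumes I: "ideal I R"
  shows "filtration R (symbolic_power R I)"
proof -
  interpret M: comm_monoid "ideals_set R" by (rule ideals_set_is_comm_monoid)
  define p where "p n = I [^]\<^bsub>ideals_set R\<^esub> n" for n :: nat
  have pid: "ideal (p n) R" for n
    unfolding p_def by (rule ideal_power[OF I])
  have p0: "p 0 = carrier R" and pS: "p (Suc n) = p n \<cdot> I" for n
    by (simp_all add: p_def ideals_set_def)
  have padd: "p (i + j) = p i \<cdot> p j" for i j
    using M.nat_pow_mult[of I i j] I by (simp add: p_def ideals_set_def)
  have prime: "primeideal Q R" if "Q \<in> associated_primes R I" for Q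
    using that by (simp add: associated_primes_def)
  have one: "to_localization_at R Q x \<in> extend_at R Q (carrier R)"
    if "primeideal Q R" "x \<in> carrier R" for Q x
    using that(2) mult_set.S_one[OF mult_set_prime[OF that(1)]]
    unfolding extend_at_eq[OF that(1) oneideal] to_localization_at_def by blast
  have sym: "symbolic_power R I n = {x \<in> carrier R. \<forall>Q\<in>associated_primes R I.
      x \<in> contract_at R Q (extend_at R Q (p n))}" for n
    by (auto simp: symbolic_power_def p_def[symmetric] p0 contract_at_def intro: one prime)
  have sym': "symbolic_power R I n =
      carrier R \<inter> \<Inter>((\<lambda>Q. contract_at R Q (extend_at R Q (p n))) ` associated_primes R I)" for n
    unfolding sym by auto
  show ?thesis
  proof (intro filtration.intro filtration_axioms.intro)
    show "cring R" by (rule cring_axioms)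
    fix n
    show "ideal (symbolic_power R I n) R"
    proof (cases "associated_primes R I = {}")
      case True
      then show ?thesis unfolding sym' by (simp add: oneideal)
    next
      case False
      then have "ideal (\<Inter>((\<lambda>Q. contract_at R Q (extend_at R Q (p n))) ` associated_primes R I)) R"
        by (intro i_Intersect) (auto intro: ideal_contract_at ideal_extend_at pid prime)
      then show ?thesis
        unfolding sym' by (intro i_intersect oneideal)
    qed
    have "p (Suc n) \<subseteq> p n"
      using ideal_prod_inter[OF pid I, of n] by (auto simp: pS)
    then have "extend_at R Q (p (Suc n)) \<subseteq> extend_at R Q (p n)" if "primeideal Q R" for Q
      unfolding extend_at_eq[OF that pid] by blast
    then show "symbolic_power R I (Suc n) \<subseteq> symbolic_power R I n"
      unfolding sym contract_at_def using prime by blast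
  next
    show "symbolic_power R I 0 = carrier R" by (simp add: symbolic_power_def)
  next
    fix x y i j assume x: "x \<in> symbolic_power R I i" and y: "y \<in> symbolic_power R I j"
    have "x \<otimes> y \<in> contract_at R Q (extend_at R Q (p (i + j)))" if Q: "Q \<in> associated_primes R I" for Q
    proof -
      interpret S: mult_set R "carrier R - Q" by (rule mult_set_prime[OF prime[OF Q]])
      have c: "x \<in> carrier R" "y \<in> carrier R" using x y by (auto simp: sym)
      have "to_localization_at R Q x \<otimes>\<^bsub>localization_at R Q\<^esub> to_localization_at R Q y
          \<in> extend_at R Q (p (i + j))"
        using x y Q unfolding sym contract_at_def
        by (intro extend_at_mult[OF prime[OF Q] pid[of i] pid[of j] pid])
           (auto simp: padd intro: ideal_prod.prod)
      then show ?thesis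
        using c ring_hom_mult[OF S.fraction_hom]
        by (simp add: contract_at_def to_localization_at_def localization_at_def)
    qed
    then show "x \<otimes> y \<in> symbolic_power R I (i + j)"
      using x y by (auto simp: sym)
  qed
qed

lemma (in filtration) cring_rees: "cring (rees_ring R F)"
proof -
  interpret U: UP_cring R "UP R" by unfold_locales
  have P: "cring (UP R)" by (rule U.UP_cring)
  then have P': "ring (UP R)" by (rule cring.axioms(1))
  let ?H = "{p \<in> carrier (UP R). \<forall>n. coeff (UP R) p n \<in> F n}"
  have sub: "additive_subgroup (F n) R" for n using ideals ideal.axioms(1) by blast
  have "subring ?H (UP R)"
  proof (rule ring.subringI[OF P'])
    show "\<one>\<^bsub>UP R\<^esub> \<in> ?H"
      using zeroth additive_subgroup.zero_closed[OF sub] by simp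
    fix f assume f: "f \<in> ?H"
    then show "\<ominus>\<^bsub>UP R\<^esub> f \<in> ?H"
      using additive_subgroup.a_inv_closed[OF sub] ring_axioms by (auto simp: abelian_group_axioms)
    fix g assume g: "g \<in> ?H"
    show "f \<oplus>\<^bsub>UP R\<^esub> g \<in> ?H"
      using f g additive_subgroup.a_closed[OF sub] by auto
    have fin: "(\<Oplus>i\<in>A. h i) \<in> F n" if "finite A" "\<And>i. i \<in> A \<Longrightarrow> h i \<in> F n" for A h n
      using that
    proof (induction A rule: finite_induct)
      case empty
      then show ?case using additive_subgroup.zero_closed[OF sub] by simp
    next
      case (insert k A)
      have "h \<in> A \<rightarrow> carrier R" "h k \<in> carrier R"
        using insert.prems additive_subgroup.a_subset[OF sub, of n] by auto
      then show ?case
        using insert additive_subgroup.a_closed[OF sub, of "h k" n] by simp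
    qed
    have "coeff (UP R) f i \<otimes> coeff (UP R) g (n - i) \<in> F n" if "i \<le> n" for i n
      using mult[of _ i _ "n - i"] f g that by auto
    then have "(\<Oplus>i\<in>{..n}. coeff (UP R) f i \<otimes> coeff (UP R) g (n - i)) \<in> F n" for n
      by (intro fin) auto
    then show "f \<otimes>\<^bsub>UP R\<^esub> g \<in> ?H"
      using f g by auto
  qed auto
  then have "subcring ?H (UP R)" by (rule cring.subcringI'[OF P])
  then show ?thesis
    unfolding rees_ring_def by (subst ring.subcring_iff[OF P', symmetric]) auto
qed

end

theory Submission
  imports Defs
begin

text \<open>
  Let \<open>A = R[F]\<close> be the Rees ring of the symbolic filtration \<open>F n = I\<^sup>(\<^sup>n\<^sup>)\<close> and let \<open>Q\<close> be a prime ideal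
  that contains \<open>I\<close>. The analytic spread at \<open>Q\<close> is the supremum of the lengths \<open>e\<close> of prime chains
  of the Rees ring over \<open>R\<^sub>Q\<close> that contain the maximal ideal of \<open>R\<^sub>Q\<close>. Such a chain contracts to a chain
  \<open>D\<^sub>0 \<subset> \<dots> \<subset> D\<^sub>e\<close> of primes of \<open>A\<close> all of which lie over \<open>Q\<close> (\<open>rees_chain_contract\<close>). Its length is
  bounded by the dimension of \<open>A\<close> together with primes that fit below \<open>D\<^sub>0\<close>.

  \<^emph>\<open>Dimension bound.\<close> If \<open>I \<noteq> 0\<close>, a prime chain of length \<open>n + 1\<close> in \<open>A\<close> whose top lies over \<open>Q\<close> yields a
  chain of length \<open>n\<close> in \<open>R\<close> that ends in \<open>Q\<close> (\<open>graded_subring_pchain\<close>). The ring \<open>A\<close> may fail to be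
  Noetherian, but a chain of finite length is detected by finitely many elements, hence by a
  finitely generated subring that arises from \<open>R[f X]\<close>, \<open>0 \<noteq> f \<in> I\<close>, by adjoining fractions of
  elements already present. For polynomials over a Noetherian ring a chain loses at most one step on
  contraction (\<open>pchain_contract\<close>); a fraction \<open>u / v\<close> loses none, since the relation \<open>v Y = u\<close> supplies an
  additional prime of the polynomial ring. The loss of only one step rests on Krull's principal ideal
  theorem, used in this form (\<open>prime_between_containing\<close>): between the ends of a chain of
  three primes there is a prime that contains a prescribed element of the top.

  \<^emph>\<open>Upper bounds.\<close> If \<open>I = 0\<close>, then \<open>A = R\<close> and \<open>e = 0\<close>, since only one prime lies over \<open>Q\<close>. Otherwise the
  zero ideal lies strictly below \<open>D\<^sub>0\<close>, so \<open>e + 1 \<le> ht Q + 1\<close>. If \<open>Q\<close> is none of the \<open>P\<^sub>i\<close>,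
  there is also a prime \<open>p'\<close> of \<open>A\<close> with \<open>0 \<subset> p' \<subset> D\<^sub>0\<close>, one that lies over some \<open>P\<^sub>i\<close>, and hence
  \<open>e + 2 \<le> ht Q + 1\<close> (\<open>prime_below\<close>). It exists since \<open>D\<^sub>0\<close> contains the ideal \<open>J\<close> of all \<open>\<Sum> f\<^sub>n X\<^sup>n\<close> with
  \<open>f\<^sub>n \<in> F (n + 1)\<close>: the identity \<open>(f X\<^sup>n)\<^sup>n\<^sup>+\<^sup>1 = f (f X\<^sup>n\<^sup>+\<^sup>1)\<^sup>n\<close> exhibits a power of such a term as a multiple of
  an element of \<open>I \<subseteq> Q\<close>. Now \<open>J\<close> is the intersection of ideals \<open>J\<^sub>i\<close>, one for each \<open>P\<^sub>i\<close>, each of which is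
  contracted from the localization at \<open>P\<^sub>i\<close>. So \<open>D\<^sub>0\<close> contains some \<open>J\<^sub>i\<close>, and then a prime over \<open>P\<^sub>i\<close> too.

  \<^emph>\<open>Lower bound.\<close> Over the Noetherian local ring \<open>L = R\<^sub>P\<close>, \<open>P = P\<^sub>i\<close>, the filtration consists of the
  powers of the maximal ideal \<open>M\<close>. A chain of length \<open>n\<close> in \<open>L\<close> that ends in \<open>M\<close> extends to the ring
  \<open>L[X, X\<^sup>-\<^sup>1]\<close>. It contracts to the extended Rees ring \<open>L[M X, X\<^sup>-\<^sup>1]\<close>, where one more prime fits
  on top, one that contains \<open>X\<^sup>-\<^sup>1\<close>. By the principal ideal theorem the primes above the bottom
  can be chosen to contain \<open>X\<^sup>-\<^sup>1\<close>, and thus \<open>M = X\<^sup>-\<^sup>1 (M X)\<close>. They contract to a chain of length \<open>n\<close> in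
  the fiber of the Rees ring (\<open>fiber_chain_exists\<close>).
\<close>

section \<open>Chains of prime ideals\<close>

text \<open>Only the length and the two ends of a chain matter below; chains are built and taken apart at either end.\<close>

definition pchain :: "('a, 'b) ring_scheme \<Rightarrow> nat \<Rightarrow> 'a set \<Rightarrow> 'a set \<Rightarrow> bool" where
  "pchain R n p q \<longleftrightarrow> (\<exists>C. prime_chain R n C \<and> C 0 = p \<and> C n = q)"

lemma pchain_0: "pchain R 0 p q \<longleftrightarrow> primeideal p R \<and> q = p"
  by (auto simp: pchain_def prime_chain_def)

lemma pchain_prime:
  assumes "pchain R n p q" shows "primeideal p R" "primeideal q R"
  using assms by (auto simp: pchain_def prime_chain_def)

lemma pchain_Cons:
  assumes "primeideal p R" "p \<subset> p'" "pchain R n p' q" shows "pchain R (Suc n) p q"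
proof -
  obtain C where C: "prime_chain R n C" "C 0 = p'" "C n = q"
    using assms(3) by (auto simp: pchain_def)
  let ?D = "\<lambda>i. case i of 0 \<Rightarrow> p | Suc j \<Rightarrow> C j"
  have "prime_chain R (Suc n) ?D"
    using C assms(1,2) by (auto simp: prime_chain_def less_Suc_eq_0_disj split: nat.splits)
  then show ?thesis using C unfolding pchain_def by (intro exI[of _ ?D]) auto
qed

lemma pchain_snoc:
  assumes "pchain R n p q" "primeideal q' R" "q \<subset> q'" shows "pchain R (Suc n) p q'"
proof -
  obtain C where C: "prime_chain R n C" "C 0 = p" "C n = q"
    using assms(1) by (auto simp: pchain_def)
  let ?D = "\<lambda>i. if i \<le> n then C i else q'"
  have "prime_chain R (Suc n) ?D"
    unfolding prime_chain_def
  proof (intro conjI allI impI)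
    fix i assume "i \<le> Suc n" then show "primeideal (?D i) R"
      using C assms by (auto simp: prime_chain_def)
  next
    fix i assume "i < Suc n" then show "?D i \<subset> ?D (Suc i)"
      using C assms by (cases "i = n") (auto simp: prime_chain_def)
  qed
  then show ?thesis using C unfolding pchain_def by (intro exI[of _ ?D]) auto
qed

lemma pchain_Suc_first:
  assumes "pchain R (Suc n) p q"
  obtains p' where "primeideal p R" "p \<subset> p'" "pchain R n p' q"
proof -
  obtain C where C: "prime_chain R (Suc n) C" "C 0 = p" "C (Suc n) = q"
    using assms by (auto simp: pchain_def)
  have "pchain R n (C 1) q"
    unfolding pchain_def using C by (intro exI[of _ "\<lambda>i. C (Suc i)"]) (auto simp: prime_chain_def)
  moreover have "primeideal p R" "p \<subset> C 1"
    using C by (auto simp: prime_chain_def)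
  ultimately show ?thesis using that by blast
qed

lemma pchain_Suc_last:
  assumes "pchain R (Suc n) p q"
  obtains q' where "primeideal q R" "q' \<subset> q" "pchain R n p q'"
proof -
  obtain C where C: "prime_chain R (Suc n) C" "C 0 = p" "C (Suc n) = q"
    using assms by (auto simp: pchain_def)
  have "pchain R n p (C n)"
    unfolding pchain_def using C by (intro exI[of _ C]) (auto simp: prime_chain_def)
  moreover have "primeideal q R" "C n \<subset> q"
    using C by (auto simp: prime_chain_def)
  ultimately show ?thesis using that by blast
qed

lemma pchain_subset: "pchain R n p q \<Longrightarrow> p \<subseteq> q"
proof (induction n arbitrary: p)
  case 0 then show ?case by (simp add: pchain_0)
next
  case (Suc n)
  then show ?case by (elim pchain_Suc_first) blast
qed

lemma (in ring_hom_cring) primeideal_vimage: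
  assumes J: "primeideal J S" shows "primeideal {r \<in> carrier R. h r \<in> J} R"
proof -
  interpret J: primeideal J S by fact
  have 1: "ideal {r \<in> carrier R. h r \<in> J} R" using ring.ideal_vimage[OF J.ideal_axioms] .
  show ?thesis
  proof (rule primeidealI[OF 1 R.cring_axioms])
    show "carrier R \<noteq> {r \<in> carrier R. h r \<in> J}"
      using J.I_notcarr J.one_imp_carrier hom_one R.one_closed by force
    fix a b assume "a \<in> carrier R" "b \<in> carrier R" "a \<otimes> b \<in> {r \<in> carrier R. h r \<in> J}"
    then show "a \<in> {r \<in> carrier R. h r \<in> J} \<or> b \<in> {r \<in> carrier R. h r \<in> J}"
      using J.I_prime[of "h a" "h b"] by auto
  qed
qed

text \<open>
  A contracted chain can only collapse where two consecutive primes have the same trace on the image.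
  The condition is required for all primes between the ends, so that the induction can pass to a subchain.
\<close>

lemma (in ring_hom_cring) pchain_vimage:
  assumes C: "pchain S n p q"
    and strict: "\<And>I J. \<lbrakk>primeideal I S; primeideal J S; p \<subseteq> I; I \<subset> J; J \<subseteq> q\<rbrakk> \<Longrightarrow> \<exists>r\<in>carrier R. h r \<in> J - I"
  shows "pchain R n {r \<in> carrier R. h r \<in> p} {r \<in> carrier R. h r \<in> q}"
  using assms
proof (induction n arbitrary: p)
  case 0 then show ?case by (simp add: pchain_0 primeideal_vimage)
next
  case (Suc n)
  obtain p' where p': "primeideal p S" "p \<subset> p'" "pchain S n p' q"
    using Suc.prems(1) by (elim pchain_Suc_first)
  have "pchain R n {r \<in> carrier R. h r \<in> p'} {r \<in> carrier R. h r \<in> q}"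
  proof (rule Suc.IH[OF p'(3)])
    fix I J assume "primeideal I S" "primeideal J S" "p' \<subseteq> I" "I \<subset> J" "J \<subseteq> q"
    then show "\<exists>r\<in>carrier R. h r \<in> J - I" using Suc.prems(2)[of I J] p'(2) by auto
  qed
  moreover have "{r \<in> carrier R. h r \<in> p} \<subset> {r \<in> carrier R. h r \<in> p'}"
    using Suc.prems(2)[of p p'] p' pchain_prime(1)[OF p'(3)] pchain_subset[OF p'(3)] by blast
  ultimately show ?case using p' primeideal_vimage by (intro pchain_Cons) auto
qed

section \<open>Noetherian rings\<close>

lemma (in noetherian_ring) exists_maximal_ideal_in:
  assumes "\<And>I. I \<in> X \<Longrightarrow> ideal I R" "X \<noteq> {}"
  obtains M where "M \<in> X" "\<And>I. I \<in> X \<Longrightarrow> M \<subseteq> I \<Longrightarrow> I = M"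
proof -
  have "\<exists>U\<in>X. \<forall>c\<in>C. c \<subseteq> U" if C: "subset.chain X C" for C
  proof (cases "C = {}")
    case True
    then show ?thesis using assms(2) by auto
  next
    case False
    have CX: "C \<subseteq> X" using C by (simp add: subset_chain_def)
    then have "subset.chain {I. ideal I R} C"
      using C assms(1) by (auto simp: subset_chain_def)
    then have "\<Union>C \<in> C" using ideal_chain_is_trivial False by blast
    then show ?thesis using CX by (intro bexI[of _ "\<Union>C"]) auto
  qed
  then have "\<exists>M\<in>X. \<forall>I\<in>X. M \<subseteq> I \<longrightarrow> I = M" by (rule subset_Zorn)
  then show ?thesis using that by blast
qed

lemma (in noetherian_ring) noetherian_induct [consumes 1, case_names step]:
  assumes "ideal I R"
    and step: "\<And>I. ideal I R \<Longrightarrow> (\<And>J. ideal J R \<Longrightarrow> I \<subset> J \<Longrightarrow> Q J) \<Longrightarrow> Q I"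
  shows "Q I"
proof (rule ccontr)
  assume "\<not> Q I"
  then have "{J. ideal J R \<and> \<not> Q J} \<noteq> {}" using assms(1) by blast
  then obtain M where "M \<in> {J. ideal J R \<and> \<not> Q J}"
    "\<And>I. I \<in> {J. ideal J R \<and> \<not> Q J} \<Longrightarrow> M \<subseteq> I \<Longrightarrow> I = M"
    using exists_maximal_ideal_in[of "{J. ideal J R \<and> \<not> Q J}"] by blast
  then show False using step[of M] by blast
qed

lemma (in noetherian_ring) ascending_stable:
  fixes N :: "nat \<Rightarrow> 'a set"
  assumes "\<And>n. ideal (N n) R" "\<And>n. N n \<subseteq> N (Suc n)"
  obtains m where "\<And>n. n \<ge> m \<Longrightarrow> N n = N m"
proof -
  obtain M where M: "M \<in> range N" "\<And>I. I \<in> range N \<Longrightarrow> M \<subseteq> I \<Longrightarrow> I = M"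
    using exists_maximal_ideal_in[of "range N"] assms(1) by blast
  then obtain m where "M = N m" by blast
  then show ?thesis using that[of m] M(2) lift_Suc_mono_le[of N, OF assms(2)] by blast
qed

lemma (in cring) ideal_of_closure:
  assumes sub: "J \<subseteq> carrier R" and zero: "\<zero> \<in> J"
    and add: "\<And>a b. a \<in> J \<Longrightarrow> b \<in> J \<Longrightarrow> a \<oplus> b \<in> J"
    and mult: "\<And>r a. r \<in> carrier R \<Longrightarrow> a \<in> J \<Longrightarrow> r \<otimes> a \<in> J"
  shows "ideal J R"
proof (rule idealI)
  show "subgroup J (add_monoid R)"
  proof (rule add.subgroupI)
    fix a assume a: "a \<in> J"
    then have "\<ominus> \<one> \<otimes> a = \<ominus> a" using sub by (simp add: l_minus subsetD)
    then show "\<ominus> a \<in> J" using mult[OF _ a, of "\<ominus> \<one>"] by simp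
  qed (use sub zero add in auto)
  show "r \<otimes> a \<in> J" "a \<otimes> r \<in> J" if "a \<in> J" "r \<in> carrier R" for a r
    using mult[OF that(2,1)] m_comm[of a r] that sub by auto
qed (rule ring_axioms)

lemma (in cring) colon_ideal:
  assumes "ideal J R" "z \<in> carrier R"
  shows "ideal {r \<in> carrier R. r \<otimes> z \<in> J} R"
proof -
  interpret J: ideal J R by fact
  show ?thesis
    using assms(2) by (intro ideal_of_closure) (auto simp: l_distr m_assoc J.I_l_closed)
qed

text \<open>Among the annihilators of nonzero classes of \<open>R/J\<close>, a maximal one is prime.\<close>

lemma (in cring) exists_associated_prime:
  assumes N: "noetherian_ring R" and J: "ideal J R" "J \<noteq> carrier R"
  obtains z where "z \<in> carrier R" "z \<notin> J" "primeideal {r \<in> carrier R. r \<otimes> z \<in> J} R"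
proof -
  interpret noetherian_ring R by (rule N)
  interpret J: ideal J R by (rule J)
  let ?c = "\<lambda>z. {r \<in> carrier R. r \<otimes> z \<in> J}"
  have ne: "?c ` (carrier R - J) \<noteq> {}" using J(2) J.a_subset by blast
  obtain M where M: "M \<in> ?c ` (carrier R - J)" "\<And>I. I \<in> ?c ` (carrier R - J) \<Longrightarrow> M \<subseteq> I \<Longrightarrow> I = M"
    using exists_maximal_ideal_in[OF _ ne] colon_ideal[OF J(1)] by blast
  obtain z where z: "z \<in> carrier R" "z \<notin> J" "M = ?c z" using M(1) by blast
  have "primeideal (?c z) R"
  proof (rule primeidealI[OF colon_ideal[OF J(1) z(1)] cring_axioms])
    show "carrier R \<noteq> ?c z" using z by auto (metis (mono_tags, lifting) mem_Collect_eq l_one one_closed)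
    fix a b assume ab: "a \<in> carrier R" "b \<in> carrier R" "a \<otimes> b \<in> ?c z"
    show "a \<in> ?c z \<or> b \<in> ?c z"
    proof (rule disjCI)
      assume b: "b \<notin> ?c z"
      then have bz: "b \<otimes> z \<in> carrier R - J" using ab z by auto
      have "M \<subseteq> ?c (b \<otimes> z)"
      proof
        fix r assume "r \<in> M"
        then have r: "r \<in> carrier R" "r \<otimes> z \<in> J" using z by auto
        then have "b \<otimes> (r \<otimes> z) \<in> J" using ab J.I_l_closed by simp
        then show "r \<in> ?c (b \<otimes> z)" using r ab z by (simp add: m_lcomm)
      qed
      then have "?c (b \<otimes> z) = M" using M(2) bz by blast
      moreover have "a \<in> ?c (b \<otimes> z)" using ab z by (auto simp: m_assoc)
      ultimately show "a \<in> ?c z" using z by simp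
    qed
  qed
  then show ?thesis using that z by blast
qed

section \<open>Saturation and Nakayama's lemma\<close>

text \<open>
  The saturation is the contraction of the extension of \<open>N\<close> to the localization at \<open>P\<close>. Working with
  saturated ideals of \<open>R\<close> in place of ideals of the localization keeps several primes in play at once.
\<close>

definition saturation :: "('a, 'b) ring_scheme \<Rightarrow> 'a set \<Rightarrow> 'a set \<Rightarrow> 'a set" where
  "saturation R P N = {r \<in> carrier R. \<exists>s\<in>carrier R - P. s \<otimes>\<^bsub>R\<^esub> r \<in> N}"

text \<open>The ideal generated by \<open>x\<close> and the ideal \<open>N\<close>, in a form that exhibits its elements.\<close>

definition adjoin :: "('a, 'b) ring_scheme \<Rightarrow> 'a set \<Rightarrow> 'a \<Rightarrow> 'a set" where
  "adjoin R N x = {n \<oplus>\<^bsub>R\<^esub> c \<otimes>\<^bsub>R\<^esub> x | n c. n \<in> N \<and> c \<in> carrier R}"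

lemma (in ideal) minus_mem: "a \<in> I \<Longrightarrow> b \<in> I \<Longrightarrow> a \<ominus> b \<in> I"
  by (simp add: a_minus_def)

lemma saturatedD:
  "\<lbrakk>saturation R P N \<subseteq> N; s \<in> carrier R - P; r \<in> carrier R; s \<otimes>\<^bsub>R\<^esub> r \<in> N\<rbrakk> \<Longrightarrow> r \<in> N"
  unfolding saturation_def by blast

lemma (in abelian_monoid) set_addE:
  assumes "x \<in> A <+>\<^bsub>G\<^esub> B"
  obtains a b where "a \<in> A" "b \<in> B" "x = a \<oplus> b"
  using assms by (auto simp: set_add_def')

lemma (in primeideal) one_notin: "\<one> \<notin> I"
  using I_notcarr one_imp_carrier by blast

lemma (in primeideal) mult_notin:
  "s \<in> carrier R - I \<Longrightarrow> t \<in> carrier R - I \<Longrightarrow> s \<otimes> t \<in> carrier R - I"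
  using I_prime by auto

lemma (in cring) ideal_adjoin:
  assumes "ideal N R" "x \<in> carrier R"
  shows "ideal (adjoin R N x) R" "N \<subseteq> adjoin R N x" "x \<in> adjoin R N x"
proof -
  interpret N: ideal N R by fact
  show "ideal (adjoin R N x) R"
  proof (rule ideal_of_closure)
    show "adjoin R N x \<subseteq> carrier R" using assms by (auto simp: adjoin_def)
    show "\<zero> \<in> adjoin R N x" unfolding adjoin_def using assms(2)
      by (intro CollectI exI[of _ \<zero>]) simp
  next
    fix a b assume "a \<in> adjoin R N x" "b \<in> adjoin R N x"
    then obtain n c m d where *: "a = n \<oplus> c \<otimes> x" "n \<in> N" "c \<in> carrier R"
      "b = m \<oplus> d \<otimes> x" "m \<in> N" "d \<in> carrier R" by (auto simp: adjoin_def)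
    then have "a \<oplus> b = (n \<oplus> m) \<oplus> (c \<oplus> d) \<otimes> x" "n \<oplus> m \<in> N" "c \<oplus> d \<in> carrier R"
      using assms by (auto simp: l_distr a_ac)
    then show "a \<oplus> b \<in> adjoin R N x" unfolding adjoin_def by blast
  next
    fix r a assume r: "r \<in> carrier R" and "a \<in> adjoin R N x"
    then obtain n c where *: "a = n \<oplus> c \<otimes> x" "n \<in> N" "c \<in> carrier R" by (auto simp: adjoin_def)
    then have "r \<otimes> a = r \<otimes> n \<oplus> (r \<otimes> c) \<otimes> x" "r \<otimes> n \<in> N" "r \<otimes> c \<in> carrier R"
      using assms r by (auto simp: r_distr m_assoc N.I_l_closed)
    then show "r \<otimes> a \<in> adjoin R N x" unfolding adjoin_def by blast
  qed
  show "N \<subseteq> adjoin R N x"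
  proof
    fix n assume "n \<in> N"
    then have "n = n \<oplus> \<zero> \<otimes> x" using assms by simp
    then show "n \<in> adjoin R N x" using \<open>n \<in> N\<close> unfolding adjoin_def by blast
  qed
  show "x \<in> adjoin R N x" unfolding adjoin_def using assms
    by (intro CollectI exI[of _ \<zero>] exI[of _ \<one>]) simp
qed

lemma (in cring) ideal_saturation:
  assumes "primeideal P R" "ideal N R"
  shows "ideal (saturation R P N) R" "N \<subseteq> saturation R P N"
proof -
  interpret P: primeideal P R by fact
  interpret N: ideal N R by fact
  show "ideal (saturation R P N) R"
  proof (rule ideal_of_closure)
    show "saturation R P N \<subseteq> carrier R" by (auto simp: saturation_def)
    show "\<zero> \<in> saturation R P N" using P.one_notin unfolding saturation_def
      by (auto intro!: bexI[of _ \<one>])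
  next
    fix a b assume "a \<in> saturation R P N" "b \<in> saturation R P N"
    then obtain s t where st: "a \<in> carrier R" "b \<in> carrier R" "s \<in> carrier R - P" "s \<otimes> a \<in> N"
      "t \<in> carrier R - P" "t \<otimes> b \<in> N" by (auto simp: saturation_def)
    then have "(s \<otimes> t) \<otimes> (a \<oplus> b) = t \<otimes> (s \<otimes> a) \<oplus> s \<otimes> (t \<otimes> b)"
      by (auto simp: r_distr m_ac)
    then have "(s \<otimes> t) \<otimes> (a \<oplus> b) \<in> N" using st N.I_l_closed by simp
    then show "a \<oplus> b \<in> saturation R P N"
      using st P.mult_notin[OF st(3,5)] unfolding saturation_def by blast
  next
    fix r a assume r: "r \<in> carrier R" and "a \<in> saturation R P N"
    then obtain s where s: "a \<in> carrier R" "s \<in> carrier R - P" "s \<otimes> a \<in> N" by (auto simp: saturation_def)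
    then have "s \<otimes> (r \<otimes> a) \<in> N" using r N.I_l_closed[of "s \<otimes> a" r] by (simp add: m_lcomm)
    then show "r \<otimes> a \<in> saturation R P N" using s r unfolding saturation_def by blast
  qed
  show "N \<subseteq> saturation R P N"
    using P.one_notin N.a_subset unfolding saturation_def by (auto intro!: bexI[of _ \<one>])
qed

lemma saturation_mono: "N \<subseteq> N' \<Longrightarrow> saturation R P N \<subseteq> saturation R P N'"
  by (auto simp: saturation_def)

lemma (in cring) saturation_idem:
  assumes "primeideal P R" "s \<in> carrier R - P" "r \<in> carrier R" "s \<otimes> r \<in> saturation R P N"
  shows "r \<in> saturation R P N"
proof -
  interpret P: primeideal P R by fact
  obtain t where t: "t \<in> carrier R - P" "t \<otimes> (s \<otimes> r) \<in> N" using assms by (auto simp: saturation_def)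
  then have "(t \<otimes> s) \<otimes> r \<in> N" using assms by (simp add: m_assoc)
  then show ?thesis using assms P.mult_notin[OF t(1) assms(2)] unfolding saturation_def by blast
qed

lemma (in primeideal) saturation_prime:
  assumes "I \<subseteq> P" shows "saturation R P I \<subseteq> I"
  using I_prime assms by (auto simp: saturation_def)

lemma (in cring) saturation_adjoin_mono:
  assumes "primeideal P R" "ideal N R" "b \<in> carrier R" "b \<in> saturation R P N"
  shows "saturation R P (adjoin R N b) \<subseteq> saturation R P N"
proof
  interpret P: primeideal P R by fact
  interpret S: ideal "saturation R P N" R by (rule ideal_saturation[OF assms(1,2)])
  fix r assume "r \<in> saturation R P (adjoin R N b)"
  then obtain s where s1: "r \<in> carrier R" "s \<in> carrier R - P" "s \<otimes> r \<in> adjoin R N b"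
    unfolding saturation_def by blast
  then obtain n c where s: "r \<in> carrier R" "s \<in> carrier R - P" "n \<in> N" "c \<in> carrier R"
    "s \<otimes> r = n \<oplus> c \<otimes> b" unfolding adjoin_def by blast
  have "n \<in> saturation R P N" using ideal_saturation(2)[OF assms(1,2)] s by blast
  moreover have "c \<otimes> b \<in> saturation R P N" using assms s S.I_l_closed by simp
  ultimately have "s \<otimes> r \<in> saturation R P N" using s by simp
  then show "r \<in> saturation R P N" using saturation_idem[OF assms(1)] s by blast
qed

text \<open>
  Nakayama's lemma for \<open>(K + N)/N\<close> over the localization at \<open>P\<close>. The determinant argument is replaced by the
  removal of generators one at a time: modulo \<open>N\<close> and the generators not yet removed, the generator
  \<open>b\<close> satisfies \<open>(s - p) b = 0\<close> with \<open>p \<in> P\<close> and \<open>s \<notin> P\<close>, and \<open>s - p\<close> is a unit locally at \<open>P\<close>.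
\<close>

lemma (in cring) nakayama_saturation:
  assumes Noeth: "noetherian_ring R" and P: "primeideal P R" and K: "ideal K R" and N: "ideal N R"
    and KN: "K \<subseteq> saturation R P (N <+>\<^bsub>R\<^esub> (P \<cdot> K))"
  shows "K \<subseteq> saturation R P N"
proof -
  interpret noetherian_ring R by (rule Noeth)
  interpret P: primeideal P R by (rule P)
  interpret K: ideal K R by (rule K)
  let ?gen = "\<lambda>bs. foldr (\<lambda>b N. adjoin R N b) bs"
  have gen_ideal: "ideal (?gen bs M) R \<and> M \<subseteq> ?gen bs M \<and> set bs \<subseteq> ?gen bs M"
    if "set bs \<subseteq> carrier R" "ideal M R" for bs M
    using that
  proof (induction bs)
    case Nil then show ?case by simp
  next
    case (Cons b bs)
    then show ?case using ideal_adjoin[of "?gen bs M" b] by auto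
  qed
  have red: "K \<subseteq> saturation R P N" if "set bs \<subseteq> K" "K \<subseteq> saturation R P (?gen bs N)" for bs
    using that
  proof (induction bs)
    case Nil then show ?case by simp
  next
    case (Cons b bs)
    let ?N = "?gen bs N"
    have bK: "b \<in> K" "b \<in> carrier R" using Cons.prems K.a_subset by auto
    have N': "ideal ?N R" "N \<subseteq> ?N" using gen_ideal[of bs N] Cons.prems K.a_subset N by auto
    interpret N': ideal ?N R by (rule N')
    \<comment> \<open>Locally at \<open>P\<close>, the product \<open>P K\<close> lies in \<open>?N + P b\<close>, since \<open>K\<close> lies in \<open>?N + R b\<close>.\<close>
    have key: "\<exists>s\<in>carrier R - P. \<exists>n\<in>?N. \<exists>p\<in>P. s \<otimes> z = n \<oplus> p \<otimes> b" if "z \<in> P \<cdot> K" for z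
      using that
    proof (induction rule: ideal_prod.induct)
      case (prod p k)
      then have "k \<in> saturation R P (adjoin R ?N b)" using Cons.prems by auto
      then obtain s n c where s: "k \<in> carrier R" "s \<in> carrier R - P" "n \<in> ?N" "c \<in> carrier R"
        "s \<otimes> k = n \<oplus> c \<otimes> b" by (auto simp: saturation_def adjoin_def)
      have "s \<otimes> (p \<otimes> k) = p \<otimes> (s \<otimes> k)" using s P.Icarr[OF prod(1)] by (simp add: m_lcomm)
      also have "\<dots> = p \<otimes> n \<oplus> (p \<otimes> c) \<otimes> b"
        unfolding s using s P.Icarr[OF prod(1)] bK by (simp add: r_distr m_assoc)
      finally show ?case using s P.Icarr[OF prod(1)] N'.I_l_closed[of n p] P.I_r_closed[OF prod(1), of c] by blast
    next
      case (sum s1 s2)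
      then obtain s n p s' n' p' where s: "s \<in> carrier R - P" "n \<in> ?N" "p \<in> P" "s \<otimes> s1 = n \<oplus> p \<otimes> b"
        "s' \<in> carrier R - P" "n' \<in> ?N" "p' \<in> P" "s' \<otimes> s2 = n' \<oplus> p' \<otimes> b" by metis
      have c: "s1 \<in> carrier R" "s2 \<in> carrier R"
        using sum ideal_prod_in_carrier[OF P.ideal_axioms K] by auto
      have cc: "n \<in> carrier R" "n' \<in> carrier R" "p \<in> carrier R" "p' \<in> carrier R" "s \<in> carrier R" "s' \<in> carrier R"
        using s P.Icarr by auto
      have "(s \<otimes> s') \<otimes> (s1 \<oplus> s2) = s' \<otimes> (s \<otimes> s1) \<oplus> s \<otimes> (s' \<otimes> s2)"
        using cc c by algebra
      also have "\<dots> = (s' \<otimes> n \<oplus> s \<otimes> n') \<oplus> (s' \<otimes> p \<oplus> s \<otimes> p') \<otimes> b"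
        unfolding s using cc bK by (simp add: r_distr l_distr m_assoc a_ac)
      finally have "(s \<otimes> s') \<otimes> (s1 \<oplus> s2) = (s' \<otimes> n \<oplus> s \<otimes> n') \<oplus> (s' \<otimes> p \<oplus> s \<otimes> p') \<otimes> b" .
      moreover have "s' \<otimes> n \<oplus> s \<otimes> n' \<in> ?N" "s' \<otimes> p \<oplus> s \<otimes> p' \<in> P"
        using s cc N'.I_l_closed P.I_l_closed by auto
      ultimately show ?case using P.mult_notin[OF s(1,5)] by blast
    qed
    have "b \<in> saturation R P (N <+>\<^bsub>R\<^esub> (P \<cdot> K))" using KN bK by blast
    then obtain s n z where s: "s \<in> carrier R - P" "n \<in> N" "z \<in> P \<cdot> K" "s \<otimes> b = n \<oplus> z"
      by (auto simp: saturation_def set_add_def')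
    obtain s' n' p where s': "s' \<in> carrier R - P" "n' \<in> ?N" "p \<in> P" "s' \<otimes> z = n' \<oplus> p \<otimes> b"
      using key[OF s(3)] by blast
    have cc: "n \<in> carrier R" "n' \<in> carrier R" "p \<in> carrier R" "s \<in> carrier R" "s' \<in> carrier R" "z \<in> carrier R"
      "n \<in> ?N"
      using s s' P.Icarr N' ideal_prod_in_carrier[OF P.ideal_axioms K] by auto
    have "(s' \<otimes> s) \<otimes> b = s' \<otimes> n \<oplus> (n' \<oplus> p \<otimes> b)"
      using cc bK s(4) s'(4) by (simp add: m_assoc r_distr)
    then have "(s' \<otimes> s \<ominus> p) \<otimes> b = s' \<otimes> n \<oplus> n'"
      using cc bK by algebra
    then have 1: "(s' \<otimes> s \<ominus> p) \<otimes> b \<in> ?N" using cc s' N'.I_l_closed by simp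
    have "s' \<otimes> s \<ominus> p \<notin> P"
    proof
      assume "s' \<otimes> s \<ominus> p \<in> P"
      then have "(s' \<otimes> s \<ominus> p) \<oplus> p \<in> P" using s' by simp
      moreover have "(s' \<otimes> s \<ominus> p) \<oplus> p = s' \<otimes> s" using cc by algebra
      ultimately show False using P.mult_notin[OF s'(1) s(1)] by simp
    qed
    then have "b \<in> saturation R P ?N" using 1 bK cc unfolding saturation_def by blast
    then have "K \<subseteq> saturation R P ?N"
      using Cons.prems saturation_adjoin_mono[OF P N'(1) bK(2)] by auto
    then show ?case using Cons by auto
  qed
  obtain A where A: "A \<subseteq> carrier R" "finite A" "K = Idl A" using finetely_gen[OF K] by blast
  obtain bs where bs: "set bs = A" using A(2) finite_list by blast
  have "A \<subseteq> ?gen bs N" "ideal (?gen bs N) R" using gen_ideal[of bs N] A bs N by auto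
  then have "K \<subseteq> ?gen bs N" using genideal_minimal A by metis
  moreover have "set bs \<subseteq> K" using bs A genideal_self by blast
  ultimately show ?thesis
    using red[of bs] ideal_saturation(2)[OF P \<open>ideal (?gen bs N) R\<close>] by blast
qed

section \<open>The principal ideal theorem\<close>

text \<open>
  Locally at \<open>P\<close> the ring \<open>R/J\<close> has only one prime ideal, so it is Artinian. The descending chain condition
  above a saturated ideal \<open>B \<supseteq> J\<close> follows by Noetherian induction on \<open>B\<close>. The associated prime of \<open>B\<close>
  has to be \<open>P\<close>; it provides \<open>z \<notin> B\<close> with \<open>P z \<subseteq> B\<close>. Let \<open>B'\<close> be the saturation of \<open>B + R z\<close>. Locally \<open>B'/B\<close> is simple.
  So a chain above \<open>B\<close> either stays above \<open>B'\<close> or finally meets \<open>B'\<close> in \<open>B\<close>; in the latter case it is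
  controlled by its sum with \<open>B'\<close>, by the modular law.
\<close>

lemma (in cring) descending_stable_saturated:
  assumes Noeth: "noetherian_ring R" and P: "primeideal P R"
    and J: "ideal J R"
    and min: "\<And>p. primeideal p R \<Longrightarrow> J \<subseteq> p \<Longrightarrow> p \<subseteq> P \<Longrightarrow> p = P"
    and sat: "saturation R P J \<subseteq> J"
    and N: "\<And>n. ideal (N n) R" "\<And>n. N (Suc n) \<subseteq> N n" "\<And>n. J \<subseteq> N n" "\<And>n. saturation R P (N n) \<subseteq> N n"
  shows "\<exists>n. N (Suc n) = N n"
proof -
  interpret noetherian_ring R by (rule Noeth)
  interpret P: primeideal P R by (rule P)
  have "\<forall>N. (\<forall>n. ideal (N n) R) \<longrightarrow> (\<forall>n. N (Suc n) \<subseteq> N n) \<longrightarrow> (\<forall>n. J' \<subseteq> N n) \<longrightarrow>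
      (\<forall>n. saturation R P (N n) \<subseteq> N n) \<longrightarrow> (\<exists>m. \<forall>n\<ge>m. N n = N m)"
    if "ideal J' R" "J \<subseteq> J'" "saturation R P J' \<subseteq> J'" for J'
    using that
  proof (induction rule: noetherian_induct)
    case (step B)
    show ?case
    proof (intro allI impI)
      fix N :: "nat \<Rightarrow> 'a set"
      assume N: "\<forall>n. ideal (N n) R" "\<forall>n. N (Suc n) \<subseteq> N n" "\<forall>n. B \<subseteq> N n" "\<forall>n. saturation R P (N n) \<subseteq> N n"
      interpret B: ideal B R by (rule step)
      show "\<exists>m. \<forall>n\<ge>m. N n = N m"
      proof (cases "B = carrier R")
        case True
        have "N n = carrier R" for n
        proof -
          interpret Nn: ideal "N n" R using N by blast
          show ?thesis using True N(3) Nn.a_subset by blast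
        qed
        then show ?thesis by simp
      next
        case False
        obtain z where z: "z \<in> carrier R" "z \<notin> B" and pz: "primeideal {r \<in> carrier R. r \<otimes> z \<in> B} R"
          using exists_associated_prime[OF Noeth step(1) False] by blast
        have "J \<subseteq> {r \<in> carrier R. r \<otimes> z \<in> B}"
          using step.prems(1) B.I_r_closed z B.a_subset by blast
        moreover have "{r \<in> carrier R. r \<otimes> z \<in> B} \<subseteq> P"
          using step.prems(2) z unfolding saturation_def by blast
        ultimately have zP: "{r \<in> carrier R. r \<otimes> z \<in> B} = P" using min pz by blast
        let ?B = "saturation R P (adjoin R B z)"
        note adj = ideal_adjoin[OF step(1) z(1)]
        have B': "ideal ?B R" "B \<subset> ?B" "J \<subseteq> ?B" "saturation R P ?B \<subseteq> ?B"
          using ideal_saturation[OF P adj(1)] adj step.prems z saturation_idem[OF P, of _ _ "adjoin R B z"]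
          by (blast, blast, blast, auto simp: saturation_def[of R P "saturation R P _"])
        note IH = step.IH[OF B'(1,2), rule_format, OF B'(3,4)]
        show ?thesis
        proof (cases "\<forall>n. z \<in> N n")
          case True
          have "?B \<subseteq> N n" for n
          proof -
            interpret Nn: ideal "N n" R using N by blast
            have "adjoin R B z \<subseteq> N n"
              using True N(3) Nn.I_l_closed Nn.a_closed z(1) unfolding adjoin_def by blast
            then show ?thesis using saturation_mono N(4) by blast
          qed
          then show ?thesis using IH[of N] N by blast
        next
          case False
          have anti: "N m \<subseteq> N n" if "n \<le> m" for n m using that lift_Suc_antimono_le[of N] N(2) by blast
          obtain n1 where n1: "z \<notin> N n1" using False by blast
          then have zN: "z \<notin> N n" if "n \<ge> n1" for n using anti that by blast
          let ?N = "\<lambda>n. saturation R P (N n <+>\<^bsub>R\<^esub> ?B)"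
          have id: "ideal (N n <+>\<^bsub>R\<^esub> ?B) R" for n using add_ideals N B' by blast
          have sub: "N n \<subseteq> N n <+>\<^bsub>R\<^esub> ?B" "?B \<subseteq> N n <+>\<^bsub>R\<^esub> ?B" for n
          proof -
            interpret Nn: ideal "N n" R using N by blast
            interpret B'': ideal ?B R using B' by blast
            show "N n \<subseteq> N n <+>\<^bsub>R\<^esub> ?B" unfolding set_add_def' using B''.zero_closed Nn.Icarr by (force intro: r_zero[symmetric])
            show "?B \<subseteq> N n <+>\<^bsub>R\<^esub> ?B" unfolding set_add_def' using Nn.zero_closed B''.Icarr by (force intro: l_zero[symmetric])
          qed
          have "\<exists>m. \<forall>n\<ge>m. ?N n = ?N m"
          proof (rule IH)
            fix n
            show "ideal (?N n) R" using ideal_saturation[OF P id] by blast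
            have "N (Suc n) <+>\<^bsub>R\<^esub> ?B \<subseteq> N n <+>\<^bsub>R\<^esub> ?B" unfolding set_add_def' using N(2) by blast
            then show "?N (Suc n) \<subseteq> ?N n" by (rule saturation_mono)
            show "?B \<subseteq> ?N n" using sub ideal_saturation[OF P id] by blast
            show "saturation R P (?N n) \<subseteq> ?N n"
              using saturation_idem[OF P, of _ _ "N n <+>\<^bsub>R\<^esub> ?B"] by (auto simp: saturation_def[of R P "saturation R P (_ <+>\<^bsub>R\<^esub> _)"])
          qed
          then obtain m where m: "\<And>n. n \<ge> m \<Longrightarrow> ?N n = ?N m" by blast
          have "N n = N (max m n1)" if n: "n \<ge> max m n1" for n
          proof
            let ?k = "max m n1"
            show "N n \<subseteq> N ?k" using anti n by blast
            show "N ?k \<subseteq> N n"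
            proof
              fix r assume r: "r \<in> N ?k"
              interpret Nk: ideal "N ?k" R using N by blast
              interpret Nn: ideal "N n" R using N by blast
              have rc: "r \<in> carrier R" using r Nk.Icarr by blast
              have "r \<in> ?N ?k" using r sub ideal_saturation[OF P id] by blast
              also have "?N ?k = ?N n" using m[of ?k] m[of n] n by simp
              finally obtain s where s1: "s \<in> carrier R - P" "s \<otimes> r \<in> N n <+>\<^bsub>R\<^esub> ?B"
                unfolding saturation_def[of R P "_ <+>\<^bsub>R\<^esub> _"] by blast
              from s1(2) obtain r' b where "r' \<in> N n" "b \<in> ?B" "s \<otimes> r = r' \<oplus> b"
                by (rule set_addE)
              then have s: "s \<in> carrier R - P" "r' \<in> N n" "b \<in> ?B" "s \<otimes> r = r' \<oplus> b" using s1 by auto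
              have bc: "b \<in> carrier R" "r' \<in> carrier R" using s(2,3) ideal.Icarr[OF B'(1)] Nn.Icarr by auto
              have "b = s \<otimes> r \<ominus> r'" unfolding s(4) using bc by algebra
              moreover have "r' \<in> N ?k" using s anti n by blast
              ultimately have bN: "b \<in> N ?k" using r s(1) Nk.I_l_closed Nk.minus_mem by auto
              obtain t a c where t: "t \<in> carrier R - P" "a \<in> B" "c \<in> carrier R" "t \<otimes> b = a \<oplus> c \<otimes> z"
                using s(3) unfolding saturation_def adjoin_def by blast
              have "c \<in> P"
              proof (rule ccontr)
                assume "c \<notin> P"
                have "c \<otimes> z = t \<otimes> b \<ominus> a" unfolding t(4) using t(3) B.Icarr[OF t(2)] z(1) by algebra
                moreover have "t \<otimes> b \<in> N ?k" using t(1) bN Nk.I_l_closed by blast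
                moreover have "a \<in> N ?k" using t(2) N(3) by blast
                ultimately have "c \<otimes> z \<in> N ?k" using Nk.minus_mem by simp
                then have "z \<in> N ?k" using saturatedD[of R P "N ?k" c z] t(3) z(1) \<open>c \<notin> P\<close> N(4) by blast
                then show False using zN[of ?k] by simp
              qed
              then have "c \<otimes> z \<in> B" using zP by blast
              then have "t \<otimes> b \<in> B" using t by simp
              then have "b \<in> B" using saturatedD[OF step.prems(2) t(1) bc(1)] by simp
              then have "s \<otimes> r \<in> N n" using s N(3) by auto
              then show "r \<in> N n" using saturatedD[OF _ s(1) rc] N(4) by blast
            qed
          qed
          then show ?thesis by blast
        qed
      qed
    qed
  qed
  from this[OF J order_refl sat, rule_format, of N, OF N] obtain m where "\<forall>n\<ge>m. N n = N m" by blast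
  then have "N (Suc m) = N m" using le_SucI[OF order_refl] by blast
  then show ?thesis by blast
qed


lemma (in ring) set_add_supset:
  assumes "ideal I R" "ideal J R"
  shows "I \<subseteq> I <+>\<^bsub>R\<^esub> J" "J \<subseteq> I <+>\<^bsub>R\<^esub> J"
proof -
  interpret I: ideal I R by fact
  interpret J: ideal J R by fact
  show "I \<subseteq> I <+>\<^bsub>R\<^esub> J" unfolding set_add_def' using J.zero_closed I.Icarr by (force intro: r_zero[symmetric])
  show "J \<subseteq> I <+>\<^bsub>R\<^esub> J" unfolding set_add_def' using I.zero_closed J.Icarr by (force intro: l_zero[symmetric])
qed

text \<open>
  Krull's principal ideal theorem in relative form. Suppose that no prime strictly below \<open>P2\<close> contains \<open>P0\<close> and
  \<open>x\<close>. Let \<open>K n\<close> be the \<open>n\<close>-th symbolic power of \<open>P1\<close> modulo \<open>P0\<close>. Locally at \<open>P2\<close>, the ring modulo \<open>P0 + R x\<close> is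
  Artinian, so \<open>K n \<subseteq> K (n + 1) + R x\<close> for some \<open>n\<close>. As \<open>x \<notin> P1\<close>, the multiple of \<open>x\<close> is even in \<open>x K n\<close>, and
  Nakayama's lemma at \<open>P2\<close> gives \<open>K n = K (n + 1)\<close>. Then Nakayama's lemma at \<open>P1\<close> forces \<open>K n \<subseteq> P0\<close>,
  which contradicts \<open>P0 \<subset> P1\<close>.
\<close>

lemma (in cring) prime_between_containing:
  assumes Noeth: "noetherian_ring R"
    and prime: "primeideal P0 R" "primeideal P1 R" "primeideal P2 R"
    and sub: "P0 \<subset> P1" "P1 \<subset> P2" and x: "x \<in> P2"
  obtains p where "primeideal p R" "P0 \<subset> p" "p \<subset> P2" "x \<in> p"
proof (cases "x \<in> P1")
  case True
  then show ?thesis using that[of P1] prime sub by blast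
next
  case x1: False
  note thesis_rule = that
  interpret noetherian_ring R by (rule Noeth)
  interpret P0: primeideal P0 R by (rule prime)
  interpret P1: primeideal P1 R by (rule prime)
  interpret P2: primeideal P2 R by (rule prime)
  have xc: "x \<in> carrier R" using x P2.Icarr by blast
  have x0: "x \<notin> P0" using x1 sub by blast
  show ?thesis
  proof (rule ccontr)
    assume "\<not> thesis"
    then have no: "p = P2" if "primeideal p R" "P0 \<subseteq> p" "x \<in> p" "p \<subseteq> P2" for p
      using that assms(1) \<open>\<not> thesis\<close> x0 thesis_rule by (metis psubsetI)
    define step where "step L = saturation R P1 (P0 <+>\<^bsub>R\<^esub> (P1 \<cdot> L))" for L
    define K where "K n = (step ^^ n) (carrier R)" for n
    have KS: "K (Suc n) = saturation R P1 (P0 <+>\<^bsub>R\<^esub> (P1 \<cdot> K n))" for n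
      by (simp add: K_def step_def)
    have Kid: "ideal (K n) R" for n
    proof (induction n)
      case 0 then show ?case by (simp add: K_def oneideal)
    next
      case (Suc n)
      then show ?case unfolding KS
        by (intro ideal_saturation(1) prime add_ideals ideal_prod_is_ideal P0.ideal_axioms P1.ideal_axioms)
    qed
    have prod: "ideal (P1 \<cdot> K n) R" for n using Kid ideal_prod_is_ideal P1.ideal_axioms by blast
    have sumid: "ideal (P0 <+>\<^bsub>R\<^esub> (P1 \<cdot> K n)) R" for n using prod add_ideals P0.ideal_axioms by blast
    have P0K: "P0 \<subseteq> K n" for n
    proof (cases n)
      case 0 then show ?thesis using P0.a_subset by (simp add: K_def)
    next
      case (Suc m)
      then show ?thesis using KS[of m] set_add_supset(1)[OF P0.ideal_axioms prod]
        ideal_saturation(2)[OF prime(2) sumid] by blast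
    qed
    have Ksat: "r \<in> K n" if "s \<in> carrier R - P1" "r \<in> carrier R" "s \<otimes> r \<in> K n" for r s n
    proof (cases n)
      case 0 then show ?thesis using that by (simp add: K_def)
    next
      case (Suc m)
      then show ?thesis using that saturation_idem[OF prime(2)] unfolding Suc KS by blast
    qed
    have Kanti: "K (Suc n) \<subseteq> K n" for n
    proof
      fix r assume "r \<in> K (Suc n)"
      then obtain s where s: "r \<in> carrier R" "s \<in> carrier R - P1" "s \<otimes> r \<in> P0 <+>\<^bsub>R\<^esub> (P1 \<cdot> K n)"
        unfolding KS saturation_def by blast
      interpret Kn: ideal "K n" R by (rule Kid)
      have "P1 \<cdot> K n \<subseteq> K n" using ideal_prod_inter[OF P1.ideal_axioms Kid] by blast
      then have "s \<otimes> r \<in> K n" using set_addE[OF s(3)] P0K[of n] Kn.a_closed by (metis subsetD)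
      then show "r \<in> K n" using Ksat s by blast
    qed
    \<comment> \<open>A product of elements outside the prime \<open>P0\<close> stays outside; this is where \<open>P0 \<noteq> P1\<close> enters.\<close>
    have notP0: "\<not> K n \<subseteq> P0" for n
    proof (induction n)
      case 0 then show ?case using P0.one_notin by (auto simp: K_def)
    next
      case (Suc n)
      then obtain k where k: "k \<in> K n" "k \<notin> P0" by blast
      obtain q where q: "q \<in> P1" "q \<notin> P0" using sub by blast
      have "q \<otimes> k \<in> P1 \<cdot> K n" using k q by (intro ideal_prod.prod)
      then have "q \<otimes> k \<in> K (Suc n)"
        using KS set_add_supset(2)[OF P0.ideal_axioms prod] ideal_saturation(2)[OF prime(2) sumid] by blast
      moreover have "q \<otimes> k \<notin> P0" using k q P0.I_prime P1.Icarr ideal.Icarr[OF Kid] by blast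
      ultimately show ?case by blast
    qed
    define J where "J = saturation R P2 (adjoin R P0 x)"
    note adj = ideal_adjoin[OF P0.ideal_axioms xc]
    have J: "ideal J R" "P0 \<subseteq> J" "x \<in> J"
      using ideal_saturation[OF prime(3) adj(1)] adj by (auto simp: J_def)
    define N where "N n = saturation R P2 (K n <+>\<^bsub>R\<^esub> J)" for n
    have KJ: "ideal (K n <+>\<^bsub>R\<^esub> J) R" for n using add_ideals Kid J by blast
    have "\<exists>n. N (Suc n) = N n"
    proof (rule descending_stable_saturated[OF Noeth prime(3) J(1)])
      fix p assume "primeideal p R" "J \<subseteq> p" "p \<subseteq> P2"
      then show "p = P2" using no J by blast
    next
      show "saturation R P2 J \<subseteq> J"
        using saturation_idem[OF prime(3)] unfolding J_def by (auto simp: saturation_def[of R P2 "saturation R P2 _"])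
    next
      fix n
      show "ideal (N n) R" unfolding N_def by (rule ideal_saturation(1)[OF prime(3) KJ])
      have "K (Suc n) <+>\<^bsub>R\<^esub> J \<subseteq> K n <+>\<^bsub>R\<^esub> J" unfolding set_add_def' using Kanti by blast
      then show "N (Suc n) \<subseteq> N n" unfolding N_def by (rule saturation_mono)
      show "J \<subseteq> N n" unfolding N_def
        using set_add_supset(2)[OF Kid J(1)] ideal_saturation(2)[OF prime(3) KJ] by blast
      show "saturation R P2 (N n) \<subseteq> N n"
        using saturation_idem[OF prime(3)] unfolding N_def by (auto simp: saturation_def[of R P2 "saturation R P2 _"])
    qed
    then obtain n where n: "N (Suc n) = N n" by blast
    interpret Kn: ideal "K n" R by (rule Kid)
    have "K n \<subseteq> saturation R P2 (K (Suc n) <+>\<^bsub>R\<^esub> (P2 \<cdot> K n))"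
    proof
      fix r assume r: "r \<in> K n"
      then have rc: "r \<in> carrier R" by (rule Kn.Icarr)
      have "r \<in> N n" using r set_add_supset(1)[OF Kid J(1)] ideal_saturation(2)[OF prime(3) KJ]
        unfolding N_def by blast
      then have "r \<in> saturation R P2 (K (Suc n) <+>\<^bsub>R\<^esub> J)" using n by (simp add: N_def)
      then obtain s where s: "s \<in> carrier R - P2" "s \<otimes> r \<in> K (Suc n) <+>\<^bsub>R\<^esub> J"
        unfolding saturation_def by blast
      then obtain k j where kj: "k \<in> K (Suc n)" "j \<in> J" "s \<otimes> r = k \<oplus> j"
        by (auto simp: set_add_def')
      obtain t where t: "t \<in> carrier R - P2" "t \<otimes> j \<in> adjoin R P0 x"
        using kj(2) unfolding J_def saturation_def by blast
      then obtain a c where ac: "a \<in> P0" "c \<in> carrier R" "t \<otimes> j = a \<oplus> c \<otimes> x"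
        unfolding adjoin_def by blast
      interpret KS: ideal "K (Suc n)" R by (rule Kid)
      have cc: "k \<in> carrier R" "j \<in> carrier R" "a \<in> carrier R" "s \<in> carrier R" "t \<in> carrier R"
        using kj ac s t KS.Icarr ideal.Icarr[OF J(1)] P0.Icarr by auto
      have eq: "(t \<otimes> s) \<otimes> r = (t \<otimes> k \<oplus> a) \<oplus> x \<otimes> c"
      proof -
        have "(t \<otimes> s) \<otimes> r = t \<otimes> (k \<oplus> j)" using cc rc kj(3)[symmetric] by (simp add: m_assoc)
        also have "\<dots> = t \<otimes> k \<oplus> (a \<oplus> c \<otimes> x)" using cc ac(3)[symmetric] by (simp add: r_distr)
        also have "\<dots> = (t \<otimes> k \<oplus> a) \<oplus> x \<otimes> c" using cc xc ac(2) by (simp add: a_assoc m_comm)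
        finally show ?thesis .
      qed
      have ka: "t \<otimes> k \<oplus> a \<in> K (Suc n)" using cc kj KS.I_l_closed ac P0K by blast
      then have kan: "t \<otimes> k \<oplus> a \<in> K n" using Kanti by blast
      have "x \<otimes> c = (t \<otimes> s) \<otimes> r \<ominus> (t \<otimes> k \<oplus> a)"
        unfolding eq using cc xc ac by algebra
      then have "x \<otimes> c \<in> K n" using r kan cc Kn.I_l_closed by (simp add: a_minus_def)
      then have "c \<in> K n" using Ksat[of x c n] x1 xc ac by blast
      then have "x \<otimes> c \<in> P2 \<cdot> K n" using x by (intro ideal_prod.prod)
      then have "(t \<otimes> s) \<otimes> r \<in> K (Suc n) <+>\<^bsub>R\<^esub> (P2 \<cdot> K n)"
        unfolding eq set_add_def' using ka by blast
      then show "r \<in> saturation R P2 (K (Suc n) <+>\<^bsub>R\<^esub> (P2 \<cdot> K n))"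
        using P2.mult_notin[OF t(1) s(1)] rc unfolding saturation_def by blast
    qed
    then have "K n \<subseteq> saturation R P2 (K (Suc n))"
      by (rule nakayama_saturation[OF Noeth prime(3) Kid Kid])
    moreover have "saturation R P2 (K (Suc n)) \<subseteq> K (Suc n)"
      using Ksat sub(2) unfolding saturation_def by blast
    ultimately have "K n \<subseteq> saturation R P1 (P0 <+>\<^bsub>R\<^esub> (P1 \<cdot> K n))"
      using KS by blast
    then have "K n \<subseteq> saturation R P1 P0"
      by (rule nakayama_saturation[OF Noeth prime(2) Kid P0.ideal_axioms])
    also have "\<dots> \<subseteq> P0" using P0.saturation_prime[of P1] sub by auto
    finally show False using notP0 by simp
  qed
qed

text \<open>The prescribed element is pushed down the chain, one link at a time, by \<open>prime_between_containing\<close>.\<close>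

lemma (in cring) pchain_containing:
  assumes Noeth: "noetherian_ring R" and "pchain R (Suc n) p q" "x \<in> q"
  obtains p' where "p \<subset> p'" "x \<in> p'" "pchain R n p' q"
proof -
  have "\<exists>p'. p \<subset> p' \<and> x \<in> p' \<and> pchain R n p' q" using assms(2,3)
  proof (induction n arbitrary: q)
    case 0
    then show ?case by (elim pchain_Suc_last) (auto simp: pchain_0)
  next
    case (Suc n)
    obtain v where v: "primeideal q R" "v \<subset> q" "pchain R (Suc n) p v"
      using Suc.prems(1) by (rule pchain_Suc_last)
    obtain u where u: "primeideal v R" "u \<subset> v" "pchain R n p u"
      using v(3) by (rule pchain_Suc_last)
    obtain w where w: "primeideal w R" "u \<subset> w" "w \<subset> q" "x \<in> w"
      using prime_between_containing[OF Noeth pchain_prime(2)[OF u(3)] u(1) v(1) u(2) v(2) Suc.prems(2)] by blast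
    obtain p' where "p \<subset> p'" "x \<in> p'" "pchain R n p' w"
      using Suc.IH[OF pchain_snoc[OF u(3) w(1,2)] w(4)] by blast
    then show ?case using pchain_snoc[OF _ v(1) w(3)] by blast
  qed
  then show ?thesis using that by blast
qed

section \<open>Hilbert's basis theorem\<close>

lemma (in cring) add_minus_cancel:
  assumes "x \<in> carrier R" "y \<in> carrier R"
  shows "(x \<oplus> y) \<ominus> x = y" "(x \<oplus> y) \<ominus> y = x" "(x \<ominus> y) \<oplus> y = x"
  using assms by algebra+

lemma (in abelian_monoid) finsum_mem:
  assumes "H \<subseteq> carrier G" "\<zero> \<in> H" "\<And>x y. x \<in> H \<Longrightarrow> y \<in> H \<Longrightarrow> x \<oplus> y \<in> H"
    and "\<And>i. i \<in> A \<Longrightarrow> f i \<in> H"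
  shows "finsum G f A \<in> H"
  using assms(4)
proof (induction A rule: infinite_finite_induct)
  case (insert x A)
  then have "f \<in> A \<rightarrow> carrier G" "f x \<in> carrier G" using assms(1) by auto
  then show ?case using insert assms by simp
qed (use assms in auto)

lemma (in UP_ring) poly_mem:
  assumes p: "p \<in> carrier P" and H: "H \<subseteq> carrier P" "\<zero>\<^bsub>P\<^esub> \<in> H" "\<And>x y. x \<in> H \<Longrightarrow> y \<in> H \<Longrightarrow> x \<oplus>\<^bsub>P\<^esub> y \<in> H"
    and mon: "\<And>i. monom P (coeff P p i) i \<in> H"
  shows "p \<in> H"
proof -
  have "(\<Oplus>\<^bsub>P\<^esub> i \<in> {..deg R p}. monom P (coeff P p i) i) \<in> H"
    by (rule P.finsum_mem[OF H mon])
  then show ?thesis using up_repr[OF p] by simp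
qed

lemma (in UP_cring) poly_mem_ideal:
  assumes p: "p \<in> carrier P" and J: "ideal J P" and mon: "\<And>i. monom P (coeff P p i) 0 \<in> J"
  shows "p \<in> J"
proof -
  interpret J: ideal J P by fact
  show ?thesis
  proof (rule poly_mem[OF p J.a_subset J.zero_closed J.a_closed])
    fix i
    have "monom P (coeff P p i) i = monom P \<one> i \<otimes>\<^bsub>P\<^esub> monom P (coeff P p i) 0"
      using p by (simp flip: monom_mult)
    then show "monom P (coeff P p i) i \<in> J" using mon J.I_l_closed by simp
  qed
qed

lemma (in UP_cring) ideal_lcoeffs:
  assumes J: "ideal J P"
  shows "ideal {coeff P f n | f. f \<in> J \<and> deg R f \<le> n} R"
proof -
  interpret J: ideal J P by fact
  let ?L = "{coeff P f n | f. f \<in> J \<and> deg R f \<le> n}"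
  have mult: "r \<otimes> a \<in> ?L" if r: "r \<in> carrier R" and a: "a \<in> ?L" for r a
  proof -
    obtain f where f: "a = coeff P f n" "f \<in> J" "deg R f \<le> n" using a by blast
    then have "f \<in> carrier P" by auto
    moreover have "monom P r 0 \<otimes>\<^bsub>P\<^esub> f \<in> J" using f r J.I_l_closed by simp
    ultimately have "r \<odot>\<^bsub>P\<^esub> f \<in> J" "coeff P (r \<odot>\<^bsub>P\<^esub> f) n = r \<otimes> a" "deg R (r \<odot>\<^bsub>P\<^esub> f) \<le> n"
      using r f deg_smult_decr[of r f] by (auto simp: monom_mult_is_smult)
    then show ?thesis by (metis (mono_tags, lifting) mem_Collect_eq)
  qed
  show ?thesis
  proof (rule R.ideal_of_closure[OF _ _ _ mult])
    show "?L \<subseteq> carrier R" by auto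
    have "coeff P \<zero>\<^bsub>P\<^esub> n \<in> ?L" by (intro CollectI exI[of _ "\<zero>\<^bsub>P\<^esub>"]) simp
    then show "\<zero> \<in> ?L" by simp
    fix a b assume "a \<in> ?L" "b \<in> ?L"
    then obtain f g where fg: "a = coeff P f n" "f \<in> J" "deg R f \<le> n" "b = coeff P g n" "g \<in> J" "deg R g \<le> n" by blast
    then have c: "f \<in> carrier P" "g \<in> carrier P" by auto
    have "deg R (f \<oplus>\<^bsub>P\<^esub> g) \<le> n" using deg_add[OF c] fg(3,6) by (meson max.boundedI order_trans)
    then have "f \<oplus>\<^bsub>P\<^esub> g \<in> J" "a \<oplus> b = coeff P (f \<oplus>\<^bsub>P\<^esub> g) n" "deg R (f \<oplus>\<^bsub>P\<^esub> g) \<le> n"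
      using fg c by auto
    then show "a \<oplus> b \<in> ?L" by blast
  qed
qed

text \<open>
  An element of \<open>J\<close> of degree at most \<open>d\<close> loses its coefficient at \<open>d\<close> upon subtraction of a suitable
  element of \<open>K\<close>, so induction on the degree applies.
\<close>

lemma (in UP_cring) ideal_eq_lcoeffs:
  assumes J: "ideal J P" and K: "ideal K P" and KJ: "K \<subseteq> J"
    and L: "\<And>n. {coeff P f n | f. f \<in> J \<and> deg R f \<le> n} \<subseteq> {coeff P f n | f. f \<in> K \<and> deg R f \<le> n}"
  shows "J \<subseteq> K"
proof -
  interpret J: ideal J P by fact
  interpret K: ideal K P by fact
  have "f \<in> K" if "f \<in> J" "\<And>i. i \<ge> d \<Longrightarrow> coeff P f i = \<zero>" for f d
    using that
  proof (induction d arbitrary: f)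
    case 0
    then have "f = \<zero>\<^bsub>P\<^esub>" by (intro up_eqI) auto
    then show ?case by simp
  next
    case (Suc d)
    have fc: "f \<in> carrier P" using Suc.prems by auto
    then have deg: "deg R f \<le> d" using Suc.prems(2) by (intro deg_aboveI) auto
    then have "coeff P f d \<in> {coeff P f d | f. f \<in> K \<and> deg R f \<le> d}" using L[of d] Suc.prems(1) by blast
    then obtain g where g: "g \<in> K" "deg R g \<le> d" "coeff P f d = coeff P g d" by blast
    have gc: "g \<in> carrier P" using g by auto
    have "f \<ominus>\<^bsub>P\<^esub> g \<in> K"
    proof (rule Suc.IH)
      show "f \<ominus>\<^bsub>P\<^esub> g \<in> J" using Suc.prems(1) g KJ by (auto simp: a_minus_def)
      show "coeff P (f \<ominus>\<^bsub>P\<^esub> g) i = \<zero>" if "i \<ge> d" for i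
      proof (cases "i = d")
        case True then show ?thesis using fc gc g by (simp add: R.r_neg a_minus_def)
      next
        case False
        then have "coeff P g i = \<zero>" using that g gc by (intro deg_aboveD) auto
        then show ?thesis using fc gc Suc.prems(2)[of i] False that by (simp add: a_minus_def)
      qed
    qed
    then have "(f \<ominus>\<^bsub>P\<^esub> g) \<oplus>\<^bsub>P\<^esub> g \<in> K" using g by simp
    moreover have "(f \<ominus>\<^bsub>P\<^esub> g) \<oplus>\<^bsub>P\<^esub> g = f" using fc gc by (simp add: a_minus_def P.a_assoc P.l_neg)
    ultimately show ?case by simp
  qed
  moreover have "coeff P f i = \<zero>" if "f \<in> J" "i \<ge> Suc (deg R f)" for f i
    using that J.Icarr by (intro deg_aboveD) auto
  ultimately show ?thesis by blast
qed

text \<open>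
  The coefficient ideals of \<open>J\<close> increase with the degree and become constant at some \<open>m\<close>. Polynomials that
  realize finitely many generators of the coefficient ideals up to \<open>m\<close> generate an ideal with the same
  coefficient ideals as \<open>J\<close>.
\<close>

theorem (in UP_cring) hilbert_basis:
  assumes "noetherian_ring R"
  shows "noetherian_ring P"
proof (rule P.noetherian_ringI)
  interpret noetherian_ring R by fact
  fix J assume J: "ideal J P"
  interpret J: ideal J P by fact
  define L where "L K n = {coeff P f n | f. f \<in> K \<and> deg R f \<le> n}" for K n
  have Lid: "ideal (L K n) R" if "ideal K P" for K n
    unfolding L_def by (rule ideal_lcoeffs[OF that])
  have Lmono: "L K n \<subseteq> L K (Suc n)" if K: "ideal K P" for K n
  proof
    interpret K: ideal K P by fact
    fix a assume "a \<in> L K n"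
    then obtain f where f: "a = coeff P f n" "f \<in> K" "deg R f \<le> n" by (auto simp: L_def)
    then have fc: "f \<in> carrier P" by auto
    let ?g = "monom P \<one> 1 \<otimes>\<^bsub>P\<^esub> f"
    have "?g \<in> K" using f K.I_l_closed by simp
    moreover have "coeff P ?g (Suc n) = a" using coeff_monom_mult[of \<one> f 1 n] f fc by simp
    moreover have "deg R ?g \<le> Suc n"
      using deg_mult_ring[of "monom P \<one> 1" f] deg_monom_le[of \<one> 1] f fc by simp
    ultimately show "a \<in> L K (Suc n)" unfolding L_def by blast
  qed
  obtain m where m: "\<And>n. n \<ge> m \<Longrightarrow> L J n = L J m"
    using ascending_stable[of "L J"] Lid[OF J] Lmono[OF J] by blast
  have "\<exists>A. A \<subseteq> carrier R \<and> finite A \<and> L J n = Idl A" for n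
    using finetely_gen[OF Lid[OF J]] by blast
  then have "\<exists>A. \<forall>n. A n \<subseteq> carrier R \<and> finite (A n) \<and> L J n = Idl (A n)" by (intro choice) blast
  then obtain A where A: "\<And>n. A n \<subseteq> carrier R" "\<And>n. finite (A n)" "\<And>n. L J n = Idl (A n)" by blast
  have "\<exists>f. f \<in> J \<and> deg R f \<le> n \<and> coeff P f n = a" if "a \<in> A n" for a n
  proof -
    have "a \<in> L J n" using that A(3)[of n] R.genideal_self[OF A(1)[of n]] by blast
    then show ?thesis by (auto simp: L_def)
  qed
  note lift = this
  define f where "f n a = (SOME f. f \<in> J \<and> deg R f \<le> n \<and> coeff P f n = a)" for n a
  have f: "f n a \<in> J \<and> deg R (f n a) \<le> n \<and> coeff P (f n a) n = a" if "a \<in> A n" for n a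
    unfolding f_def by (rule someI_ex[OF lift[OF that]])
  define B where "B = (\<Union>n\<le>m. f n ` A n)"
  have BJ: "B \<subseteq> J" using f by (auto simp: B_def)
  then have Bc: "B \<subseteq> carrier P" by auto
  have K: "ideal (Idl\<^bsub>P\<^esub> B) P" by (rule P.genideal_ideal[OF Bc])
  have KJ: "Idl\<^bsub>P\<^esub> B \<subseteq> J" by (rule P.genideal_minimal[OF J BJ])
  have small: "L J n \<subseteq> L (Idl\<^bsub>P\<^esub> B) n" if "n \<le> m" for n
  proof -
    have "A n \<subseteq> L (Idl\<^bsub>P\<^esub> B) n"
    proof
      fix a assume a: "a \<in> A n"
      then have "f n a \<in> Idl\<^bsub>P\<^esub> B" using that P.genideal_self[OF Bc] by (auto simp: B_def)
      then show "a \<in> L (Idl\<^bsub>P\<^esub> B) n" using f[OF a] unfolding L_def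
        by (intro CollectI exI[of _ "f n a"]) simp
    qed
    then show ?thesis using R.genideal_minimal[OF Lid[OF K]] A(3) by simp
  qed
  have "L J n \<subseteq> L (Idl\<^bsub>P\<^esub> B) n" for n
  proof (cases "n \<le> m")
    case False
    then have "L J n \<subseteq> L (Idl\<^bsub>P\<^esub> B) m" using m[of n] small[of m] by simp
    also have "\<dots> \<subseteq> L (Idl\<^bsub>P\<^esub> B) n"
      using False lift_Suc_mono_le[of "L (Idl\<^bsub>P\<^esub> B)", OF Lmono[OF K]] by simp
    finally show ?thesis .
  qed (rule small)
  then have "J \<subseteq> Idl\<^bsub>P\<^esub> B" by (intro ideal_eq_lcoeffs[OF J K KJ]) (simp add: L_def)
  moreover have "finite B" using A by (auto simp: B_def)
  ultimately show "\<exists>A\<subseteq>carrier P. finite A \<and> J = Idl\<^bsub>P\<^esub> A" using KJ Bc by blast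
qed

section \<open>Prime ideals of polynomial rings\<close>

text \<open>Isolates one summand of a coefficient of a product; the indices used below are extremal, such as that of a leading coefficient.\<close>

lemma (in UP_cring) coeff_mult_mod:
  assumes q: "ideal q R" and f: "f \<in> carrier P" and g: "g \<in> carrier P"
    and small: "\<And>k. k \<le> i + j \<Longrightarrow> k \<noteq> i \<Longrightarrow> coeff P f k \<otimes> coeff P g (i + j - k) \<in> q"
  obtains z where "z \<in> q" "coeff P (f \<otimes>\<^bsub>P\<^esub> g) (i + j) = coeff P f i \<otimes> coeff P g j \<oplus> z"
proof -
  interpret q: ideal q R by fact
  let ?h = "\<lambda>k. coeff P f k \<otimes> coeff P g (i + j - k)"
  have "coeff P (f \<otimes>\<^bsub>P\<^esub> g) (i + j) = finsum R ?h (insert i ({..i + j} - {i}))"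
    using f g by (simp add: insert_absorb)
  also have "\<dots> = ?h i \<oplus> finsum R ?h ({..i + j} - {i})"
    using f g by (intro R.finsum_insert) auto
  finally have "coeff P (f \<otimes>\<^bsub>P\<^esub> g) (i + j) = coeff P f i \<otimes> coeff P g j \<oplus> finsum R ?h ({..i + j} - {i})"
    by simp
  moreover have "finsum R ?h ({..i + j} - {i}) \<in> q"
    using small by (intro R.finsum_mem[OF q.a_subset q.zero_closed q.a_closed]) auto
  ultimately show ?thesis using that by blast
qed

lemma (in UP_cring) ideal_coeffs:
  assumes q: "ideal q R"
  shows "ideal {f \<in> carrier P. \<forall>n. coeff P f n \<in> q} P"
proof -
  interpret q: ideal q R by fact
  show ?thesis
  proof (rule idealI)
    show "subgroup {f \<in> carrier P. \<forall>n. coeff P f n \<in> q} (add_monoid P)"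
      by (rule P.add.subgroupI) (auto simp flip: a_inv_def intro!: exI[of _ "\<zero>\<^bsub>P\<^esub>"])
    fix f g assume f: "f \<in> {f \<in> carrier P. \<forall>n. coeff P f n \<in> q}" and g: "g \<in> carrier P"
    have "coeff P (f \<otimes>\<^bsub>P\<^esub> g) n \<in> q" for n
      using f g by (auto intro!: R.finsum_mem[OF q.a_subset q.zero_closed q.a_closed] q.I_r_closed)
    then show "f \<otimes>\<^bsub>P\<^esub> g \<in> {f \<in> carrier P. \<forall>n. coeff P f n \<in> q}" using f g by auto
    then show "g \<otimes>\<^bsub>P\<^esub> f \<in> {f \<in> carrier P. \<forall>n. coeff P f n \<in> q}" using P.m_comm[of f g] f g by auto
  qed (rule P.ring_axioms)
qed

text \<open>This is the ideal \<open>q[X]\<close>: the product of the lowest coefficients outside \<open>q\<close> is, modulo \<open>q\<close>, a coefficient of the product.\<close>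

lemma (in UP_cring) primeideal_coeffs:
  assumes q: "primeideal q R"
  shows "primeideal {f \<in> carrier P. \<forall>n. coeff P f n \<in> q} P" (is "primeideal ?Q P")
proof -
  interpret q: primeideal q R by fact
  show ?thesis
  proof (rule primeidealI[OF ideal_coeffs[OF q.ideal_axioms] P.cring_axioms])
    have "\<one>\<^bsub>P\<^esub> \<notin> ?Q" using q.one_notin by (auto dest: spec[of _ 0])
    then show "carrier P \<noteq> ?Q" using P.one_closed by blast
    fix f g assume fg: "f \<in> carrier P" "g \<in> carrier P" "f \<otimes>\<^bsub>P\<^esub> g \<in> ?Q"
    show "f \<in> ?Q \<or> g \<in> ?Q"
    proof (rule ccontr)
      assume "\<not> (f \<in> ?Q \<or> g \<in> ?Q)"
      then obtain i0 j0 where "coeff P f i0 \<notin> q" "coeff P g j0 \<notin> q" using fg by blast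
      define i where "i = (LEAST i. coeff P f i \<notin> q)"
      define j where "j = (LEAST i. coeff P g i \<notin> q)"
      have i: "coeff P f i \<notin> q" "\<And>k. k < i \<Longrightarrow> coeff P f k \<in> q"
        unfolding i_def using \<open>coeff P f i0 \<notin> q\<close> by (rule LeastI, use not_less_Least in blast)
      have j: "coeff P g j \<notin> q" "\<And>k. k < j \<Longrightarrow> coeff P g k \<in> q"
        unfolding j_def using \<open>coeff P g j0 \<notin> q\<close> by (rule LeastI, use not_less_Least in blast)
      have "coeff P f k \<otimes> coeff P g (i + j - k) \<in> q" if "k \<le> i + j" "k \<noteq> i" for k
      proof (cases "k < i")
        case True then show ?thesis using i fg q.I_r_closed by simp
      next
        case False
        then have "i + j - k < j" using that by simp
        then show ?thesis using j fg q.I_l_closed by simp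
      qed
      then obtain z where z: "z \<in> q" "coeff P (f \<otimes>\<^bsub>P\<^esub> g) (i + j) = coeff P f i \<otimes> coeff P g j \<oplus> z"
        using coeff_mult_mod[OF q.ideal_axioms fg(1,2)] by blast
      have "coeff P f i \<otimes> coeff P g j \<oplus> z \<in> q" using fg z by (metis (mono_tags, lifting) mem_Collect_eq)
      then have "(coeff P f i \<otimes> coeff P g j \<oplus> z) \<oplus> \<ominus> z \<in> q" using z by simp
      then have "coeff P f i \<otimes> coeff P g j \<in> q" using fg z q.Icarr[OF z(1)] by (simp add: R.a_assoc R.r_neg)
      then have "coeff P f i \<in> q \<or> coeff P g j \<in> q"
        using q.I_prime[of "coeff P f i" "coeff P g j"] fg(1,2) coeff_closed by blast
      then show False using i(1) j(1) by blast
    qed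
  qed
qed

lemma (in primeideal) pow_notin:
  assumes "s \<in> carrier R" "s \<notin> I" shows "s [^] (n::nat) \<notin> I"
  by (induction n) (use assms one_notin mult_notin[of _ s] in auto)

text \<open>
  The fiber over a prime \<open>q\<close> is the polynomial ring over the residue field of \<open>q\<close>, which has dimension one.
  In elementary terms: an element \<open>g\<close> of minimal degree in \<open>D2 - D0\<close> has leading coefficient outside \<open>q\<close>, and
  pseudo-division by \<open>g\<close> shows that \<open>D2\<close> is generated by \<open>g\<close> modulo \<open>D0\<close>, locally at \<open>q\<close>. So \<open>g \<notin> D1\<close>.
  If \<open>f\<close> has minimal degree in \<open>D1 - D0\<close>, it is thus a multiple of \<open>g\<close> up to these identifications, with a
  cofactor \<open>u\<close> in \<open>D1 - D0\<close>, and modulo \<open>q\<close> the degree of \<open>u\<close> is smaller than that of \<open>f\<close>.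
\<close>

lemma (in UP_cring) no_chain_of_three_in_fiber:
  assumes prime: "primeideal D0 P" "primeideal D1 P" "primeideal D2 P"
    and sub: "D0 \<subset> D1" "D1 \<subset> D2"
    and con: "{a \<in> carrier R. monom P a 0 \<in> D2} \<subseteq> {a \<in> carrier R. monom P a 0 \<in> D0}"
  shows False
proof -
  interpret D0: primeideal D0 P by (rule prime)
  interpret D1: primeideal D1 P by (rule prime)
  interpret D2: primeideal D2 P by (rule prime)
  interpret c: ring_hom_cring R P "\<lambda>a. monom P a 0"
    by (intro ring_hom_cringI R.cring_axioms P.cring_axioms const_ring_hom)
  define q where "q = {a \<in> carrier R. monom P a 0 \<in> D0}"
  have q: "primeideal q R" unfolding q_def by (rule c.primeideal_vimage[OF prime(1)])
  interpret q: primeideal q R by (rule q)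
  have q2: "a \<in> q" if "a \<in> carrier R" "monom P a 0 \<in> D2" for a using that con unfolding q_def by blast
  have inD0: "f \<in> D0" if "f \<in> carrier P" "\<And>n. coeff P f n \<in> q" for f
  proof -
    have "monom P (coeff P f i) 0 \<in> D0" for i using that(2)[of i] unfolding q_def by blast
    then show ?thesis by (rule poly_mem_ideal[OF that(1) D0.ideal_axioms])
  qed
  have trunc: "\<exists>f'\<in>J - D0. deg R f' \<le> e" if J: "ideal J P" "D0 \<subseteq> J" and f: "f \<in> J - D0" "\<And>i. i > e \<Longrightarrow> coeff P f i \<in> q" for J f e
  proof -
    interpret J: ideal J P by fact
    have fc: "f \<in> carrier P" using f by auto
    define f' where "f' = (\<Oplus>\<^bsub>P\<^esub> i \<in> {..e}. monom P (coeff P f i) i)"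
    have f'c: "f' \<in> carrier P" using fc by (auto simp: f'_def)
    have co: "coeff P f' n = (if n \<le> e then coeff P f n else \<zero>)" for n
    proof (cases "n \<le> e")
      case True
      have "coeff P f' n = (\<Oplus>i\<in>{..e}. coeff P (monom P (coeff P f i) i) n)"
        using fc unfolding f'_def by (subst coeff_finsum) auto
      also have "\<dots> = (\<Oplus>i\<in>{..e}. if n = i then coeff P f i else \<zero>)"
        using fc by (intro R.finsum_cong') auto
      also have "\<dots> = coeff P f n" using True fc by (intro R.finsum_singleton) auto
      finally show ?thesis using True by simp
    next
      case False
      have "coeff P f' n = (\<Oplus>i\<in>{..e}. coeff P (monom P (coeff P f i) i) n)"
        using fc unfolding f'_def by (subst coeff_finsum) auto
      also have "\<dots> = (\<Oplus>i\<in>{..e}. \<zero>)"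
        using fc False by (intro R.finsum_cong') auto
      finally have "coeff P f' n = (\<Oplus>i\<in>{..e}. \<zero>)" .
      then show ?thesis using False by simp
    qed
    have "f \<ominus>\<^bsub>P\<^esub> f' \<in> D0"
    proof (rule inD0)
      fix n show "coeff P (f \<ominus>\<^bsub>P\<^esub> f') n \<in> q"
        using f(2)[of n] fc f'c co[of n] by (cases "n \<le> e") (auto simp: a_minus_def R.r_neg)
    qed (use fc f'c in auto)
    then have fD: "f \<ominus>\<^bsub>P\<^esub> f' \<in> D0" .
    have eq: "f = (f \<ominus>\<^bsub>P\<^esub> f') \<oplus>\<^bsub>P\<^esub> f'" "f' = f \<oplus>\<^bsub>P\<^esub> (\<ominus>\<^bsub>P\<^esub> (f \<ominus>\<^bsub>P\<^esub> f'))"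
      using fc f'c by algebra+
    have "f' \<notin> D0" using eq(1) fD f(1) D0.a_closed by (metis DiffD2)
    moreover have "f' \<in> J" using eq(2) fD f(1) J(2) J.a_closed J.a_inv_closed by (metis DiffD1 subsetD)
    moreover have "deg R f' \<le> e" using f'c co by (intro deg_aboveI) auto
    ultimately show ?thesis by blast
  qed
  have minel: "\<exists>f\<in>J - D0. lcoeff f \<notin> q \<and> (\<forall>f'\<in>J - D0. deg R f \<le> deg R f')"
    if J: "ideal J P" "D0 \<subset> J" for J
  proof -
    interpret J: ideal J P by fact
    obtain f0 where "f0 \<in> J - D0" using J by blast
    then obtain f where f: "f \<in> J - D0" and min: "\<forall>f'\<in>J - D0. deg R f \<le> deg R f'"
      using exists_least_iff[of "\<lambda>n. \<exists>f\<in>J - D0. deg R f = n"] by (metis linorder_not_less)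
    have fc: "f \<in> carrier P" using f by auto
    have "lcoeff f \<notin> q"
    proof
      assume l: "lcoeff f \<in> q"
      have big: "coeff P f i \<in> q" if "i \<ge> deg R f" for i
        using l that fc deg_aboveD[of f i] by (cases "i = deg R f") auto
      show False
      proof (cases "deg R f")
        case 0
        then show False using inD0[OF fc] big f by auto
      next
        case (Suc e)
        then obtain f' where "f' \<in> J - D0" "deg R f' \<le> e"
          using trunc[OF J(1) _ f, of e] J(2) big by auto
        then show False using min Suc by force
      qed
    qed
    then show ?thesis using f min by blast
  qed
  obtain g where g: "g \<in> D2 - D0" "lcoeff g \<notin> q" "\<forall>f'\<in>D2 - D0. deg R g \<le> deg R f'"
    using minel[OF D2.ideal_axioms psubset_trans[OF sub]] by (elim bexE conjE)
  obtain f where f: "f \<in> D1 - D0" "lcoeff f \<notin> q" "\<forall>f'\<in>D1 - D0. deg R f \<le> deg R f'"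
    using minel[OF D1.ideal_axioms sub(1)] by (elim bexE conjE)
  have gc: "g \<in> carrier P" and fc: "f \<in> carrier P" using g f by auto
  have gnz: "g \<noteq> \<zero>\<^bsub>P\<^esub>" using g by auto
  have divi: "\<exists>u r s. u \<in> carrier P \<and> r \<in> D0 \<and> s \<in> carrier R \<and> s \<notin> q \<and> monom P s 0 \<otimes>\<^bsub>P\<^esub> w = g \<otimes>\<^bsub>P\<^esub> u \<oplus>\<^bsub>P\<^esub> r \<and> (\<forall>i\<ge>deg R g. coeff P r i = \<zero>)"
    if w: "w \<in> D2" for w
  proof -
    have wc: "w \<in> carrier P" using w by auto
    obtain u r k where *: "u \<in> carrier P" "r \<in> carrier P" "lcoeff g [^] (k::nat) \<odot>\<^bsub>P\<^esub> w = g \<otimes>\<^bsub>P\<^esub> u \<oplus>\<^bsub>P\<^esub> r"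
      "r = \<zero>\<^bsub>P\<^esub> \<or> deg R r < deg R g"
      using long_div_theorem[OF gc wc gnz] by blast
    let ?s = "lcoeff g [^] k"
    have s: "?s \<in> carrier R" "?s \<notin> q" using q.pow_notin[OF lcoeff_closed[OF gc] g(2)] lcoeff_closed[OF gc] R.nat_pow_closed by blast+
    have e: "monom P ?s 0 \<otimes>\<^bsub>P\<^esub> w = g \<otimes>\<^bsub>P\<^esub> u \<oplus>\<^bsub>P\<^esub> r" using * s wc by (simp add: monom_mult_is_smult)
    have "r = (monom P ?s 0 \<otimes>\<^bsub>P\<^esub> w) \<ominus>\<^bsub>P\<^esub> g \<otimes>\<^bsub>P\<^esub> u"
      unfolding e using P.add_minus_cancel(1)[of "g \<otimes>\<^bsub>P\<^esub> u" r] *(1,2) gc by simp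
    moreover have "monom P ?s 0 \<otimes>\<^bsub>P\<^esub> w \<in> D2" "g \<otimes>\<^bsub>P\<^esub> u \<in> D2"
      using w s g * D2.I_l_closed D2.I_r_closed by auto
    ultimately have "r \<in> D2" by (simp add: a_minus_def)
    then have "r \<in> D0" using *(4) bspec[OF g(3), of r] D0.zero_closed by force
    moreover have "coeff P r i = \<zero>" if "i \<ge> deg R g" for i
      using *(2,4) that deg_aboveD[of r i] by auto
    ultimately show ?thesis using * s e by blast
  qed
  have sn: "monom P s 0 \<notin> D2" "monom P s 0 \<in> carrier P" if "s \<in> carrier R" "s \<notin> q" for s using that q2 by auto
  have "g \<notin> D1"
  proof
    assume gD1: "g \<in> D1"
    have "w \<in> D1" if w: "w \<in> D2" for w
    proof -
      obtain u r s where *: "u \<in> carrier P" "r \<in> D0" "s \<in> carrier R" "s \<notin> q" "monom P s 0 \<otimes>\<^bsub>P\<^esub> w = g \<otimes>\<^bsub>P\<^esub> u \<oplus>\<^bsub>P\<^esub> r"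
        using divi[OF w] by blast
      have "monom P s 0 \<otimes>\<^bsub>P\<^esub> w \<in> D1" using * gD1 D1.I_r_closed sub by auto
      then show ?thesis using D1.I_prime[of "monom P s 0" w] sn[OF *(3,4)] w sub by auto
    qed
    then show False using sub by blast
  qed
  obtain u r s where *: "u \<in> carrier P" "r \<in> D0" "s \<in> carrier R" "s \<notin> q" "monom P s 0 \<otimes>\<^bsub>P\<^esub> f = g \<otimes>\<^bsub>P\<^esub> u \<oplus>\<^bsub>P\<^esub> r"
    "\<forall>i\<ge>deg R g. coeff P r i = \<zero>"
  proof -
    have "f \<in> D2" using f(1) sub by blast
    from divi[OF this] that show ?thesis by (elim exE conjE)
  qed
  have rc: "r \<in> carrier P" using * by auto
  have gu: "g \<otimes>\<^bsub>P\<^esub> u = (monom P s 0 \<otimes>\<^bsub>P\<^esub> f) \<ominus>\<^bsub>P\<^esub> r"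
    unfolding *(5) using P.add_minus_cancel(2)[of "g \<otimes>\<^bsub>P\<^esub> u" r] *(1) rc gc by simp
  moreover have "monom P s 0 \<otimes>\<^bsub>P\<^esub> f \<in> D1"
    using f(1) *(3) by (intro D1.I_l_closed) auto
  moreover have "r \<in> D1" using *(2) sub by blast
  ultimately have "g \<otimes>\<^bsub>P\<^esub> u \<in> D1" by (simp add: a_minus_def)
  then have uD1: "u \<in> D1" using D1.I_prime gc * \<open>g \<notin> D1\<close> by blast
  have uD0: "u \<notin> D0"
  proof
    assume "u \<in> D0"
    then have "monom P s 0 \<otimes>\<^bsub>P\<^esub> f \<in> D0" using * gc D0.I_l_closed by auto
    then show False using D0.I_prime[of "monom P s 0" f] sn[OF *(3,4)] fc f sub by auto
  qed
  let ?E = "{i. coeff P u i \<notin> q}"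
  have "?E \<subseteq> {..deg R u}"
  proof
    fix i assume "i \<in> ?E"
    then have "coeff P u i \<noteq> \<zero>" by auto
    then show "i \<in> {..deg R u}" using deg_aboveD[of u i] * by (cases "i \<le> deg R u") auto
  qed
  then have fin: "finite ?E" by (rule finite_subset) simp
  have "?E \<noteq> {}" using inD0[of u] * uD0 by blast
  \<comment> \<open>The degree of \<open>u\<close> modulo \<open>q\<close>; the coefficients of \<open>u\<close> beyond \<open>e\<close> lie in \<open>q\<close> and may be cut off.\<close>
  define e where "e = Max ?E"
  have e: "coeff P u e \<notin> q" using Max_in[OF fin \<open>?E \<noteq> {}\<close>] by (simp add: e_def)
  have e': "coeff P u i \<in> q" if "i > e" for i using Max_ge[OF fin, of i] that by (fastforce simp: e_def)
  have fe: "deg R f \<le> e"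
  proof -
    obtain f' where "f' \<in> D1 - D0" "deg R f' \<le> e"
      using trunc[OF D1.ideal_axioms psubset_imp_subset[OF sub(1)] _ e'] uD1 uD0 by blast
    then show ?thesis using f(3) by force
  qed
  let ?d = "deg R g"
  have d: "?d > 0"
  proof (rule ccontr)
    assume "\<not> ?d > 0"
    then have "g = monom P (coeff P g 0) 0" using deg_zero_impl_monom[OF gc] by simp
    then have "coeff P g 0 \<in> q" using q2[of "coeff P g 0"] g(1) gc by auto
    then show False using g(2) \<open>\<not> ?d > 0\<close> by simp
  qed
  have "coeff P g k \<otimes> coeff P u (?d + e - k) \<in> q" if "k \<le> ?d + e" "k \<noteq> ?d" for k
  proof (cases "k < ?d")
    case True then show ?thesis using e'[of "?d + e - k"] gc * q.I_l_closed by simp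
  next
    case False then show ?thesis using deg_aboveD[of g k] gc * that by simp
  qed
  then obtain z where z: "z \<in> q" "coeff P (g \<otimes>\<^bsub>P\<^esub> u) (?d + e) = lcoeff g \<otimes> coeff P u e \<oplus> z"
    using coeff_mult_mod[OF q.ideal_axioms gc *(1)] by blast
  have "coeff P (g \<otimes>\<^bsub>P\<^esub> u) (?d + e) = \<zero>"
    using *(3) *(6)[rule_format, of "?d + e"] fc rc d fe deg_aboveD[of f "?d + e"]
    unfolding gu by (simp add: a_minus_def monom_mult_is_smult)
  then have "lcoeff g \<otimes> coeff P u e \<oplus> z = \<zero>" using z by simp
  then have "lcoeff g \<otimes> coeff P u e = \<ominus> z" using gc * q.Icarr[OF z(1)] by (metis R.m_closed R.minus_equality R.a_comm coeff_closed lcoeff_closed R.minus_minus)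
  then have "lcoeff g \<otimes> coeff P u e \<in> q" using z by simp
  then show False using q.I_prime[of "lcoeff g" "coeff P u e"] g e gc * by auto
qed

text \<open>
  Since fibers have dimension one, the top of a chain with at least three members contains some \<open>a \<in> R\<close> that is
  missing in its bottom \<open>D\<close>. By \<open>pchain_containing\<close>, the second
  member \<open>E\<close> may be assumed to contain \<open>a\<close>, so that \<open>D\<close> and \<open>E\<close> have different contractions, and the
  rest of the chain is treated by induction.
\<close>

theorem (in UP_cring) pchain_contract:
  assumes Noeth: "noetherian_ring R" and "pchain P (Suc n) D D'"
  shows "\<exists>c. {a \<in> carrier R. monom P a 0 \<in> D} \<subseteq> c \<and> pchain R n c {a \<in> carrier R. monom P a 0 \<in> D'}"
  using assms(2)
proof (induction n arbitrary: D)
  interpret c: ring_hom_cring R P "\<lambda>a. monom P a 0"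
    by (intro ring_hom_cringI R.cring_axioms P.cring_axioms const_ring_hom)
  case 0
  then show ?case
    using pchain_prime(2)[OF 0] pchain_subset[OF 0] c.primeideal_vimage by (auto simp: pchain_0)
next
  interpret c: ring_hom_cring R P "\<lambda>a. monom P a 0"
    by (intro ring_hom_cringI R.cring_axioms P.cring_axioms const_ring_hom)
  let ?c = "\<lambda>D. {a \<in> carrier R. monom P a 0 \<in> D}"
  case (Suc n)
  obtain D1 where D1: "primeideal D P" "D \<subset> D1" "pchain P (Suc n) D1 D'" using Suc.prems by (rule pchain_Suc_first)
  obtain D2 where D2: "primeideal D1 P" "D1 \<subset> D2" "pchain P n D2 D'" using D1(3) by (rule pchain_Suc_first)
  have "\<not> ?c D' \<subseteq> ?c D"
  proof
    assume "?c D' \<subseteq> ?c D"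
    then have "?c D2 \<subseteq> ?c D" using pchain_subset[OF D2(3)] by blast
    then show False using no_chain_of_three_in_fiber[OF D1(1) D2(1) pchain_prime(1)[OF D2(3)] D1(2) D2(2)] by blast
  qed
  then obtain a where a: "a \<in> carrier R" "monom P a 0 \<in> D'" "monom P a 0 \<notin> D" by blast
  obtain E where E: "D \<subset> E" "monom P a 0 \<in> E" "pchain P (Suc n) E D'"
    using P.pchain_containing[OF hilbert_basis[OF Noeth] Suc.prems a(2)] by blast
  obtain c where c: "?c E \<subseteq> c" "pchain R n c (?c D')" using Suc.IH[OF E(3)] by blast
  have "?c D \<subset> c" using E a c by blast
  then have "pchain R (Suc n) (?c D) (?c D')"
    using c c.primeideal_vimage[OF D1(1)] by (intro pchain_Cons) auto
  then show ?case by blast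
qed

section \<open>Simple extensions of subrings\<close>

text \<open>Unlike in \<open>pchain_vimage\<close>, only the links of one given chain have to be detected, for which finitely many elements suffice.\<close>

lemma (in ring_hom_cring) prime_chain_vimage:
  assumes C: "prime_chain S n C" and strict: "\<And>i. i < n \<Longrightarrow> \<exists>r\<in>carrier R. h r \<in> C (Suc i) - C i"
  shows "pchain R n {r \<in> carrier R. h r \<in> C 0} {r \<in> carrier R. h r \<in> C n}"
proof -
  have "prime_chain R n (\<lambda>i. {r \<in> carrier R. h r \<in> C i})"
    unfolding prime_chain_def
  proof (intro conjI allI impI)
    fix i assume "i \<le> n"
    then show "primeideal {r \<in> carrier R. h r \<in> C i} R"
      using C primeideal_vimage by (auto simp: prime_chain_def)
  next
    fix i assume i: "i < n"
    then have "C i \<subset> C (Suc i)" using C by (auto simp: prime_chain_def)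
    then show "{r \<in> carrier R. h r \<in> C i} \<subset> {r \<in> carrier R. h r \<in> C (Suc i)}"
      using strict[OF i] by blast
  qed
  then show ?thesis unfolding pchain_def by blast
qed

lemma (in ring_hom_cring) pchain_vimage_surj:
  assumes C: "pchain S n p q" and surj: "h ` carrier R = carrier S"
  shows "pchain R n {r \<in> carrier R. h r \<in> p} {r \<in> carrier R. h r \<in> q}"
proof (rule pchain_vimage[OF C])
  fix I J assume "primeideal I S" "primeideal J S" "I \<subset> J"
  then interpret J: primeideal J S by simp
  obtain j where "j \<in> J" "j \<notin> I" using \<open>I \<subset> J\<close> by blast
  then show "\<exists>r\<in>carrier R. h r \<in> J - I" using surj J.Icarr[of j] by (metis DiffI imageE)
qed

lemma (in ring_hom_cring) noetherian_image:
  assumes surj: "h ` carrier R = carrier S" and Noeth: "noetherian_ring R"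
  shows "noetherian_ring S"
proof (rule S.noetherian_ringI)
  interpret N: noetherian_ring R by (rule Noeth)
  fix J assume J: "ideal J S"
  obtain A where A: "A \<subseteq> carrier R" "finite A" "{r \<in> carrier R. h r \<in> J} = Idl\<^bsub>R\<^esub> A"
    using N.finetely_gen[OF ring.ideal_vimage[OF J]] by blast
  have hA: "h ` A \<subseteq> carrier S" using A(1) by auto
  have "h ` A \<subseteq> J" using R.genideal_self[OF A(1)] A(3) by blast
  then have 1: "Idl\<^bsub>S\<^esub> (h ` A) \<subseteq> J" by (rule S.genideal_minimal[OF J])
  have "A \<subseteq> {r \<in> carrier R. h r \<in> Idl\<^bsub>S\<^esub> (h ` A)}"
    using A(1) S.genideal_self[OF hA] by blast
  then have "Idl\<^bsub>R\<^esub> A \<subseteq> {r \<in> carrier R. h r \<in> Idl\<^bsub>S\<^esub> (h ` A)}"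
    by (rule R.genideal_minimal[OF ring.ideal_vimage[OF S.genideal_ideal[OF hA]]])
  then have 2: "{r \<in> carrier R. h r \<in> J} \<subseteq> {r \<in> carrier R. h r \<in> Idl\<^bsub>S\<^esub> (h ` A)}" using A(3) by simp
  have "J \<subseteq> Idl\<^bsub>S\<^esub> (h ` A)"
  proof
    fix j assume j: "j \<in> J"
    then have "j \<in> carrier S" using ideal.Icarr[OF J] by simp
    then obtain r where "r \<in> carrier R" "j = h r" using surj by blast
    then show "j \<in> Idl\<^bsub>S\<^esub> (h ` A)" using 2 j by blast
  qed
  then show "\<exists>A\<subseteq>carrier S. finite A \<and> J = Idl\<^bsub>S\<^esub> A" using 1 hA A(2) by blast
qed

text \<open>The subring \<open>H[g]\<close>, given as the image of the polynomial ring over \<open>H\<close>; this makes Hilbert's theorem and \<open>pchain_contract\<close> applicable.\<close>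

definition poly_values :: "('a, 'b) ring_scheme \<Rightarrow> 'a set \<Rightarrow> 'a \<Rightarrow> 'a set" where
  "poly_values S H g = eval (S\<lparr>carrier := H\<rparr>) S id g ` carrier (UP (S\<lparr>carrier := H\<rparr>))"

lemma (in ring) subring_pow_closed: "subring H R \<Longrightarrow> x \<in> H \<Longrightarrow> x [^] (n::nat) \<in> H"
  by (induction n) (auto simp: subringE)

lemma (in cring) subring_is_cring: "subring H R \<Longrightarrow> cring (R\<lparr>carrier := H\<rparr>)"
  by (intro subcring_iff[THEN iffD1] subcringI' subringE(1)) auto

context cring
begin

context
  fixes H g
  assumes H: "subring H R" and g: "g \<in> carrier R"
begin

lemma poly_values_hom:
  "ring_hom_cring (UP (R\<lparr>carrier := H\<rparr>)) R (eval (R\<lparr>carrier := H\<rparr>) R id g)"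
  and UP_pre_subring: "UP_pre_univ_prop (R\<lparr>carrier := H\<rparr>) R id"
proof -
  interpret A: cring "R\<lparr>carrier := H\<rparr>" by (rule subring_is_cring[OF H])
  interpret U: UP_cring "R\<lparr>carrier := H\<rparr>" "UP (R\<lparr>carrier := H\<rparr>)" by unfold_locales
  have "ring_hom_cring (R\<lparr>carrier := H\<rparr>) R id"
    by (intro ring_hom_cringI A.cring_axioms cring_axioms ring_hom_memI) (use subringE(1)[OF H] in auto)
  then show "UP_pre_univ_prop (R\<lparr>carrier := H\<rparr>) R id"
    by (intro UP_pre_univ_prop.intro UP_cring.intro A.cring_axioms)
  then interpret E: UP_pre_univ_prop "R\<lparr>carrier := H\<rparr>" R id "UP (R\<lparr>carrier := H\<rparr>)" .
  show "ring_hom_cring (UP (R\<lparr>carrier := H\<rparr>)) R (eval (R\<lparr>carrier := H\<rparr>) R id g)"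
    by (intro ring_hom_cringI U.P.cring_axioms cring_axioms E.eval_ring_hom g)
qed

lemma poly_values_contains: "H \<subseteq> poly_values R H g" "g \<in> poly_values R H g"
proof -
  interpret A: cring "R\<lparr>carrier := H\<rparr>" by (rule subring_is_cring[OF H])
  interpret U: UP_cring "R\<lparr>carrier := H\<rparr>" "UP (R\<lparr>carrier := H\<rparr>)" by unfold_locales
  interpret E: UP_pre_univ_prop "R\<lparr>carrier := H\<rparr>" R id "UP (R\<lparr>carrier := H\<rparr>)" by (rule UP_pre_subring)
  show "H \<subseteq> poly_values R H g"
  proof
    fix a assume "a \<in> H"
    then have "eval (R\<lparr>carrier := H\<rparr>) R id g (monom (UP (R\<lparr>carrier := H\<rparr>)) a 0) = a"
      using E.eval_const[OF g, of a] by simp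
    moreover have "monom (UP (R\<lparr>carrier := H\<rparr>)) a 0 \<in> carrier (UP (R\<lparr>carrier := H\<rparr>))"
      using \<open>a \<in> H\<close> by (intro U.monom_closed) simp
    ultimately show "a \<in> poly_values R H g" unfolding poly_values_def by (metis imageI)
  qed
  have "monom (UP (R\<lparr>carrier := H\<rparr>)) \<one>\<^bsub>R\<lparr>carrier := H\<rparr>\<^esub> 1 \<in> carrier (UP (R\<lparr>carrier := H\<rparr>))"
    by (intro U.monom_closed A.one_closed)
  then show "g \<in> poly_values R H g" unfolding poly_values_def
    using E.eval_monom1[OF g] by (metis imageI)
qed

lemma poly_values_subring: "subring (poly_values R H g) R"
proof -
  interpret h: ring_hom_cring "UP (R\<lparr>carrier := H\<rparr>)" R "eval (R\<lparr>carrier := H\<rparr>) R id g" by (rule poly_values_hom)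
  show ?thesis unfolding poly_values_def
    using h.ring.img_is_subring[OF h.R.carrier_is_subring] .
qed

lemma poly_values_minimal:
  assumes K: "subring K R" "H \<subseteq> K" "g \<in> K" shows "poly_values R H g \<subseteq> K"
proof
  interpret A: cring "R\<lparr>carrier := H\<rparr>" by (rule subring_is_cring[OF H])
  interpret U: UP_cring "R\<lparr>carrier := H\<rparr>" "UP (R\<lparr>carrier := H\<rparr>)" by unfold_locales
  fix x assume "x \<in> poly_values R H g"
  then obtain p where p: "p \<in> carrier (UP (R\<lparr>carrier := H\<rparr>))" "x = eval (R\<lparr>carrier := H\<rparr>) R id g p"
    by (auto simp: poly_values_def)
  have "coeff (UP (R\<lparr>carrier := H\<rparr>)) p i \<in> H" for i using U.coeff_closed[OF p(1)] by simp
  then have "(\<Oplus>\<^bsub>R\<^esub>i\<in>{..deg (R\<lparr>carrier := H\<rparr>) p}. id (coeff (UP (R\<lparr>carrier := H\<rparr>)) p i) \<otimes> g [^] i) \<in> K"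
    using K by (intro finsum_mem subringE(1,2,7)[OF K(1)])
       (auto intro!: subringE(6)[OF K(1)] subring_pow_closed[OF K(1)])
  then show "x \<in> K" using p by (simp add: eval_def)
qed

lemma poly_values_hom_onto:
  "ring_hom_cring (UP (R\<lparr>carrier := H\<rparr>)) (R\<lparr>carrier := poly_values R H g\<rparr>) (eval (R\<lparr>carrier := H\<rparr>) R id g)"
  "eval (R\<lparr>carrier := H\<rparr>) R id g ` carrier (UP (R\<lparr>carrier := H\<rparr>)) = carrier (R\<lparr>carrier := poly_values R H g\<rparr>)"
proof -
  interpret h: ring_hom_cring "UP (R\<lparr>carrier := H\<rparr>)" R "eval (R\<lparr>carrier := H\<rparr>) R id g" by (rule poly_values_hom)
  show "ring_hom_cring (UP (R\<lparr>carrier := H\<rparr>)) (R\<lparr>carrier := poly_values R H g\<rparr>) (eval (R\<lparr>carrier := H\<rparr>) R id g)"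
    by (intro ring_hom_cringI h.R.cring_axioms subring_is_cring poly_values_subring ring_hom_memI)
       (auto simp: poly_values_def)
qed (simp add: poly_values_def)

lemma poly_values_noetherian:
  assumes "noetherian_ring (R\<lparr>carrier := H\<rparr>)"
  shows "noetherian_ring (R\<lparr>carrier := poly_values R H g\<rparr>)"
proof -
  interpret A: cring "R\<lparr>carrier := H\<rparr>" by (rule subring_is_cring[OF H])
  interpret U: UP_cring "R\<lparr>carrier := H\<rparr>" "UP (R\<lparr>carrier := H\<rparr>)" by unfold_locales
  show ?thesis
    by (rule ring_hom_cring.noetherian_image[OF poly_values_hom_onto U.hilbert_basis[OF assms]])
qed

lemma poly_values_pchain:
  assumes Noeth: "noetherian_ring (R\<lparr>carrier := H\<rparr>)"
    and C: "pchain (R\<lparr>carrier := poly_values R H g\<rparr>) (Suc n) D D'"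
  shows "\<exists>c. pchain (R\<lparr>carrier := H\<rparr>) n c (D' \<inter> H)"
proof -
  let ?A = "R\<lparr>carrier := H\<rparr>"
  interpret A: cring ?A by (rule subring_is_cring[OF H])
  interpret U: UP_cring ?A "UP ?A" by unfold_locales
  interpret E: UP_pre_univ_prop "R\<lparr>carrier := H\<rparr>" R id "UP (R\<lparr>carrier := H\<rparr>)" by (rule UP_pre_subring)
  have "pchain (UP ?A) (Suc n) {r \<in> carrier (UP ?A). eval ?A R id g r \<in> D} {r \<in> carrier (UP ?A). eval ?A R id g r \<in> D'}"
    by (rule ring_hom_cring.pchain_vimage_surj[OF poly_values_hom_onto(1) C poly_values_hom_onto(2)])
  from U.pchain_contract[OF Noeth this]
  obtain c where "pchain ?A n c {a \<in> carrier ?A. monom (UP ?A) a 0 \<in> {r \<in> carrier (UP ?A). eval ?A R id g r \<in> D'}}"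
    by blast
  moreover have "{a \<in> carrier ?A. monom (UP ?A) a 0 \<in> {r \<in> carrier (UP ?A). eval ?A R id g r \<in> D'}} = D' \<inter> H"
    using U.monom_closed E.eval_const[OF g] by auto
  ultimately show ?thesis by auto
qed

text \<open>
  The pullback of the chain to the polynomial ring over \<open>H\<close> contains the kernel of the evaluation, in which
  \<open>v Y - u\<close> is a nonzero element. So the zero ideal can be prepended, and this makes up for the
  step that is lost in \<open>pchain_contract\<close>.
\<close>

lemma poly_values_pchain_birational:
  assumes dom: "domain R" and Noeth: "noetherian_ring (R\<lparr>carrier := H\<rparr>)"
    and vu: "v \<in> H" "u \<in> H" "v \<noteq> \<zero>" "v \<otimes> g = u"
    and C: "pchain (R\<lparr>carrier := poly_values R H g\<rparr>) n D D'"
  shows "\<exists>c. pchain (R\<lparr>carrier := H\<rparr>) n c (D' \<inter> H)"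
proof -
  interpret domain R by (rule dom)
  let ?A = "R\<lparr>carrier := H\<rparr>"
  let ?e = "eval ?A R id g"
  interpret A: domain ?A by (rule subring_is_domain[OF H])
  interpret U: UP_domain ?A "UP ?A" by unfold_locales
  interpret E: UP_pre_univ_prop ?A R id "UP ?A" by (rule UP_pre_subring)
  interpret e: ring_hom_cring "UP ?A" R ?e by (rule poly_values_hom)
  let ?p = "monom (UP ?A) v 1 \<oplus>\<^bsub>UP ?A\<^esub> monom (UP ?A) (\<ominus>\<^bsub>?A\<^esub> u) 0"
  have uA: "\<ominus>\<^bsub>?A\<^esub> u \<in> carrier ?A" "v \<in> carrier ?A" using vu A.a_inv_closed[of u] by auto
  have uR: "\<ominus>\<^bsub>?A\<^esub> u \<oplus> u = \<zero>" using A.l_neg[of u] vu by simp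
  have cR: "v \<in> carrier R" "u \<in> carrier R" "\<ominus>\<^bsub>?A\<^esub> u \<in> carrier R" using vu uA subringE(1)[OF H] by auto
  have "?e ?p = v \<otimes> g \<oplus> (\<ominus>\<^bsub>?A\<^esub> u)"
    using uA E.eval_monom[OF uA(2) g, of 1] E.eval_monom[OF uA(1) g, of 0] U.monom_closed g cR by simp
  also have "\<dots> = \<zero>" using vu(4) uR cR by (simp add: a_comm)
  finally have p0: "?e ?p = \<zero>" .
  have pc: "?p \<in> carrier (UP ?A)" using uA by simp
  have c1: "coeff (UP ?A) ?p 1 = v" using uA cR by simp
  have pnz: "?p \<noteq> \<zero>\<^bsub>UP ?A\<^esub>"
  proof
    assume "?p = \<zero>\<^bsub>UP ?A\<^esub>"
    then have "v = \<zero>" using c1 U.coeff_zero[of 1] by simp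
    then show False using vu(3) by simp
  qed
  let ?K = "{r \<in> carrier (UP ?A). ?e r \<in> D}"
  have "pchain (UP ?A) n ?K {r \<in> carrier (UP ?A). ?e r \<in> D'}"
    by (rule ring_hom_cring.pchain_vimage_surj[OF poly_values_hom_onto(1) C poly_values_hom_onto(2)])
  moreover have "{\<zero>\<^bsub>UP ?A\<^esub>} \<subset> ?K"
  proof -
    have "\<zero>\<^bsub>R\<lparr>carrier := poly_values R H g\<rparr>\<^esub> \<in> D"
      by (rule additive_subgroup.zero_closed[OF ideal.axioms(1)[OF primeideal.axioms(1)[OF pchain_prime(1)[OF C]]]])
    then have "\<zero> \<in> D" by simp
    then have "\<zero>\<^bsub>UP ?A\<^esub> \<in> ?K" "?p \<in> ?K" using p0 pc e.hom_zero U.P.zero_closed by simp_all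
    then show ?thesis using pnz by blast
  qed
  ultimately have "pchain (UP ?A) (Suc n) {\<zero>\<^bsub>UP ?A\<^esub>} {r \<in> carrier (UP ?A). ?e r \<in> D'}"
    by (intro pchain_Cons[OF domain.zeroprimeideal[OF U.UP_domain]])
  from U.pchain_contract[OF Noeth this]
  obtain c where "pchain ?A n c {a \<in> carrier ?A. monom (UP ?A) a 0 \<in> {r \<in> carrier (UP ?A). ?e r \<in> D'}}"
    by blast
  moreover have "{a \<in> carrier ?A. monom (UP ?A) a 0 \<in> {r \<in> carrier (UP ?A). ?e r \<in> D'}} = D' \<inter> H"
    using U.monom_closed E.eval_const[OF g] by auto
  ultimately show ?thesis by auto
qed

end

end

section \<open>Graded subrings of a polynomial ring\<close>

lemma (in UP_cring) constants_noetherian: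
  assumes "noetherian_ring R"
  shows "subring ((\<lambda>a. monom P a 0) ` carrier R) P"
    and "noetherian_ring (P\<lparr>carrier := (\<lambda>a. monom P a 0) ` carrier R\<rparr>)"
    and "pchain (P\<lparr>carrier := (\<lambda>a. monom P a 0) ` carrier R\<rparr>) n D D' \<Longrightarrow>
      pchain R n {a \<in> carrier R. monom P a 0 \<in> D} {a \<in> carrier R. monom P a 0 \<in> D'}"
proof -
  let ?C = "(\<lambda>a. monom P a 0) ` carrier R"
  interpret c: ring_hom_cring R P "\<lambda>a. monom P a 0"
    by (intro ring_hom_cringI R.cring_axioms P.cring_axioms const_ring_hom)
  show sub: "subring ?C P" using c.ring.img_is_subring[OF R.carrier_is_subring] .
  interpret c': ring_hom_cring R "P\<lparr>carrier := ?C\<rparr>" "\<lambda>a. monom P a 0"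
    by (intro ring_hom_cringI R.cring_axioms P.subring_is_cring sub ring_hom_memI) (auto)
  show "noetherian_ring (P\<lparr>carrier := ?C\<rparr>)"
    by (rule c'.noetherian_image[OF _ assms]) simp
  show "pchain (P\<lparr>carrier := ?C\<rparr>) n D D' \<Longrightarrow>
      pchain R n {a \<in> carrier R. monom P a 0 \<in> D} {a \<in> carrier R. monom P a 0 \<in> D'}"
    by (rule c'.pchain_vimage_surj) simp_all
qed

lemma (in domain) pow_nonzero: "f \<in> carrier R \<Longrightarrow> f \<noteq> \<zero> \<Longrightarrow> f [^] (n::nat) \<noteq> \<zero>"
  by (induction n) (auto simp: integral_iff)

context UP_domain
begin

text \<open>
  The Noetherian rings between \<open>R[f X]\<close> and \<open>R[X]\<close> for which the dimension bound is known. The class contains \<open>R[f X]\<close>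
  and is closed under the adjunction of monomials.
\<close>

definition bounded_subring :: "'a \<Rightarrow> (nat \<Rightarrow> 'a) set \<Rightarrow> bool" where
  "bounded_subring f H \<longleftrightarrow> subring H P \<and> noetherian_ring (P\<lparr>carrier := H\<rparr>) \<and>
    (\<forall>a\<in>carrier R. monom P a 0 \<in> H) \<and> monom P f 1 \<in> H \<and>
    (\<forall>n D D'. pchain (P\<lparr>carrier := H\<rparr>) (Suc n) D D' \<longrightarrow> (\<exists>c. pchain R n c {a \<in> carrier R. monom P a 0 \<in> D'}))"

lemma bounded_subring_base:
  assumes Noeth: "noetherian_ring R" and f: "f \<in> carrier R"
    and A: "subring A P" "\<And>a. a \<in> carrier R \<Longrightarrow> monom P a 0 \<in> A" "monom P f 1 \<in> A"
  shows "\<exists>H\<subseteq>A. bounded_subring f H"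
proof -
  let ?C = "(\<lambda>a. monom P a 0) ` carrier R"
  note C = constants_noetherian[OF Noeth]
  have fX: "monom P f 1 \<in> carrier P" using f by simp
  let ?H = "poly_values P ?C (monom P f 1)"
  note pv = P.poly_values_subring[OF C(1) fX] P.poly_values_contains[OF C(1) fX] P.poly_values_noetherian[OF C(1) fX C(2)]
  have "\<exists>c. pchain R n c {a \<in> carrier R. monom P a 0 \<in> D'}"
    if ch: "pchain (P\<lparr>carrier := ?H\<rparr>) (Suc n) D D'" for n D D'
  proof -
    obtain c where "pchain (P\<lparr>carrier := ?C\<rparr>) n c (D' \<inter> ?C)"
      using P.poly_values_pchain[OF C(1) fX C(2) ch] by blast
    from C(3)[OF this]
    have "pchain R n {a \<in> carrier R. monom P a 0 \<in> c} {a \<in> carrier R. monom P a 0 \<in> D' \<inter> ?C}" .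
    moreover have "{a \<in> carrier R. monom P a 0 \<in> D' \<inter> ?C} = {a \<in> carrier R. monom P a 0 \<in> D'}" by blast
    ultimately show ?thesis by auto
  qed
  then have "bounded_subring f ?H" using pv unfolding bounded_subring_def by blast
  moreover have "?H \<subseteq> A" using A by (intro P.poly_values_minimal[OF C(1) fX]) auto
  ultimately show ?thesis by blast
qed

text \<open>The monomial \<open>a X\<^sup>m\<close> is a fraction of elements of \<open>H\<close>, since \<open>f\<^sup>m (a X\<^sup>m) = a (f X)\<^sup>m\<close>.\<close>

lemma bounded_subring_step:
  assumes good: "bounded_subring f H" and f: "f \<in> carrier R" "f \<noteq> \<zero>" and a: "a \<in> carrier R"
    and A: "subring A P" "H \<subseteq> A" "monom P a m \<in> A"
  shows "\<exists>H'. H \<subseteq> H' \<and> H' \<subseteq> A \<and> monom P a m \<in> H' \<and> bounded_subring f H'"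
proof -
  have H: "subring H P" and HN: "noetherian_ring (P\<lparr>carrier := H\<rparr>)"
    and Hc: "\<And>a. a \<in> carrier R \<Longrightarrow> monom P a 0 \<in> H" and Hf: "monom P f 1 \<in> H"
    and Hp: "\<And>n D D'. pchain (P\<lparr>carrier := H\<rparr>) (Suc n) D D' \<Longrightarrow> (\<exists>c. pchain R n c {a \<in> carrier R. monom P a 0 \<in> D'})"
    using good by (auto simp: bounded_subring_def)
  have aX: "monom P a m \<in> carrier P" using a by simp
  let ?v = "monom P (f [^] m) 0"
  let ?u = "monom P a 0 \<otimes>\<^bsub>P\<^esub> monom P f 1 [^]\<^bsub>P\<^esub> m"
  have fm: "f [^] m \<in> carrier R" "f [^] m \<noteq> \<zero>" using f by (auto simp: R.pow_nonzero)
  have vu: "?v \<in> H" "?u \<in> H"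
    using Hc[OF fm(1)] subringE(6)[OF H Hc[OF a] P.subring_pow_closed[OF H Hf]] by simp_all
  have vu3: "?v \<otimes>\<^bsub>P\<^esub> monom P a m = ?u"
    using a f fm by (simp add: monom_pow R.m_comm flip: monom_mult)
  have vnz: "?v \<noteq> \<zero>\<^bsub>P\<^esub>" using fm by (metis coeff_monom coeff_zero)
  let ?H = "poly_values P H (monom P a m)"
  note pv = P.poly_values_subring[OF H aX] P.poly_values_contains[OF H aX] P.poly_values_noetherian[OF H aX HN]
  have "\<exists>c. pchain R n c {a \<in> carrier R. monom P a 0 \<in> D'}"
    if ch: "pchain (P\<lparr>carrier := ?H\<rparr>) (Suc n) D D'" for n D D'
  proof -
    obtain c where c: "pchain (P\<lparr>carrier := H\<rparr>) (Suc n) c (D' \<inter> H)"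
      using P.poly_values_pchain_birational[OF H aX UP_domain HN vu(1,2) vnz vu3 ch] by blast
    moreover have "{a \<in> carrier R. monom P a 0 \<in> D' \<inter> H} = {a \<in> carrier R. monom P a 0 \<in> D'}"
      using Hc by blast
    ultimately show ?thesis using Hp[OF c] by simp
  qed
  then have "bounded_subring f ?H" using pv Hc Hf unfolding bounded_subring_def by blast
  moreover have "?H \<subseteq> A" using A by (intro P.poly_values_minimal[OF H aX]) auto
  ultimately show ?thesis using pv by blast
qed

text \<open>
  A chain in \<open>A\<close> remains strict in a subring that contains one element for each of its links. The monomials of these
  elements belong to \<open>A\<close> and generate, together with \<open>R[f X]\<close>, a subring for which the bound is known.
\<close>

theorem graded_subring_pchain:
  assumes Noeth: "noetherian_ring R" and f: "f \<in> carrier R" "f \<noteq> \<zero>"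
    and A: "subring A P" "\<And>a. a \<in> carrier R \<Longrightarrow> monom P a 0 \<in> A" "monom P f 1 \<in> A"
    and mon: "\<And>p i. p \<in> A \<Longrightarrow> monom P (coeff P p i) i \<in> A"
    and C: "pchain (P\<lparr>carrier := A\<rparr>) (Suc n) D D'"
  shows "\<exists>c. pchain R n c {a \<in> carrier R. monom P a 0 \<in> D'}"
proof -
  have AP: "A \<subseteq> carrier P" using subringE(1)[OF A(1)] .
  have monoms: "\<exists>H\<subseteq>A. bounded_subring f H \<and> M \<subseteq> H"
    if "finite M" "M \<subseteq> A" "\<And>x. x \<in> M \<Longrightarrow> \<exists>a\<in>carrier R. \<exists>m. x = monom P a m" for M
    using that
  proof (induction M rule: finite_induct)
    case empty
    then show ?case using bounded_subring_base[OF Noeth f(1) A] by auto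
  next
    case (insert x M)
    then obtain H where H: "H \<subseteq> A" "bounded_subring f H" "M \<subseteq> H" by auto
    obtain a m where x: "a \<in> carrier R" "x = monom P a m" using insert.prems by blast
    have "monom P a m \<in> A" using insert.prems(1) x(2) by simp
    from bounded_subring_step[OF H(2) f x(1) A(1) H(1) this]
    obtain H' where "H \<subseteq> H'" "H' \<subseteq> A" "monom P a m \<in> H'" "bounded_subring f H'" by blast
    then show ?case using H x by blast
  qed
  have elems: "\<exists>H\<subseteq>A. bounded_subring f H \<and> X \<subseteq> H" if X: "finite X" "X \<subseteq> A" for X
  proof -
    let ?M = "\<Union>p\<in>X. (\<lambda>i. monom P (coeff P p i) i) ` {..deg R p}"
    have Xc: "X \<subseteq> carrier P" using X AP by blast
    have "\<exists>H\<subseteq>A. bounded_subring f H \<and> ?M \<subseteq> H"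
    proof (rule monoms)
      show "finite ?M" using X by blast
      show "?M \<subseteq> A" using mon X by blast
      fix x assume "x \<in> ?M"
      then obtain p i where "p \<in> X" "x = monom P (coeff P p i) i" by blast
      then show "\<exists>a\<in>carrier R. \<exists>m. x = monom P a m"
        using Xc by (intro bexI[of _ "coeff P p i"] exI[of _ i]) auto
    qed
    then obtain H where H: "H \<subseteq> A" "bounded_subring f H" "?M \<subseteq> H" by blast
    have sub: "subring H P" using H by (simp add: bounded_subring_def)
    have "p \<in> H" if p: "p \<in> X" for p
    proof -
      have "(\<Oplus>\<^bsub>P\<^esub> i \<in> {..deg R p}. monom P (coeff P p i) i) \<in> H"
        using p H by (intro P.finsum_mem subringE(1,2,7)[OF sub]) auto
      then show ?thesis using up_repr[of p] p Xc by auto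
    qed
    then show ?thesis using H by blast
  qed
  obtain K where K: "prime_chain (P\<lparr>carrier := A\<rparr>) (Suc n) K" "K 0 = D" "K (Suc n) = D'"
    using C unfolding pchain_def by blast
  have "\<exists>x. x \<in> A \<and> x \<in> K (Suc i) - K i" if "i < Suc n" for i
  proof -
    have "K i \<subset> K (Suc i)" "primeideal (K (Suc i)) (P\<lparr>carrier := A\<rparr>)"
      using K(1) that unfolding prime_chain_def by auto
    then show ?thesis using additive_subgroup.a_subset[OF ideal.axioms(1)[OF primeideal.axioms(1)]] by fastforce
  qed
  then obtain x where x: "\<And>i. i < Suc n \<Longrightarrow> x i \<in> A \<and> x i \<in> K (Suc i) - K i" by metis
  obtain H where H: "H \<subseteq> A" "bounded_subring f H" "x ` {..<Suc n} \<subseteq> H"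
    using elems[of "x ` {..<Suc n}"] x by auto
  have sub: "subring H P" and Hc: "\<And>a. a \<in> carrier R \<Longrightarrow> monom P a 0 \<in> H"
    and Hp: "\<And>n D D'. pchain (P\<lparr>carrier := H\<rparr>) (Suc n) D D' \<Longrightarrow> (\<exists>c. pchain R n c {a \<in> carrier R. monom P a 0 \<in> D'})"
    using H by (auto simp: bounded_subring_def)
  interpret i: ring_hom_cring "P\<lparr>carrier := H\<rparr>" "P\<lparr>carrier := A\<rparr>" id
    by (intro ring_hom_cringI P.subring_is_cring sub A(1) ring_hom_memI) (use H(1) in auto)
  have "pchain (P\<lparr>carrier := H\<rparr>) (Suc n) {r \<in> carrier (P\<lparr>carrier := H\<rparr>). id r \<in> K 0}
      {r \<in> carrier (P\<lparr>carrier := H\<rparr>). id r \<in> K (Suc n)}"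
  proof (rule i.prime_chain_vimage[OF K(1)])
    fix i assume "i < Suc n"
    then show "\<exists>r\<in>carrier (P\<lparr>carrier := H\<rparr>). id r \<in> K (Suc i) - K i"
      using x[of i] H(3) by (intro bexI[of _ "x i"]) auto
  qed
  then obtain c where "pchain R n c {a \<in> carrier R. monom P a 0 \<in> {r \<in> carrier (P\<lparr>carrier := H\<rparr>). id r \<in> K (Suc n)}}"
    using Hp by blast
  moreover have "{a \<in> carrier R. monom P a 0 \<in> {r \<in> carrier (P\<lparr>carrier := H\<rparr>). id r \<in> K (Suc n)}} = {a \<in> carrier R. monom P a 0 \<in> D'}"
    using Hc K(3) by auto
  ultimately show ?thesis by auto
qed

end

section \<open>Quotients and localizations\<close>

lemma (in cring) exists_prime_avoiding:
  assumes J: "ideal J R" and S: "\<one> \<in> S" "\<And>s t. s \<in> S \<Longrightarrow> t \<in> S \<Longrightarrow> s \<otimes> t \<in> S" "S \<subseteq> carrier R"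
    and disj: "J \<inter> S = {}"
  obtains p where "primeideal p R" "J \<subseteq> p" "p \<inter> S = {}"
proof -
  let ?X = "{K. ideal K R \<and> J \<subseteq> K \<and> K \<inter> S = {}}"
  have "\<exists>M\<in>?X. \<forall>I\<in>?X. M \<subseteq> I \<longrightarrow> I = M"
  proof (rule subset_Zorn)
    fix C assume C: "subset.chain ?X C"
    show "\<exists>U\<in>?X. \<forall>c\<in>C. c \<subseteq> U"
    proof (cases "C = {}")
      case True then show ?thesis using J disj by blast
    next
      case False
      have CX: "C \<subseteq> ?X" using C by (simp add: subset_chain_def)
      then have "subset.chain {I. ideal I R} C" using C by (auto simp: subset_chain_def)
      then have "ideal (\<Union>C) R" using chain_Union_is_ideal False by presburger
      then have "\<Union>C \<in> ?X" using CX False by blast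
      then show ?thesis by blast
    qed
  qed
  then obtain M where M0: "M \<in> ?X" "\<forall>I\<in>?X. M \<subseteq> I \<longrightarrow> I = M" by (rule bexE)
  then have M: "ideal M R" "J \<subseteq> M" "M \<inter> S = {}" by simp_all
  have M4: "I = M" if "I \<in> ?X" "M \<subseteq> I" for I using bspec[OF M0(2) that(1)] that(2) by simp
  interpret M: ideal M R by (rule M(1))
  have big: "\<exists>n\<in>M. \<exists>c\<in>carrier R. n \<oplus> c \<otimes> a \<in> S" if a: "a \<in> carrier R" "a \<notin> M" for a
  proof -
    note adj = ideal_adjoin[OF M(1) a(1)]
    have "adjoin R M a \<notin> ?X" using M4[of "adjoin R M a"] adj a by blast
    then have "adjoin R M a \<inter> S \<noteq> {}" using adj M(2) by blast
    then show ?thesis unfolding adjoin_def by blast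
  qed
  have "primeideal M R"
  proof (rule primeidealI[OF M(1) cring_axioms])
    show "carrier R \<noteq> M" using M(3) S by blast
    fix a b assume ab: "a \<in> carrier R" "b \<in> carrier R" "a \<otimes> b \<in> M"
    show "a \<in> M \<or> b \<in> M"
    proof (rule ccontr)
      assume "\<not> (a \<in> M \<or> b \<in> M)"
      then obtain n c m d where *: "n \<in> M" "c \<in> carrier R" "n \<oplus> c \<otimes> a \<in> S" "m \<in> M" "d \<in> carrier R" "m \<oplus> d \<otimes> b \<in> S"
        using big ab by meson
      have nm: "n \<in> carrier R" "m \<in> carrier R" using * by auto
      have "(n \<oplus> c \<otimes> a) \<otimes> (m \<oplus> d \<otimes> b) = n \<otimes> (m \<oplus> d \<otimes> b) \<oplus> ((c \<otimes> a) \<otimes> m \<oplus> (c \<otimes> d) \<otimes> (a \<otimes> b))"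
        using nm * ab by algebra
      moreover have "n \<otimes> (m \<oplus> d \<otimes> b) \<in> M" "(c \<otimes> a) \<otimes> m \<in> M" "(c \<otimes> d) \<otimes> (a \<otimes> b) \<in> M"
        using nm * ab M.I_l_closed M.I_r_closed by auto
      ultimately have "(n \<oplus> c \<otimes> a) \<otimes> (m \<oplus> d \<otimes> b) \<in> M" by simp
      then show False using S(2) * M(3) by blast
    qed
  qed
  then show ?thesis using that M by blast
qed

lemma zero_quot: "\<zero>\<^bsub>R Quot J\<^esub> = J"
  by (simp add: FactRing_def)

lemma carrier_quot: "carrier (R Quot J) = a_r_coset R J ` carrier R"
  by (auto simp: FactRing_def A_RCOSETS_def')

lemma (in cring) quot_vimage_image:
  assumes J: "ideal J R" and p: "ideal p R" "J \<subseteq> p"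
  shows "{r \<in> carrier R. J +> r \<in> (+>) J ` p} = p"
proof
  interpret J: ideal J R by fact
  interpret p: ideal p R by fact
  show "p \<subseteq> {r \<in> carrier R. J +> r \<in> (+>) J ` p}" using p.Icarr by blast
  show "{r \<in> carrier R. J +> r \<in> (+>) J ` p} \<subseteq> p"
  proof clarify
    fix r a assume r: "r \<in> carrier R" "a \<in> p" "J +> r = J +> a"
    then have "r \<ominus> a \<in> J" using quotient_eq_iff_same_a_r_cos[OF J r(1), of a] p.Icarr by simp
    then have "(r \<ominus> a) \<oplus> a \<in> p" using p(2) r by auto
    then show "r \<in> p" using r add_minus_cancel(3)[of r a] p.Icarr by simp
  qed
qed

lemma (in cring) primeideal_quot_image:
  assumes J: "ideal J R" and p: "primeideal p R" "J \<subseteq> p"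
  shows "primeideal ((+>) J ` p) (R Quot J)"
proof -
  interpret J: ideal J R by fact
  interpret p: primeideal p R by fact
  interpret h: ring_hom_cring R "R Quot J" "(+>) J" by (rule J.rcos_ring_hom_cring[OF cring_axioms])
  have surj: "(+>) J ` carrier R = carrier (R Quot J)" by (simp add: carrier_quot)
  note vi = quot_vimage_image[OF J p.ideal_axioms p(2)]
  show ?thesis
  proof (rule primeidealI)
    show "ideal ((+>) J ` p) (R Quot J)"
      using ring_ideal_imp_quot_ideal[OF J p.ideal_axioms] .
    show "cring (R Quot J)" by (rule h.S.cring_axioms)
    show "carrier (R Quot J) \<noteq> (+>) J ` p" using vi surj p.one_notin by blast
    fix x y assume xy: "x \<in> carrier (R Quot J)" "y \<in> carrier (R Quot J)" "x \<otimes>\<^bsub>R Quot J\<^esub> y \<in> (+>) J ` p"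
    then obtain a b where ab: "a \<in> carrier R" "b \<in> carrier R" "x = J +> a" "y = J +> b" unfolding carrier_quot by blast
    then have "J +> (a \<otimes> b) \<in> (+>) J ` p" using xy(3) by simp
    then have "a \<otimes> b \<in> p" using vi ab by blast
    then show "x \<in> (+>) J ` p \<or> y \<in> (+>) J ` p" using p.I_prime ab by blast
  qed
qed

lemma (in cring) quot_prime_chain:
  assumes J: "ideal J R"
  shows "(\<exists>C. prime_chain (R Quot J) n C) \<longleftrightarrow> (\<exists>C. prime_chain R n C \<and> J \<subseteq> C 0)"
proof
  interpret J: ideal J R by fact
  interpret h: ring_hom_cring R "R Quot J" "(+>) J" by (rule J.rcos_ring_hom_cring[OF cring_axioms])
  have surj: "(+>) J ` carrier R = carrier (R Quot J)" by (simp add: carrier_quot)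
  {
    assume "\<exists>C. prime_chain (R Quot J) n C"
    then obtain C where C: "prime_chain (R Quot J) n C" ..
    then have "pchain (R Quot J) n (C 0) (C n)" by (auto simp: pchain_def)
    from h.pchain_vimage_surj[OF this surj]
    obtain D where D: "prime_chain R n D" "D 0 = {r \<in> carrier R. J +> r \<in> C 0}" by (auto simp: pchain_def)
    interpret C0: primeideal "C 0" "R Quot J" using C by (auto simp: prime_chain_def)
    have "J \<subseteq> D 0"
    proof
      fix j assume "j \<in> J"
      then have e: "J +> j = \<zero>\<^bsub>R Quot J\<^esub>" unfolding zero_quot by (rule J.a_rcos_const)
      have "\<zero>\<^bsub>R Quot J\<^esub> \<in> C 0" by (rule additive_subgroup.zero_closed[OF C0.additive_subgroup_axioms])
      then have "J +> j \<in> C 0" unfolding e .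
      then show "j \<in> D 0" unfolding D(2) using J.Icarr[OF \<open>j \<in> J\<close>] by blast
    qed
    then show "\<exists>C. prime_chain R n C \<and> J \<subseteq> C 0" using D by blast
  }
  {
    assume "\<exists>C. prime_chain R n C \<and> J \<subseteq> C 0"
    then obtain C where C: "prime_chain R n C" "J \<subseteq> C 0" by blast
    have JC: "J \<subseteq> C i" if "i \<le> n" for i using that
    proof (induction i)
      case (Suc i)
      then have "C i \<subset> C (Suc i)" using C(1) by (simp add: prime_chain_def)
      then show ?case using Suc by auto
    qed (use C in auto)
    have pr: "primeideal (C i) R" if "i \<le> n" for i using C(1) that by (simp add: prime_chain_def)
    have "prime_chain (R Quot J) n (\<lambda>i. (+>) J ` C i)"
      unfolding prime_chain_def
    proof (intro conjI allI impI)
      fix i assume i: "i \<le> n"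
      then show "primeideal ((+>) J ` C i) (R Quot J)" using primeideal_quot_image[OF J pr JC] by simp
    next
      fix i assume i: "i < n"
      have sub: "C i \<subset> C (Suc i)" using C(1) i by (simp add: prime_chain_def)
      have id: "ideal (C i) R" "ideal (C (Suc i)) R"
        using primeideal.axioms(1)[OF pr[of i]] primeideal.axioms(1)[OF pr[of "Suc i"]] i by simp_all
      have "J \<subseteq> C i" "J \<subseteq> C (Suc i)" using JC i by simp_all
      then have v: "{r \<in> carrier R. J +> r \<in> (+>) J ` C i} = C i"
        "{r \<in> carrier R. J +> r \<in> (+>) J ` C (Suc i)} = C (Suc i)"
        using quot_vimage_image[OF J id(1)] quot_vimage_image[OF J id(2)] by simp_all
      have "(+>) J ` C i \<noteq> (+>) J ` C (Suc i)"
      proof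
        assume eq: "(+>) J ` C i = (+>) J ` C (Suc i)"
        show False using v(1) unfolding eq v(2) using sub by blast
      qed
      then show "(+>) J ` C i \<subset> (+>) J ` C (Suc i)" using sub by blast
    qed
    then show "\<exists>C. prime_chain (R Quot J) n C" by blast
  }
qed

context mult_set
begin

definition extension :: "'a set \<Rightarrow> ('a \<times> 'a) set set" where
  "extension p = {fraction R S a s | a s. a \<in> p \<and> s \<in> S}"

lemma frac_mem_extension:
  assumes p: "primeideal p R" "p \<inter> S = {}" and a: "a \<in> carrier R" "s \<in> S"
  shows "fraction R S a s \<in> extension p \<longleftrightarrow> a \<in> p"
proof
  interpret p: primeideal p R by (rule p)
  assume "fraction R S a s \<in> extension p"
  then obtain b t where bt: "b \<in> p" "t \<in> S" "fraction R S a s = fraction R S b t" by (auto simp: extension_def)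
  then obtain u where u: "u \<in> S" "u \<otimes> (a \<otimes> t) = u \<otimes> (b \<otimes> s)" using frac_eq[of a s b t] a by auto
  have "u \<otimes> (b \<otimes> s) \<in> p" using bt u a p.I_l_closed p.I_r_closed by simp
  then have "u \<otimes> (a \<otimes> t) \<in> p" using u by simp
  moreover have "u \<notin> p" "t \<notin> p" using u bt p(2) by auto
  ultimately show "a \<in> p" using p.I_prime a u bt by (metis S_carr m_closed)
qed (use a in \<open>auto simp: extension_def\<close>)

lemma primeideal_extension:
  assumes p: "primeideal p R" "p \<inter> S = {}"
  shows "primeideal (extension p) (localization R S)"
proof -
  interpret p: primeideal p R by (rule p)
  show ?thesis
  proof (rule primeidealI)
    show "ideal (extension p) (localization R S)" unfolding extension_def by (rule ideal_fractions[OF p.ideal_axioms])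
    show "cring (localization R S)" by (rule cring_localization)
    have "fraction R S \<one> \<one> \<notin> extension p" using frac_mem_extension[OF p] p.one_notin by simp
    moreover have "fraction R S \<one> \<one> \<in> carrier (localization R S)" by (simp add: frac_in_carrier)
    ultimately show "carrier (localization R S) \<noteq> extension p" by blast
    fix x y assume xy: "x \<in> carrier (localization R S)" "y \<in> carrier (localization R S)"
      "x \<otimes>\<^bsub>localization R S\<^esub> y \<in> extension p"
    obtain a s where a: "a \<in> carrier R" "s \<in> S" "x = fraction R S a s" using xy(1) by (rule frac_cases)
    obtain b t where b: "b \<in> carrier R" "t \<in> S" "y = fraction R S b t" using xy(2) by (rule frac_cases)
    have "a \<otimes> b \<in> p" using xy(3) a b frac_mem_extension[OF p] by (simp add: frac_mult)
    then show "x \<in> extension p \<or> y \<in> extension p" using p.I_prime a b frac_mem_extension[OF p] by blast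
  qed
qed

lemma frac_mult_den: "a \<in> carrier R \<Longrightarrow> s \<in> S \<Longrightarrow> fraction R S s \<one> \<otimes>\<^bsub>localization R S\<^esub> fraction R S a s = fraction R S a \<one>"
  by (simp add: frac_mult) (rule frac_eqI, auto simp: m_ac)

lemma frac_inv: "s \<in> S \<Longrightarrow> fraction R S \<one> s \<otimes>\<^bsub>localization R S\<^esub> fraction R S s \<one> = \<one>\<^bsub>localization R S\<^esub>"
  by (simp add: frac_mult frac_one) (rule frac_eqI, auto)

lemma frac_unit_ideal:
  assumes J: "ideal J (localization R S)" and a: "a \<in> S" "s \<in> S" "fraction R S a s \<in> J"
  shows "J = carrier (localization R S)"
proof -
  interpret J: ideal J "localization R S" by fact
  have "fraction R S s a \<otimes>\<^bsub>localization R S\<^esub> fraction R S a s \<in> J"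
    using a by (intro J.I_l_closed) (auto simp: frac_in_carrier)
  moreover have "fraction R S s a \<otimes>\<^bsub>localization R S\<^esub> fraction R S a s = \<one>\<^bsub>localization R S\<^esub>"
    using a by (simp add: frac_mult frac_one) (rule frac_eqI, auto simp: m_comm)
  ultimately show ?thesis using J.one_imp_carrier by simp
qed

end

context cring
begin

lemma extend_at_extension: "primeideal Q R \<Longrightarrow> ideal J R \<Longrightarrow> extend_at R Q J = mult_set.extension R (carrier R - Q) J"
  by (simp add: extend_at_eq mult_set.extension_def[OF mult_set_prime])

lemma proper_ideal_localization_at:
  assumes Q: "primeideal Q R" and J: "ideal J (localization_at R Q)" "J \<noteq> carrier (localization_at R Q)"
  shows "J \<subseteq> extend_at R Q Q"
proof
  interpret S: mult_set R "carrier R - Q" by (rule mult_set_prime[OF Q])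
  interpret Q: primeideal Q R by (rule Q)
  interpret J: ideal J "localization R (carrier R - Q)" using J by (simp add: localization_at_def)
  fix x assume x: "x \<in> J"
  then obtain a s where a: "a \<in> carrier R" "s \<in> carrier R - Q" "x = fraction R (carrier R - Q) a s"
    using J.Icarr S.frac_cases by metis
  have "a \<in> Q"
  proof (rule ccontr)
    assume "a \<notin> Q"
    then show False using S.frac_unit_ideal[OF J.ideal_axioms, of a s] a x J(2) by (simp add: localization_at_def)
  qed
  then show "x \<in> extend_at R Q Q" using a extend_at_eq[OF Q Q.ideal_axioms] by blast
qed

lemma primeideal_extend_at:
  assumes Q: "primeideal Q R" and p: "primeideal p R" "p \<subseteq> Q"
  shows "primeideal (extend_at R Q p) (localization_at R Q)"
    and "a \<in> carrier R \<Longrightarrow> s \<in> carrier R - Q \<Longrightarrow> fraction R (carrier R - Q) a s \<in> extend_at R Q p \<longleftrightarrow> a \<in> p"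
proof -
  interpret S: mult_set R "carrier R - Q" by (rule mult_set_prime[OF Q])
  interpret p: primeideal p R by (rule p)
  have d: "p \<inter> (carrier R - Q) = {}" using p(2) by blast
  show "primeideal (extend_at R Q p) (localization_at R Q)"
    using S.primeideal_extension[OF p(1) d] extend_at_extension[OF Q p.ideal_axioms] by (simp add: localization_at_def)
  show "a \<in> carrier R \<Longrightarrow> s \<in> carrier R - Q \<Longrightarrow> fraction R (carrier R - Q) a s \<in> extend_at R Q p \<longleftrightarrow> a \<in> p"
    using S.frac_mem_extension[OF p(1) d] extend_at_extension[OF Q p.ideal_axioms] by simp
qed

lemma max_ideal_localization_at:
  assumes Q: "primeideal Q R"
  shows "max_ideal (localization_at R Q) = extend_at R Q Q"
    and "maximalideal (extend_at R Q Q) (localization_at R Q)"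
proof -
  interpret Q: primeideal Q R by (rule Q)
  interpret E: primeideal "extend_at R Q Q" "localization_at R Q" by (rule primeideal_extend_at(1)[OF Q Q order_refl])
  show max: "maximalideal (extend_at R Q Q) (localization_at R Q)"
  proof (rule maximalidealI[OF E.ideal_axioms E.I_notcarr])
    fix J assume "ideal J (localization_at R Q)" "extend_at R Q Q \<subseteq> J" "J \<subseteq> carrier (localization_at R Q)"
    then show "J = extend_at R Q Q \<or> J = carrier (localization_at R Q)"
      using proper_ideal_localization_at[OF Q] by blast
  qed
  show "max_ideal (localization_at R Q) = extend_at R Q Q"
    unfolding max_ideal_def
  proof (rule the_equality, rule max)
    fix M assume M: "maximalideal M (localization_at R Q)"
    interpret M: maximalideal M "localization_at R Q" by (rule M)
    have "M \<subseteq> extend_at R Q Q" using proper_ideal_localization_at[OF Q M.ideal_axioms] M.I_notcarr by blast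
    then show "M = extend_at R Q Q"
      using M.I_maximal[OF E.ideal_axioms] E.I_notcarr E.a_subset by blast
  qed
qed

end

section \<open>Rees rings and localization\<close>

lemma (in cring) mult_swap_distr:
  "\<lbrakk>s \<in> carrier R; t \<in> carrier R; x \<in> carrier R; y \<in> carrier R\<rbrakk> \<Longrightarrow>
    (s \<otimes> t) \<otimes> (x \<oplus> y) = t \<otimes> (s \<otimes> x) \<oplus> s \<otimes> (t \<otimes> y)"
  by algebra

lemma UP_map_hom:
  assumes "ring_hom_cring R S h"
  shows "(\<lambda>p n. h (coeff (UP R) p n)) \<in> ring_hom (UP R) (UP S)"
    and "a \<in> carrier R \<Longrightarrow> (\<lambda>n. h (coeff (UP R) (monom (UP R) a k) n)) = monom (UP S) (h a) k"
    and "p \<in> carrier (UP R) \<Longrightarrow> coeff (UP S) (\<lambda>n. h (coeff (UP R) p n)) n = h (coeff (UP R) p n)"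
proof -
  interpret h: ring_hom_cring R S h by fact
  interpret UR: UP_cring R "UP R" by unfold_locales
  interpret US: UP_cring S "UP S" by unfold_locales
  define f where "f p = (\<lambda>n. h (coeff (UP R) p n))" for p
  have cl: "f p \<in> carrier (UP S)" if p: "p \<in> carrier (UP R)" for p
  proof -
    obtain n where "bound \<zero>\<^bsub>R\<^esub> n (coeff (UP R) p)" using p by (auto simp: UP_def)
    then have "bound \<zero>\<^bsub>S\<^esub> n (f p)" by (auto simp: bound_def f_def)
    moreover have "f p n \<in> carrier S" for n using UR.coeff_closed[OF p] by (simp add: f_def)
    ultimately show ?thesis by (auto simp: UP_def)
  qed
  have co: "coeff (UP S) (f p) n = h (coeff (UP R) p n)" if p: "p \<in> carrier (UP R)" for p n
  proof -
    have "coeff (UP S) (f p) = f p" using cl[OF p] by (simp add: UP_def)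
    then show ?thesis by (simp add: f_def)
  qed
  then show "p \<in> carrier (UP R) \<Longrightarrow> coeff (UP S) (\<lambda>n. h (coeff (UP R) p n)) n = h (coeff (UP R) p n)"
    by (simp add: f_def)
  show "(\<lambda>n. h (coeff (UP R) (monom (UP R) a k) n)) = monom (UP S) (h a) k" if a: "a \<in> carrier R"
    unfolding f_def[symmetric]
    using a by (intro US.up_eqI) (auto simp: cl co)
  show "(\<lambda>p n. h (coeff (UP R) p n)) \<in> ring_hom (UP R) (UP S)"
    unfolding f_def[symmetric]
  proof (rule ring_hom_memI)
    fix p q assume pq: "p \<in> carrier (UP R)" "q \<in> carrier (UP R)"
    show "f (p \<otimes>\<^bsub>UP R\<^esub> q) = f p \<otimes>\<^bsub>UP S\<^esub> f q"
    proof (rule US.up_eqI)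
      fix n
      have "coeff (UP S) (f (p \<otimes>\<^bsub>UP R\<^esub> q)) n = h (\<Oplus>\<^bsub>R\<^esub>i\<in>{..n}. coeff (UP R) p i \<otimes>\<^bsub>R\<^esub> coeff (UP R) q (n - i))"
        using pq by (simp add: co)
      also have "\<dots> = (\<Oplus>\<^bsub>S\<^esub>i\<in>{..n}. h (coeff (UP R) p i) \<otimes>\<^bsub>S\<^esub> h (coeff (UP R) q (n - i)))"
        using pq by (subst h.ring.hom_finsum) (auto simp: comp_def intro!: h.S.finsum_cong')
      also have "\<dots> = coeff (UP S) (f p \<otimes>\<^bsub>UP S\<^esub> f q) n"
        using pq by (simp add: co cl)
      finally show "coeff (UP S) (f (p \<otimes>\<^bsub>UP R\<^esub> q)) n = coeff (UP S) (f p \<otimes>\<^bsub>UP S\<^esub> f q) n" .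
    qed (use pq in \<open>auto simp: cl\<close>)
    show "f (p \<oplus>\<^bsub>UP R\<^esub> q) = f p \<oplus>\<^bsub>UP S\<^esub> f q"
      using pq by (intro US.up_eqI) (auto simp: cl co)
  next
    show "f \<one>\<^bsub>UP R\<^esub> = \<one>\<^bsub>UP S\<^esub>"
      by (intro US.up_eqI) (auto simp: cl co)
  qed (rule cl)
qed

lemma (in filtration) rees_subring:
  shows "subring {p \<in> carrier (UP R). \<forall>n. coeff (UP R) p n \<in> F n} (UP R)"
    and "a \<in> F n \<Longrightarrow> monom (UP R) a n \<in> {p \<in> carrier (UP R). \<forall>n. coeff (UP R) p n \<in> F n}"
proof -
  interpret U: UP_cring R "UP R" by unfold_locales
  interpret c: cring "rees_ring R F" by (rule cring_rees)
  show "subring {p \<in> carrier (UP R). \<forall>n. coeff (UP R) p n \<in> F n} (UP R)"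
    by (rule U.P.ring_incl_imp_subring) (use c.ring_axioms in \<open>auto simp: rees_ring_def\<close>)
  show "a \<in> F n \<Longrightarrow> monom (UP R) a n \<in> {p \<in> carrier (UP R). \<forall>n. coeff (UP R) p n \<in> F n}"
    using ideal.Icarr[OF ideals] additive_subgroup.zero_closed[OF ideal.axioms(1)[OF ideals]] by auto
qed

lemma rees_simps:
  "carrier (rees_ring R F) = {p \<in> carrier (UP R). \<forall>n. coeff (UP R) p n \<in> F n}"
  "mult (rees_ring R F) = mult (UP R)" "add (rees_ring R F) = add (UP R)"
  "one (rees_ring R F) = one (UP R)" "zero (rees_ring R F) = zero (UP R)"
  by (simp_all add: rees_ring_def)

text \<open>
  Every element of the Rees ring over the localization becomes, after multiplication by some \<open>s \<notin> Q\<close>, the image of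
  an element of the Rees ring over \<open>R\<close>, and \<open>s\<close> is a unit. So the chain stays strict on contraction. Its members meet the
  local ring exactly in the maximal ideal and therefore lie over \<open>Q\<close>.
\<close>

lemma (in filtration) rees_chain_contract:
  assumes Q: "primeideal Q R"
  defines "L \<equiv> localization_at R Q" and "G \<equiv> localize_filtration R F Q"
  assumes C: "prime_chain (rees_ring L G) n C"
    and max: "(\<lambda>a. monom (UP L) a 0) ` max_ideal L \<subseteq> C 0"
  shows "\<exists>D. prime_chain (rees_ring R F) n D \<and> (\<forall>i\<le>n. {a \<in> carrier R. monom (UP R) a 0 \<in> D i} = Q)"
proof -
  let ?S = "carrier R - Q"
  interpret S: mult_set R ?S by (rule mult_set_prime[OF Q])
  interpret Q: primeideal Q R by (rule Q)
  interpret L: cring L unfolding L_def by (rule cring_localization_at[OF Q])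
  interpret G: filtration L G unfolding L_def G_def by (rule filtration_localize[OF Q])
  have LS: "L = localization R ?S" by (simp add: L_def localization_at_def)
  let ?h = "\<lambda>a. fraction R ?S a \<one>"
  have h: "ring_hom_cring R L ?h"
    using S.fraction_hom by (intro ring_hom_cringI cring_axioms L.cring_axioms) (simp add: LS)
  interpret h: ring_hom_cring R L ?h by (rule h)
  interpret UR: UP_cring R "UP R" by unfold_locales
  interpret UL: UP_cring L "UP L" by unfold_locales
  let ?A = "rees_ring R F" and ?B = "rees_ring L G"
  interpret A: cring ?A by (rule cring_rees)
  interpret B: cring ?B by (rule G.cring_rees)
  define th where "th = (\<lambda>p n. ?h (coeff (UP R) p n))"
  have th: "th \<in> ring_hom (UP R) (UP L)" "\<And>a k. a \<in> carrier R \<Longrightarrow> th (monom (UP R) a k) = monom (UP L) (?h a) k"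
    "\<And>p n. p \<in> carrier (UP R) \<Longrightarrow> coeff (UP L) (th p) n = ?h (coeff (UP R) p n)"
    using UP_map_hom[OF h] unfolding th_def by auto
  interpret th': ring_hom_cring "UP R" "UP L" th by (intro ring_hom_cringI UR.P.cring_axioms UL.P.cring_axioms th)
  have FG: "?h a \<in> G k" if "a \<in> F k" for a k
    using that S.S_one unfolding G_def localize_filtration_def extend_at_eq[OF Q ideals] by blast
  have thc: "th p \<in> carrier ?B" if "p \<in> carrier ?A" for p
    using that th(3) FG th'.hom_closed by (auto simp: rees_simps)
  interpret th: ring_hom_cring ?A ?B th
    by (intro ring_hom_cringI A.cring_axioms B.cring_axioms ring_hom_memI thc) (auto simp: rees_simps)
  have monA: "monom (UP R) a k \<in> carrier ?A" if "a \<in> F k" for a k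
    using rees_subring(2)[OF that] by (simp add: rees_simps)
  have monA0: "monom (UP R) a 0 \<in> carrier ?A" if "a \<in> carrier R" for a
    using monA[of a 0] that zeroth by simp
  have monB0: "monom (UP L) a 0 \<in> carrier ?B" if "a \<in> carrier L" for a
    using G.rees_subring(2)[of a 0] that G.zeroth by (simp add: rees_simps)
  have denom: "\<exists>s\<in>?S. \<exists>a\<in>carrier ?A. monom (UP L) (?h s) 0 \<otimes>\<^bsub>UP L\<^esub> b = th a" if b: "b \<in> carrier ?B" for b
  proof -
    let ?H = "{b \<in> carrier (UP L). \<exists>s\<in>?S. \<exists>a\<in>carrier ?A. monom (UP L) (?h s) 0 \<otimes>\<^bsub>UP L\<^esub> b = th a}"
    have bc: "b \<in> carrier (UP L)" using b by (simp add: rees_simps)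
    have "b \<in> ?H"
    proof (rule UL.poly_mem[OF bc])
      show "?H \<subseteq> carrier (UP L)" by blast
      show "\<zero>\<^bsub>UP L\<^esub> \<in> ?H"
        using S.S_one A.zero_closed th.hom_zero
        by (intro CollectI conjI bexI[of _ \<one>] bexI[of _ "\<zero>\<^bsub>UP R\<^esub>"]) (auto simp: rees_simps simp del: A.zero_closed)
    next
      fix x y assume "x \<in> ?H" "y \<in> ?H"
      then obtain s a t c where *: "x \<in> carrier (UP L)" "s \<in> ?S" "a \<in> carrier ?A" "monom (UP L) (?h s) 0 \<otimes>\<^bsub>UP L\<^esub> x = th a"
        "y \<in> carrier (UP L)" "t \<in> ?S" "c \<in> carrier ?A" "monom (UP L) (?h t) 0 \<otimes>\<^bsub>UP L\<^esub> y = th c" by blast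
      let ?s = "monom (UP L) (?h s) 0" and ?t = "monom (UP L) (?h t) 0"
      have st: "?s \<in> carrier (UP L)" "?t \<in> carrier (UP L)" using * h.hom_closed by auto
      have m: "monom (UP L) (?h (s \<otimes> t)) 0 = ?s \<otimes>\<^bsub>UP L\<^esub> ?t"
        using * h.hom_closed by (simp flip: UL.monom_mult)
      have "monom (UP L) (?h (s \<otimes> t)) 0 \<otimes>\<^bsub>UP L\<^esub> (x \<oplus>\<^bsub>UP L\<^esub> y) = ?t \<otimes>\<^bsub>UP L\<^esub> (?s \<otimes>\<^bsub>UP L\<^esub> x) \<oplus>\<^bsub>UP L\<^esub> ?s \<otimes>\<^bsub>UP L\<^esub> (?t \<otimes>\<^bsub>UP L\<^esub> y)"
        unfolding m using st *(1,5) UL.P.mult_swap_distr by blast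
      also have "\<dots> = th (monom (UP R) t 0 \<otimes>\<^bsub>UP R\<^esub> a \<oplus>\<^bsub>UP R\<^esub> monom (UP R) s 0 \<otimes>\<^bsub>UP R\<^esub> c)"
        using * th(2) by (simp add: rees_simps)
      finally have e: "monom (UP L) (?h (s \<otimes> t)) 0 \<otimes>\<^bsub>UP L\<^esub> (x \<oplus>\<^bsub>UP L\<^esub> y) = th (monom (UP R) t 0 \<otimes>\<^bsub>UP R\<^esub> a \<oplus>\<^bsub>UP R\<^esub> monom (UP R) s 0 \<otimes>\<^bsub>UP R\<^esub> c)" .
      have "monom (UP R) t 0 \<otimes>\<^bsub>?A\<^esub> a \<oplus>\<^bsub>?A\<^esub> monom (UP R) s 0 \<otimes>\<^bsub>?A\<^esub> c \<in> carrier ?A"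
        using * monA0 by simp
      then have "monom (UP R) t 0 \<otimes>\<^bsub>UP R\<^esub> a \<oplus>\<^bsub>UP R\<^esub> monom (UP R) s 0 \<otimes>\<^bsub>UP R\<^esub> c \<in> carrier ?A"
        by (simp only: rees_simps)
      moreover have "s \<otimes> t \<in> ?S" using S.S_mult *(2,6) by blast
      ultimately show "x \<oplus>\<^bsub>UP L\<^esub> y \<in> ?H" using e *(1,5) by blast
    next
      fix i
      have "coeff (UP L) b i \<in> G i" using b by (simp add: rees_simps)
      then obtain a s where as: "coeff (UP L) b i = fraction R ?S a s" "a \<in> F i" "s \<in> ?S"
        unfolding G_def localize_filtration_def extend_at_eq[OF Q ideals] by blast
      have ac: "a \<in> carrier R" using as ideal.Icarr[OF ideals] by blast
      have fl: "fraction R ?S a s \<in> carrier L" using S.frac_in_carrier ac as by (simp add: LS)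
      have "?h s \<otimes>\<^bsub>L\<^esub> fraction R ?S a s = ?h a"
        unfolding LS by (rule S.frac_mult_den[OF ac as(3)])
      then have "monom (UP L) (?h s) 0 \<otimes>\<^bsub>UP L\<^esub> monom (UP L) (fraction R ?S a s) i = th (monom (UP R) a i)"
        using fl h.hom_closed as ac th(2) by (simp flip: UL.monom_mult)
      moreover have "monom (UP L) (coeff (UP L) b i) i \<in> carrier (UP L)" using bc by simp
      ultimately show "monom (UP L) (coeff (UP L) b i) i \<in> ?H"
        using as monA[OF as(2)] by auto
    qed
    then show ?thesis by blast
  qed
  have pr: "primeideal (C i) ?B" if "i \<le> n" for i using C that by (simp add: prime_chain_def)
  have unit: "monom (UP L) (?h s) 0 \<notin> C i" if s: "s \<in> ?S" and i: "i \<le> n" for s i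
  proof
    interpret Ci: primeideal "C i" ?B by (rule pr[OF i])
    assume a: "monom (UP L) (?h s) 0 \<in> C i"
    have fl: "fraction R ?S \<one> s \<in> carrier L" using S.frac_in_carrier s by (simp add: LS)
    have "fraction R ?S \<one> s \<otimes>\<^bsub>L\<^esub> ?h s = \<one>\<^bsub>L\<^esub>"
      unfolding LS by (rule S.frac_inv[OF s])
    then have "monom (UP L) (fraction R ?S \<one> s) 0 \<otimes>\<^bsub>UP L\<^esub> monom (UP L) (?h s) 0 = \<one>\<^bsub>UP L\<^esub>"
      using fl s h.hom_closed by (simp flip: UL.monom_mult)
    moreover have "monom (UP L) (fraction R ?S \<one> s) 0 \<otimes>\<^bsub>?B\<^esub> monom (UP L) (?h s) 0 \<in> C i"
      using Ci.I_l_closed[OF a monB0[OF fl]] .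
    ultimately show False using Ci.one_notin by (simp add: rees_simps)
  qed
  have mono: "C 0 \<subseteq> C i" if "i \<le> n" for i using that
  proof (induction i)
    case (Suc i)
    then have "C i \<subset> C (Suc i)" using C by (simp add: prime_chain_def)
    then show ?case using Suc by auto
  qed auto
  let ?D = "\<lambda>i. {r \<in> carrier ?A. th r \<in> C i}"
  have "prime_chain ?A n ?D" unfolding prime_chain_def
  proof (intro conjI allI impI)
    fix i assume "i \<le> n" then show "primeideal (?D i) ?A" using th.primeideal_vimage pr by blast
  next
    fix i assume i: "i < n"
    then have sub: "C i \<subset> C (Suc i)" using C by (simp add: prime_chain_def)
    interpret Ci: primeideal "C i" ?B using pr i by simp
    interpret CSi: primeideal "C (Suc i)" ?B using pr i by simp
    obtain b where b: "b \<in> C (Suc i)" "b \<notin> C i" using sub by blast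
    have bc: "b \<in> carrier ?B" using b CSi.Icarr by blast
    obtain s a where sa: "s \<in> ?S" "a \<in> carrier ?A" "monom (UP L) (?h s) 0 \<otimes>\<^bsub>UP L\<^esub> b = th a" using denom[OF bc] by blast
    have sB: "monom (UP L) (?h s) 0 \<in> carrier ?B" using monB0 sa h.hom_closed by blast
    have e: "th a = monom (UP L) (?h s) 0 \<otimes>\<^bsub>?B\<^esub> b" using sa by (simp add: rees_simps)
    have "th a \<in> C (Suc i)" unfolding e using CSi.I_l_closed[OF b(1) sB] .
    moreover have "th a \<notin> C i" unfolding e using Ci.I_prime[OF sB bc] unit[OF sa(1), of i] i b by auto
    ultimately show "?D i \<subset> ?D (Suc i)" using sub sa(2) by blast
  qed
  moreover have "{a \<in> carrier R. monom (UP R) a 0 \<in> ?D i} = Q" if i: "i \<le> n" for i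
  proof
    interpret Ci: primeideal "C i" ?B by (rule pr[OF i])
    show "{a \<in> carrier R. monom (UP R) a 0 \<in> ?D i} \<subseteq> Q"
    proof
      fix a assume "a \<in> {a \<in> carrier R. monom (UP R) a 0 \<in> ?D i}"
      then have "a \<in> carrier R" "monom (UP L) (?h a) 0 \<in> C i" using th(2) by auto
      then show "a \<in> Q" using unit[OF _ i, of a] by blast
    qed
    show "Q \<subseteq> {a \<in> carrier R. monom (UP R) a 0 \<in> ?D i}"
    proof
      fix a assume a: "a \<in> Q"
      then have ac: "a \<in> carrier R" by auto
      have "?h a \<in> max_ideal L" using a S.S_one
        unfolding L_def max_ideal_localization_at(1)[OF Q] extend_at_eq[OF Q Q.ideal_axioms] by blast
      then have "th (monom (UP R) a 0) \<in> C 0" using max th(2)[OF ac] by auto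
      then show "a \<in> {a \<in> carrier R. monom (UP R) a 0 \<in> ?D i}" using mono[OF i] ac monA0[OF ac] by blast
    qed
  qed
  ultimately show ?thesis by blast
qed

section \<open>Symbolic powers of an intersection of primes\<close>

lemma (in cring) contract_extend_at:
  assumes Q: "primeideal Q R" and J: "ideal J R"
  shows "contract_at R Q (extend_at R Q J) = saturation R Q J"
proof -
  interpret S: mult_set R "carrier R - Q" by (rule mult_set_prime[OF Q])
  interpret Q: primeideal Q R by (rule Q)
  interpret J: ideal J R by (rule J)
  show ?thesis
  proof
    show "contract_at R Q (extend_at R Q J) \<subseteq> saturation R Q J"
    proof
      fix x assume "x \<in> contract_at R Q (extend_at R Q J)"
      then have x: "x \<in> carrier R" "fraction R (carrier R - Q) x \<one> \<in> extend_at R Q J"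
        by (auto simp: contract_at_def to_localization_at_def)
      obtain a s where a: "a \<in> J" "s \<in> carrier R - Q" "fraction R (carrier R - Q) x \<one> = fraction R (carrier R - Q) a s"
        using x(2) unfolding extend_at_eq[OF Q J] by blast
      then have "\<exists>u\<in>carrier R - Q. u \<otimes> (x \<otimes> s) = u \<otimes> (a \<otimes> \<one>)"
        using S.frac_eq[OF x(1) S.S_one J.Icarr[OF a(1)] a(2)] by blast
      then obtain u where u: "u \<in> carrier R - Q" "u \<otimes> (x \<otimes> s) = u \<otimes> (a \<otimes> \<one>)" ..
      have "(u \<otimes> s) \<otimes> x = u \<otimes> a" using u a(1,2) x(1) by (auto simp: m_ac)
      moreover have "u \<otimes> a \<in> J" using u a J.I_l_closed by blast
      ultimately have "(u \<otimes> s) \<otimes> x \<in> J" by simp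
      then show "x \<in> saturation R Q J"
        using S.S_mult[OF u(1) a(2)] x(1) unfolding saturation_def by blast
    qed
    show "saturation R Q J \<subseteq> contract_at R Q (extend_at R Q J)"
    proof
      fix x assume "x \<in> saturation R Q J"
      then obtain s where s: "x \<in> carrier R" "s \<in> carrier R - Q" "s \<otimes> x \<in> J" by (auto simp: saturation_def)
      have "fraction R (carrier R - Q) x \<one> = fraction R (carrier R - Q) (s \<otimes> x) s"
        using s S.S_one by (intro S.frac_eqI) (auto simp: m_ac)
      then have "fraction R (carrier R - Q) x \<one> \<in> extend_at R Q J"
        unfolding extend_at_eq[OF Q J] using s by blast
      then show "x \<in> contract_at R Q (extend_at R Q J)" using s by (simp add: contract_at_def to_localization_at_def)
    qed
  qed
qed

text \<open>A product of elements of the ideals, each chosen outside the prime ideal.\<close>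

lemma (in primeideal) exists_outside_prime_in_ideals:
  assumes "finite W" "\<And>J. J \<in> W \<Longrightarrow> ideal J R" "\<And>J. J \<in> W \<Longrightarrow> \<not> J \<subseteq> I"
  shows "\<exists>x\<in>carrier R. x \<notin> I \<and> (\<forall>J\<in>W. x \<in> J)"
  using assms
proof (induction W rule: finite_induct)
  case empty
  then show ?case using one_notin by blast
next
  case (insert J W)
  then obtain x where x: "x \<in> carrier R" "x \<notin> I" "\<forall>J\<in>W. x \<in> J" by auto
  obtain y where y: "y \<in> J" "y \<notin> I" using insert.prems(2)[of J] by blast
  have yc: "y \<in> carrier R" using y ideal.Icarr[OF insert.prems(1)[of J]] by blast
  have "x \<otimes> y \<notin> I" using I_prime x y yc by blast
  moreover have "x \<otimes> y \<in> K" if "K \<in> W" for K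
    using ideal.I_r_closed[OF insert.prems(1)[of K]] that x yc by blast
  moreover have "x \<otimes> y \<in> J" using ideal.I_l_closed[OF insert.prems(1)[of J]] x y by blast
  ultimately show ?case using x yc by (intro bexI[of _ "x \<otimes> y"]) auto
qed

lemma (in cring) associated_primes_Inter:
  assumes fin: "finite W" and pr: "\<And>p. p \<in> W \<Longrightarrow> primeideal p R"
    and inc: "\<And>p p'. p \<in> W \<Longrightarrow> p' \<in> W \<Longrightarrow> p \<subseteq> p' \<Longrightarrow> p = p'"
    and ne: "W \<noteq> {}"
  shows "associated_primes R (\<Inter>W) = W"
proof
  have id: "ideal p R" if "p \<in> W" for p using pr[OF that] primeideal.axioms(1) by blast
  show "associated_primes R (\<Inter>W) \<subseteq> W"
  proof
    fix Q assume "Q \<in> associated_primes R (\<Inter>W)"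
    then obtain x where Q: "primeideal Q R" "x \<in> carrier R" "Q = {r \<in> carrier R. r \<otimes> x \<in> \<Inter>W}"
      by (auto simp: associated_primes_def)
    interpret Q: primeideal Q R by (rule Q)
    let ?V = "{p \<in> W. x \<notin> p}"
    have QV: "Q \<subseteq> p" if "p \<in> ?V" for p
    proof
      fix r assume "r \<in> Q"
      then have "r \<in> carrier R" "r \<otimes> x \<in> p" using Q(3) that by blast+
      then show "r \<in> p" using primeideal.I_prime[OF pr[of p]] Q(2) that by blast
    qed
    obtain p where "p \<in> ?V" "p \<subseteq> Q"
    proof (rule ccontr)
      assume no: "\<not> thesis"
      have "\<exists>y\<in>carrier R. y \<notin> Q \<and> (\<forall>p\<in>?V. y \<in> p)"
        by (rule Q.exists_outside_prime_in_ideals) (use fin id no that in auto)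
      then obtain y where y: "y \<in> carrier R" "y \<notin> Q" "\<forall>p\<in>?V. y \<in> p" by blast
      have "y \<otimes> x \<in> p" if p: "p \<in> W" for p
      proof (cases "x \<in> p")
        case True then show ?thesis using ideal.I_l_closed[OF id[OF p] _ y(1)] by blast
      next
        case False
        then have "y \<in> p" using y(3) p by blast
        then show ?thesis using ideal.I_r_closed[OF id[OF p] _ Q(2)] by blast
      qed
      then show False using y Q(3) by blast
    qed
    moreover have "Q \<subseteq> p" using QV[OF \<open>p \<in> ?V\<close>] .
    ultimately show "Q \<in> W" by simp
  qed
  show "W \<subseteq> associated_primes R (\<Inter>W)"
  proof
    fix p assume p: "p \<in> W"
    interpret p: primeideal p R by (rule pr[OF p])
    have nle: "\<not> J \<subseteq> p" if "J \<in> W - {p}" for J using that inc p by blast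
    have "\<exists>x\<in>carrier R. x \<notin> p \<and> (\<forall>J\<in>W - {p}. x \<in> J)"
      by (rule p.exists_outside_prime_in_ideals) (use fin id nle in auto)
    then obtain x where x: "x \<in> carrier R" "x \<notin> p" "\<forall>J\<in>W - {p}. x \<in> J" by blast
    have "p = {r \<in> carrier R. r \<otimes> x \<in> \<Inter>W}"
    proof
      show "{r \<in> carrier R. r \<otimes> x \<in> \<Inter>W} \<subseteq> p" using p x p.I_prime by blast
      show "p \<subseteq> {r \<in> carrier R. r \<otimes> x \<in> \<Inter>W}"
      proof
        fix r assume r: "r \<in> p"
        have "r \<otimes> x \<in> J" if J: "J \<in> W" for J
        proof (cases "J = p")
          case True then show ?thesis using p.I_r_closed[OF r x(1)] by simp
        next
          case False
          then have "x \<in> J" using x(3) J by blast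
          then show ?thesis using ideal.I_l_closed[OF id[OF J] _ p.Icarr[OF r]] by blast
        qed
        then show "r \<in> {r \<in> carrier R. r \<otimes> x \<in> \<Inter>W}" using p.Icarr[OF r] by blast
      qed
    qed
    then show "p \<in> associated_primes R (\<Inter>W)" unfolding associated_primes_def using pr[OF p] x(1) by blast
  qed
qed

lemma (in cring) ideal_power_simps:
  assumes "ideal I R"
  shows "I [^]\<^bsub>ideals_set R\<^esub> (0::nat) = carrier R" "I [^]\<^bsub>ideals_set R\<^esub> (1::nat) = I"
    "I [^]\<^bsub>ideals_set R\<^esub> (i + j :: nat) = (I [^]\<^bsub>ideals_set R\<^esub> i) \<cdot> (I [^]\<^bsub>ideals_set R\<^esub> j)"
proof -
  interpret M: comm_monoid "ideals_set R" by (rule ideals_set_is_comm_monoid)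
  have I: "I \<in> carrier (ideals_set R)" using assms by (simp add: ideals_set_def)
  show "I [^]\<^bsub>ideals_set R\<^esub> (0::nat) = carrier R" by (simp add: ideals_set_def)
  show "I [^]\<^bsub>ideals_set R\<^esub> (1::nat) = I" by (rule M.nat_pow_eone[OF I])
  show "I [^]\<^bsub>ideals_set R\<^esub> (i + j :: nat) = (I [^]\<^bsub>ideals_set R\<^esub> i) \<cdot> (I [^]\<^bsub>ideals_set R\<^esub> j)"
    using M.nat_pow_mult[OF I, of i j] by (simp add: ideals_set_def)
qed

text \<open>Distinct primes of a common finite height are incomparable, so the primes of the main theorem form such a set.\<close>

locale incomparable_primes = cring R for R (structure) +
  fixes W :: "'a set set" and I
  assumes fin: "finite W" and ne: "W \<noteq> {}"
    and prime: "\<And>p. p \<in> W \<Longrightarrow> primeideal p R"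
    and incomparable: "\<And>p p'. p \<in> W \<Longrightarrow> p' \<in> W \<Longrightarrow> p \<subseteq> p' \<Longrightarrow> p = p'"
    and I_def: "I = \<Inter>W"
begin

lemma ideal_W: "p \<in> W \<Longrightarrow> ideal p R"
  using prime primeideal.axioms(1) by blast

lemma ideal_I: "ideal I R"
  unfolding I_def using ideal_W ne by (intro i_Intersect) auto

abbreviation "F \<equiv> symbolic_power R I"

sublocale F: filtration R F
  by (rule filtration_symbolic[OF ideal_I])

definition pow :: "nat \<Rightarrow> 'a set" where "pow n = I [^]\<^bsub>ideals_set R\<^esub> n"

lemmas ideal_pow = ideal_power[OF ideal_I, folded pow_def]
lemmas pow_simps = ideal_power_simps[OF ideal_I, folded pow_def]

text \<open>At \<open>n = 0\<close> the right-hand side is all of \<open>R\<close> as well, in agreement with the convention for the symbolic power.\<close>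

lemma symbolic_power_eq: "F n = {x \<in> carrier R. \<forall>p\<in>W. x \<in> saturation R p (pow n)}"
proof (cases "n = 0")
  case True
  have "x \<in> saturation R p (pow 0)" if "p \<in> W" "x \<in> carrier R" for x p
    using ideal_saturation(2)[OF prime[OF that(1)] ideal_pow[of 0]] that(2) pow_simps(1) by auto
  then show ?thesis using True by (auto simp: symbolic_power_def)
next
  case False
  then show ?thesis
    using associated_primes_Inter[OF fin prime incomparable ne, folded I_def] contract_extend_at[OF prime ideal_pow]
    by (simp add: symbolic_power_def pow_def)
qed

text \<open>Locally at \<open>p\<close> the other members of \<open>W\<close> become the unit ideal.\<close>

lemma saturation_I:
  assumes p: "p \<in> W" shows "saturation R p I = p"
proof
  interpret p: primeideal p R by (rule prime[OF p])
  have "saturation R p I \<subseteq> saturation R p p" using p by (intro saturation_mono) (auto simp: I_def)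
  then show "saturation R p I \<subseteq> p" using p.saturation_prime by blast
  have "\<not> J \<subseteq> p" if "J \<in> W - {p}" for J using that incomparable p by blast
  then obtain x where x: "x \<in> carrier R" "x \<notin> p" "\<forall>J\<in>W - {p}. x \<in> J"
    using p.exists_outside_prime_in_ideals[of "W - {p}"] fin ideal_W by auto
  show "p \<subseteq> saturation R p I"
  proof
    fix r assume r: "r \<in> p"
    have "x \<otimes> r \<in> J" if "J \<in> W" for J
      using that r x p.I_l_closed[OF r x(1)] p.Icarr[OF r] ideal.I_r_closed[OF ideal_W[OF that]] by (cases "J = p") auto
    then have "x \<otimes> r \<in> I" by (simp add: I_def)
    then show "r \<in> saturation R p I" using x p.Icarr[OF r] unfolding saturation_def by blast
  qed
qed

lemma F_1: "F 1 = I"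
proof -
  have "F 1 = {x \<in> carrier R. \<forall>p\<in>W. x \<in> p}"
    unfolding symbolic_power_eq pow_simps(2) using saturation_I by blast
  also have "\<dots> = I" using ne ideal.Icarr[OF ideal_W] by (auto simp: I_def)
  finally show ?thesis .
qed

lemma saturation_pow_mult:
  assumes p: "p \<in> W" and x: "x \<in> saturation R p (pow i)" and y: "y \<in> saturation R p (pow j)"
  shows "x \<otimes> y \<in> saturation R p (pow (i + j))"
proof -
  interpret p: primeideal p R by (rule prime[OF p])
  obtain s t where st: "x \<in> carrier R" "s \<in> carrier R - p" "s \<otimes> x \<in> pow i" "y \<in> carrier R" "t \<in> carrier R - p" "t \<otimes> y \<in> pow j"
    using x y unfolding saturation_def by blast
  have "(s \<otimes> t) \<otimes> (x \<otimes> y) = (s \<otimes> x) \<otimes> (t \<otimes> y)" using st by (auto simp: m_ac)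
  moreover have "(s \<otimes> x) \<otimes> (t \<otimes> y) \<in> pow (i + j)"
    unfolding pow_simps(3) using st by (intro ideal_prod.prod)
  ultimately have "(s \<otimes> t) \<otimes> (x \<otimes> y) \<in> pow (i + j)" by simp
  then show ?thesis using p.mult_notin[OF st(2,5)] m_closed[OF st(1,4)] unfolding saturation_def by blast
qed

lemma prime_contains_member:
  assumes Q: "primeideal Q R" "I \<subseteq> Q" obtains p where "p \<in> W" "p \<subseteq> Q"
proof (rule ccontr)
  assume "\<not> thesis"
  then have "\<And>J. J \<in> W \<Longrightarrow> \<not> J \<subseteq> Q" using that by blast
  from primeideal.exists_outside_prime_in_ideals[OF Q(1) fin ideal_W this]
  show False using Q(2) by (auto simp: I_def)
qed

section \<open>Upper bounds for chains in the fiber\<close>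

text \<open>
  For \<open>p \<in> W\<close> let \<open>J p\<close> consist of the \<open>\<Sum> f\<^sub>n X\<^sup>n\<close> in the Rees ring for which \<open>f\<^sub>n\<close> lies in the saturation of \<open>I\<^sup>n\<^sup>+\<^sup>1\<close> at
  \<open>p\<close>. The proof first shows that \<open>D0\<close> contains one of these ideals. No \<open>a s\<close> with \<open>a \<notin> D0\<close>, \<open>s \<in> R - p\<close>
  belongs to \<open>J p\<close>, since \<open>J p\<close> is saturated at \<open>p\<close>. Therefore some prime \<open>p' \<supseteq> J p\<close>
  contains no such product; it lies in \<open>D0\<close>, and its contraction to \<open>R\<close> lies in \<open>p\<close>. The contraction contains \<open>p\<close>, because
  the constants in \<open>J p\<close> are the elements of \<open>p\<close>.
\<close>

lemma prime_below:
  assumes D0: "primeideal D0 (rees_ring R F)"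
    and con: "{a \<in> carrier R. monom (UP R) a 0 \<in> D0} = Q" and IQ: "I \<subseteq> Q"
  obtains p p' where "p \<in> W" "primeideal p' (rees_ring R F)" "p' \<subseteq> D0"
    "{a \<in> carrier R. monom (UP R) a 0 \<in> p'} = p"
proof -
  let ?A = "rees_ring R F"
  interpret A: cring ?A by (rule F.cring_rees)
  interpret D0: primeideal D0 ?A by (rule D0)
  interpret U: UP_cring R "UP R" by unfold_locales
  have monA: "monom (UP R) a k \<in> carrier ?A" if "a \<in> F k" for a k
    using F.rees_subring(2)[OF that] by (simp add: rees_simps)
  have monA0: "monom (UP R) a 0 \<in> carrier ?A" if "a \<in> carrier R" for a
    using monA[of a 0] that F.zeroth by simp
  have co: "coeff (UP R) a n \<in> F n" "a \<in> carrier (UP R)" if "a \<in> carrier ?A" for a n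
    using that by (auto simp: rees_simps)
  define J where "J p = {a \<in> carrier ?A. \<forall>n. coeff (UP R) a n \<in> saturation R p (pow (Suc n))}" for p
  have satid: "ideal (saturation R p (pow n)) R" if "p \<in> W" for p n
    by (rule ideal_saturation(1)[OF prime[OF that] ideal_pow])
  have Jid: "ideal (J p) ?A" if p: "p \<in> W" for p
  proof (rule A.ideal_of_closure)
    interpret s: ideal "saturation R p (pow n)" R for n by (rule satid[OF p])
    show "J p \<subseteq> carrier ?A" by (auto simp: J_def)
    show "\<zero>\<^bsub>?A\<^esub> \<in> J p" unfolding J_def using A.zero_closed by (simp add: rees_simps)
    fix a b assume a: "a \<in> J p"
    {
      assume b: "b \<in> J p"
      then have c: "a \<oplus>\<^bsub>?A\<^esub> b \<in> carrier ?A" "a \<in> carrier (UP R)" "b \<in> carrier (UP R)"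
        using a co(2) by (auto simp: J_def)
      have "coeff (UP R) (a \<oplus>\<^bsub>?A\<^esub> b) n \<in> saturation R p (pow (Suc n))" for n
        using a b s.a_closed c(2,3) by (simp add: J_def rees_simps(3))
      then show "a \<oplus>\<^bsub>?A\<^esub> b \<in> J p" using c(1) by (simp add: J_def)
    }
  next
    interpret s: ideal "saturation R p (pow n)" R for n by (rule satid[OF p])
    fix b a assume b: "b \<in> carrier ?A" and a: "a \<in> J p"
    have ac: "a \<in> carrier ?A" "a \<in> carrier (UP R)" "b \<in> carrier (UP R)" using a b co by (auto simp: J_def)
    have "coeff (UP R) (a \<otimes>\<^bsub>UP R\<^esub> b) n \<in> saturation R p (pow (Suc n))" for n
    proof -
      have "coeff (UP R) a i \<otimes> coeff (UP R) b (n - i) \<in> saturation R p (pow (Suc n))" if "i \<in> {..n}" for i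
      proof -
        have "coeff (UP R) a i \<in> saturation R p (pow (Suc i))" using a by (simp add: J_def)
        moreover have "coeff (UP R) b (n - i) \<in> saturation R p (pow (n - i))"
          using co(1)[OF b, of "n - i"] p by (simp add: symbolic_power_eq)
        ultimately have "coeff (UP R) a i \<otimes> coeff (UP R) b (n - i) \<in> saturation R p (pow (Suc i + (n - i)))"
          by (rule saturation_pow_mult[OF p])
        then show ?thesis using that by simp
      qed
      then have "(\<Oplus>i\<in>{..n}. coeff (UP R) a i \<otimes> coeff (UP R) b (n - i)) \<in> saturation R p (pow (Suc n))"
        by (intro finsum_mem[OF s.a_subset s.zero_closed s.a_closed])
      then show ?thesis using ac by simp
    qed
    then have "a \<otimes>\<^bsub>?A\<^esub> b \<in> J p" using A.m_closed[OF ac(1) b] by (simp add: J_def rees_simps(2))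
    then show "b \<otimes>\<^bsub>?A\<^esub> a \<in> J p" using A.m_comm[OF ac(1) b] by simp
  qed
  have "\<exists>p\<in>W. J p \<subseteq> D0"
  proof (rule ccontr)
    assume neg: "\<not> (\<exists>p\<in>W. J p \<subseteq> D0)"
    have "\<exists>x\<in>carrier ?A. x \<notin> D0 \<and> (\<forall>K\<in>J ` W. x \<in> K)"
      using neg Jid by (intro D0.exists_outside_prime_in_ideals finite_imageI fin) auto
    then obtain b where b: "b \<in> carrier ?A" "b \<notin> D0" "\<forall>p\<in>W. b \<in> J p" by blast
    have bc: "b \<in> carrier (UP R)" using co b by blast
    have mon: "monom (UP R) (coeff (UP R) b n) n \<in> D0" for n
    proof -
      let ?f = "coeff (UP R) b n"
      have fFn: "?f \<in> F n" by (rule co(1)[OF b(1)])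
      have fc: "?f \<in> carrier R" using bc by simp
      have "?f \<in> saturation R p (pow (Suc n))" if "p \<in> W" for p using b(3) that unfolding J_def by blast
      then have fF: "?f \<in> F (Suc n)" unfolding symbolic_power_eq using fc by blast
      have "F (Suc n) \<subseteq> F 1" using lift_Suc_antimono_le[of F, OF F.descending, of 1 "Suc n"] by simp
      then have "?f \<in> Q" using fF F_1 IQ by blast
      then have f0: "monom (UP R) ?f 0 \<in> D0" using con by blast
      \<comment> \<open>Both sides are \<open>f\<^sup>n\<^sup>+\<^sup>1\<close> in degree \<open>n (n + 1)\<close>; on the right, \<open>f \<in> Q\<close> is a factor of degree zero.\<close>
      have "monom (UP R) ?f n [^]\<^bsub>?A\<^esub> Suc n = monom (UP R) ?f 0 \<otimes>\<^bsub>?A\<^esub> monom (UP R) ?f (Suc n) [^]\<^bsub>?A\<^esub> n"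
      proof -
        have pw: "x [^]\<^bsub>?A\<^esub> k = x [^]\<^bsub>UP R\<^esub> k" for x and k :: nat
          by (induction k) (simp_all add: rees_simps)
        show ?thesis unfolding pw rees_simps(2)
          using U.monom_pow[OF fc, of n "Suc n"] U.monom_pow[OF fc, of "Suc n" n]
            U.monom_mult[OF fc nat_pow_closed[OF fc, of n], of 0 "Suc n * n"] nat_pow_Suc2[OF fc, of n]
          by (simp only: mult.commute[of n "Suc n"] add_0)
      qed
      moreover have "monom (UP R) ?f 0 \<otimes>\<^bsub>?A\<^esub> monom (UP R) ?f (Suc n) [^]\<^bsub>?A\<^esub> n \<in> D0"
        using f0 monA[OF fF] by (intro D0.I_r_closed) auto
      ultimately have "monom (UP R) ?f n [^]\<^bsub>?A\<^esub> Suc n \<in> D0" by simp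
      then show ?thesis using D0.pow_notin[OF monA[OF fFn]] by blast
    qed
    let ?H = "D0 \<inter> carrier (UP R)"
    have "b \<in> D0 \<inter> carrier (UP R)"
    proof (rule U.poly_mem[OF bc])
      show "\<zero>\<^bsub>UP R\<^esub> \<in> ?H" using additive_subgroup.zero_closed[OF D0.additive_subgroup_axioms] by (simp add: rees_simps)
      show "x \<oplus>\<^bsub>UP R\<^esub> y \<in> ?H" if "x \<in> ?H" "y \<in> ?H" for x y
        using that additive_subgroup.a_closed[OF D0.additive_subgroup_axioms, of x y] by (simp add: rees_simps)
      show "monom (UP R) (coeff (UP R) b i) i \<in> ?H" for i using mon bc by simp
    qed auto
    then show False using b by blast
  qed
  then obtain p where p: "p \<in> W" "J p \<subseteq> D0" by blast
  interpret p: primeideal p R by (rule prime[OF p(1)])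
  let ?S = "{a \<otimes>\<^bsub>?A\<^esub> monom (UP R) s 0 | a s. a \<in> carrier ?A - D0 \<and> s \<in> carrier R - p}"
  obtain p' where p': "primeideal p' ?A" "J p \<subseteq> p'" "p' \<inter> ?S = {}"
  proof (rule A.exists_prime_avoiding[OF Jid[OF p(1)], of ?S])
    have "\<one>\<^bsub>?A\<^esub> = \<one>\<^bsub>?A\<^esub> \<otimes>\<^bsub>?A\<^esub> monom (UP R) \<one> 0" using A.l_one[OF A.one_closed] by (simp add: rees_simps(4))
    moreover have "\<one>\<^bsub>?A\<^esub> \<in> carrier ?A - D0" "\<one> \<in> carrier R - p" using D0.one_notin p.one_notin by auto
    ultimately show "\<one>\<^bsub>?A\<^esub> \<in> ?S" by blast
    show "?S \<subseteq> carrier ?A" using monA0 by auto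
    fix x y assume "x \<in> ?S" "y \<in> ?S"
    then obtain a s b t where *: "a \<in> carrier ?A - D0" "s \<in> carrier R - p" "x = a \<otimes>\<^bsub>?A\<^esub> monom (UP R) s 0"
      "b \<in> carrier ?A - D0" "t \<in> carrier R - p" "y = b \<otimes>\<^bsub>?A\<^esub> monom (UP R) t 0" by blast
    have st: "monom (UP R) (s \<otimes> t) 0 = monom (UP R) s 0 \<otimes>\<^bsub>?A\<^esub> monom (UP R) t 0"
      using * by (simp add: rees_simps(2) flip: U.monom_mult)
    have "x \<otimes>\<^bsub>?A\<^esub> y = (a \<otimes>\<^bsub>?A\<^esub> b) \<otimes>\<^bsub>?A\<^esub> monom (UP R) (s \<otimes> t) 0"
      unfolding st *(3,6) using *(1,2,4,5) monA0[of s] monA0[of t] by (simp add: A.m_ac)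
    moreover have "a \<otimes>\<^bsub>?A\<^esub> b \<in> carrier ?A - D0" "s \<otimes> t \<in> carrier R - p" using D0.mult_notin p.mult_notin * by blast+
    ultimately show "x \<otimes>\<^bsub>?A\<^esub> y \<in> ?S" by blast
  next
    show "J p \<inter> ?S = {}"
    proof (rule ccontr)
      assume "J p \<inter> ?S \<noteq> {}"
      then obtain a s where as: "a \<in> carrier ?A - D0" "s \<in> carrier R - p" "a \<otimes>\<^bsub>?A\<^esub> monom (UP R) s 0 \<in> J p" by blast
      have ac: "a \<in> carrier (UP R)" using co as by blast
      have "coeff (UP R) a n \<in> saturation R p (pow (Suc n))" for n
      proof -
        have "a \<otimes>\<^bsub>UP R\<^esub> monom (UP R) s 0 = s \<odot>\<^bsub>UP R\<^esub> a"
          using ac as U.P.m_comm[of a "monom (UP R) s 0"] by (simp add: U.monom_mult_is_smult)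
        then have "coeff (UP R) (a \<otimes>\<^bsub>?A\<^esub> monom (UP R) s 0) n = s \<otimes> coeff (UP R) a n"
          using ac as by (simp add: rees_simps(2))
        moreover have "coeff (UP R) (a \<otimes>\<^bsub>?A\<^esub> monom (UP R) s 0) n \<in> saturation R p (pow (Suc n))"
          using as(3) unfolding J_def by blast
        ultimately have "s \<otimes> coeff (UP R) a n \<in> saturation R p (pow (Suc n))" by metis
        then show ?thesis using saturation_idem[OF prime[OF p(1)] as(2)] U.coeff_closed[OF ac] by blast
      qed
      then have "a \<in> J p" using as by (simp add: J_def)
      then show False using as p(2) by blast
    qed
  qed blast
  interpret p': primeideal p' ?A by (rule p')
  have pD: "p' \<subseteq> D0"
  proof
    fix a assume a: "a \<in> p'"
    show "a \<in> D0"
    proof (rule ccontr)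
      assume "a \<notin> D0"
      have "a \<otimes>\<^bsub>?A\<^esub> monom (UP R) \<one> 0 = a" using A.r_one[OF p'.Icarr[OF a]] by (simp add: rees_simps(4))
      moreover have "a \<in> carrier ?A - D0" "\<one> \<in> carrier R - p" using \<open>a \<notin> D0\<close> p'.Icarr[OF a] p.one_notin by auto
      ultimately have "a \<in> ?S" by (metis (mono_tags, lifting) mem_Collect_eq)
      then show False using p'(3) a by blast
    qed
  qed
  have "{a \<in> carrier R. monom (UP R) a 0 \<in> p'} = p"
  proof
    show "{a \<in> carrier R. monom (UP R) a 0 \<in> p'} \<subseteq> p"
    proof (rule ccontr)
      assume "\<not> {a \<in> carrier R. monom (UP R) a 0 \<in> p'} \<subseteq> p"
      then obtain s where s: "s \<in> carrier R - p" "monom (UP R) s 0 \<in> p'" by blast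
      have "\<one>\<^bsub>?A\<^esub> \<otimes>\<^bsub>?A\<^esub> monom (UP R) s 0 \<in> ?S" using s D0.one_notin A.one_closed by blast
      then show False using p'(3) s p'.Icarr[OF s(2)] by auto
    qed
    show "p \<subseteq> {a \<in> carrier R. monom (UP R) a 0 \<in> p'}"
    proof
      fix a assume a: "a \<in> p"
      have s: "a \<in> saturation R p (pow (Suc 0))" using a saturation_I[OF p(1)] pow_simps(2) by simp
      interpret s: ideal "saturation R p (pow n)" R for n by (rule satid[OF p(1)])
      have "monom (UP R) a 0 \<in> J p" unfolding J_def using s monA0 p.Icarr[OF a] by auto
      then show "a \<in> {a \<in> carrier R. monom (UP R) a 0 \<in> p'}" using p'(2) p.Icarr[OF a] by blast
    qed
  qed
  then show ?thesis using that p(1) p'(1) pD by blast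
qed

end

lemma (in filtration) rees_pchain:
  assumes dom: "domain R" and Noeth: "noetherian_ring R" and f: "f \<in> F 1" "f \<noteq> \<zero>"
    and C: "pchain (rees_ring R F) (Suc n) D D'"
  shows "\<exists>c. pchain R n c {a \<in> carrier R. monom (UP R) a 0 \<in> D'}"
proof -
  interpret domain R by (rule dom)
  interpret U: UP_domain R "UP R" by unfold_locales
  show ?thesis
  proof (rule U.graded_subring_pchain[OF Noeth _ f(2) rees_subring(1)])
    show "f \<in> carrier R" using f(1) ideal.Icarr[OF ideals] by blast
    show "a \<in> carrier R \<Longrightarrow> monom (UP R) a 0 \<in> {p \<in> carrier (UP R). \<forall>n. coeff (UP R) p n \<in> F n}" for a
      using rees_subring(2)[of a 0] zeroth by simp
    show "monom (UP R) f 1 \<in> {p \<in> carrier (UP R). \<forall>n. coeff (UP R) p n \<in> F n}"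
      by (rule rees_subring(2)[OF f(1)])
    show "monom (UP R) (coeff (UP R) p i) i \<in> {p \<in> carrier (UP R). \<forall>n. coeff (UP R) p n \<in> F n}"
      if "p \<in> {p \<in> carrier (UP R). \<forall>n. coeff (UP R) p n \<in> F n}" for p i
      using that by (intro rees_subring(2)) blast
    show "pchain (UP R\<lparr>carrier := {p \<in> carrier (UP R). \<forall>n. coeff (UP R) p n \<in> F n}\<rparr>) (Suc n) D D'"
      using C by (simp add: rees_ring_def)
  qed
qed

text \<open>In this degenerate case the Rees ring consists of constants, so a prime is determined by its contraction.\<close>

lemma (in filtration) rees_chain_trivial:
  assumes F1: "F 1 \<subseteq> {\<zero>}" and D: "prime_chain (rees_ring R F) n D"
    and con: "\<And>i. i \<le> n \<Longrightarrow> {a \<in> carrier R. monom (UP R) a 0 \<in> D i} = Q"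
  shows "n = 0"
proof (rule ccontr)
  assume n: "n \<noteq> 0"
  interpret U: UP_cring R "UP R" by unfold_locales
  have sub: "D 0 \<subset> D 1" using D n by (auto simp: prime_chain_def)
  interpret D1: primeideal "D 1" "rees_ring R F" using D n by (auto simp: prime_chain_def)
  obtain x where x: "x \<in> D 1" "x \<notin> D 0" using sub by blast
  have xc: "x \<in> carrier (UP R)" "\<And>k. coeff (UP R) x k \<in> F k" using D1.Icarr[OF x(1)] by (auto simp: rees_simps)
  have z: "coeff (UP R) x k = \<zero>" if "k \<ge> 1" for k
    using lift_Suc_antimono_le[of F, OF descending that] xc(2)[of k] F1 by blast
  have "x = monom (UP R) (coeff (UP R) x 0) 0"
    using xc z by (intro U.up_eqI) auto
  moreover have "coeff (UP R) x 0 \<in> carrier R" using xc by simp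
  ultimately show False using x con[of 0] con[of 1] n
    by (metis (mono_tags, lifting) One_nat_def bot_nat_0.extremum less_one linorder_not_less mem_Collect_eq)
qed

context incomparable_primes
begin

text \<open>
  Below the contracted chain there is the zero ideal and, if \<open>Q \<notin> W\<close>, the prime of \<open>prime_below\<close> as well. These
  inclusions are strict since a nonzero \<open>f \<in> I\<close> lies in both primes above the zero ideal, and since the prime from
  \<open>prime_below\<close> lies over a member of \<open>W\<close>. The dimension bound costs one step.
\<close>

theorem fiber_chain_bound:
  assumes dom: "domain R" and Noeth: "noetherian_ring R" and Q: "primeideal Q R" "I \<subseteq> Q"
    and C: "prime_chain (rees_ring (localization_at R Q) (localize_filtration R F Q)) n C"
      "(\<lambda>a. monom (UP (localization_at R Q)) a 0) ` max_ideal (localization_at R Q) \<subseteq> C 0"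
  shows "\<exists>c. pchain R n c Q" and "Q \<notin> W \<Longrightarrow> \<exists>c. pchain R (Suc n) c Q"
proof -
  let ?A = "rees_ring R F"
  interpret domain R by (rule dom)
  interpret U: UP_domain R "UP R" by unfold_locales
  interpret A: domain ?A unfolding rees_ring_def
    by (rule domain.subring_is_domain[OF U.UP_domain F.rees_subring(1)])
  obtain D where D: "prime_chain ?A n D" "\<And>i. i \<le> n \<Longrightarrow> {a \<in> carrier R. monom (UP R) a 0 \<in> D i} = Q"
    using F.rees_chain_contract[OF Q(1) C] by blast
  have Dch: "pchain ?A n (D 0) (D n)" using D(1) by (auto simp: pchain_def)
  have D0: "primeideal (D 0) ?A" using pchain_prime[OF Dch] by simp
  have "(\<exists>c. pchain R n c Q) \<and> (Q \<notin> W \<longrightarrow> (\<exists>c. pchain R (Suc n) c Q))"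
  proof (cases "I \<subseteq> {\<zero>}")
    case True
    then have n: "n = 0" using F.rees_chain_trivial[OF _ D] F_1 by simp
    obtain p where p: "p \<in> W" "p \<subseteq> Q" using prime_contains_member[OF Q] by blast
    have "pchain R 0 Q Q" using Q by (simp add: pchain_0)
    moreover have "pchain R (Suc 0) p Q" if "Q \<notin> W"
      using p that prime \<open>pchain R 0 Q Q\<close> by (intro pchain_Cons) auto
    ultimately show ?thesis using n by blast
  next
    case False
    then obtain f where f: "f \<in> I" "f \<noteq> \<zero>" by blast
    then have f1: "f \<in> F 1" by (simp only: F_1)
    have fc: "f \<in> carrier R" using f ideal.Icarr[OF ideal_I] by blast
    have mnz: "monom (UP R) f 0 \<noteq> \<zero>\<^bsub>UP R\<^esub>" using f fc by (metis U.coeff_monom U.coeff_zero)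
    have below: "{\<zero>\<^bsub>?A\<^esub>} \<subset> p'" if p': "primeideal p' ?A" "monom (UP R) f 0 \<in> p'" for p'
    proof -
      have "\<zero>\<^bsub>?A\<^esub> \<in> p'" using additive_subgroup.zero_closed[OF ideal.axioms(1)[OF primeideal.axioms(1)[OF p'(1)]]] .
      then show ?thesis using p'(2) mnz by (auto simp: rees_simps)
    qed
    have "monom (UP R) f 0 \<in> D 0" using D(2)[of 0] f Q fc by blast
    then have "pchain ?A (Suc n) {\<zero>\<^bsub>?A\<^esub>} (D n)" using pchain_Cons[OF A.zeroprimeideal below[OF D0] Dch] by blast
    from F.rees_pchain[OF dom Noeth f1 f(2) this] have 1: "\<exists>c. pchain R n c Q" using D(2)[of n] by simp
    have 2: "\<exists>c. pchain R (Suc n) c Q" if QW: "Q \<notin> W"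
    proof -
      obtain p p' where p: "p \<in> W" "primeideal p' ?A" "p' \<subseteq> D 0" "{a \<in> carrier R. monom (UP R) a 0 \<in> p'} = p"
        using prime_below[OF D0 D(2) Q(2)] by blast
      have "p' \<noteq> D 0" using p D(2)[of 0] QW by auto
      then have "pchain ?A (Suc n) p' (D n)" using p Dch by (intro pchain_Cons) auto
      moreover have "monom (UP R) f 0 \<in> p'" using p f I_def fc by blast
      ultimately have "pchain ?A (Suc (Suc n)) {\<zero>\<^bsub>?A\<^esub>} (D n)"
        using pchain_Cons[OF A.zeroprimeideal below[OF p(2)]] by blast
      from F.rees_pchain[OF dom Noeth f1 f(2) this] show ?thesis using D(2)[of n] by simp
    qed
    show ?thesis using 1 2 by blast
  qed
  then show "\<exists>c. pchain R n c Q" and "Q \<notin> W \<Longrightarrow> \<exists>c. pchain R (Suc n) c Q" by blast+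
qed

end

section \<open>Chains in the fiber of the Rees ring of a maximal ideal\<close>

lemma (in UP_cring) const_coeff_hom: "(\<lambda>p. coeff P p 0) \<in> ring_hom P R"
  by (rule ring_hom_memI) auto

lemma (in UP_cring) mult_set_powers: "mult_set P {monom P \<one> k | k. True}"
proof -
  have "monom P \<one> k \<otimes>\<^bsub>P\<^esub> monom P \<one> l = monom P \<one> (k + l)" for k l by (simp flip: monom_mult)
  then have "\<And>s t. s \<in> {monom P \<one> k | k. True} \<Longrightarrow> t \<in> {monom P \<one> k | k. True} \<Longrightarrow> s \<otimes>\<^bsub>P\<^esub> t \<in> {monom P \<one> k | k. True}"
    by blast
  moreover have "\<one>\<^bsub>P\<^esub> \<in> {monom P \<one> k | k. True}" using monom_one by (metis (mono_tags, lifting) mem_Collect_eq)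
  moreover have "{monom P \<one> k | k. True} \<subseteq> carrier P" by auto
  ultimately show ?thesis
    by (intro mult_set.intro mult_set_axioms.intro P.cring_axioms)
qed

lemma (in cring) minus_minus_cancel:
  "x \<in> carrier R \<Longrightarrow> y \<in> carrier R \<Longrightarrow> x \<ominus> (x \<ominus> y) = y"
  by algebra

lemma (in UP_cring) coeff_mult_power:
  assumes "p \<in> carrier P"
  shows "coeff P (p \<otimes>\<^bsub>P\<^esub> monom P \<one> k) n = (if k \<le> n then coeff P p (n - k) else \<zero>)"
proof (cases "k \<le> n")
  case True
  then show ?thesis using coeff_monom_mult[of \<one> p k "n - k"] assms P.m_comm[of p "monom P \<one> k"] by simp
next
  case False
  then have "(\<Oplus>i\<in>{..n}. coeff P p i \<otimes> coeff P (monom P \<one> k) (n - i)) = (\<Oplus>i\<in>{..n}. \<zero>)"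
    using assms by (intro R.finsum_cong') auto
  then show ?thesis using False assms by simp
qed

text \<open>The right summand of \<open>R[X] = R + X R[X]\<close>; used for contraction along \<open>R \<rightarrow> R[X]\<close> of primes that contain \<open>X\<close>.\<close>

lemma (in UP_cring) minus_const_mem:
  assumes x: "x \<in> carrier P" and I: "ideal I P" "monom P \<one> 1 \<in> I"
  shows "x \<ominus>\<^bsub>P\<^esub> monom P (coeff P x 0) 0 \<in> I"
proof -
  interpret I: ideal I P by (rule I)
  let ?y = "x \<ominus>\<^bsub>P\<^esub> monom P (coeff P x 0) 0"
  have y: "?y \<in> carrier P" using x by simp
  show ?thesis
  proof (rule poly_mem[OF y I.a_subset I.zero_closed I.a_closed])
    fix i
    show "monom P (coeff P ?y i) i \<in> I"
    proof (cases i)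
      case 0
      then have "coeff P ?y i = \<zero>" using x by (simp add: a_minus_def R.r_neg)
      then show ?thesis by simp
    next
      case (Suc j)
      have "monom P (coeff P ?y i) i = monom P (coeff P ?y i) j \<otimes>\<^bsub>P\<^esub> monom P \<one> 1"
        using coeff_closed[OF y] Suc by (simp flip: monom_mult)
      then show ?thesis using I.I_l_closed[OF I(2)] coeff_closed[OF y] by simp
    qed
  qed
qed

text \<open>Under the assumption on the powers, the Rees ring is generated over \<open>R\<close> by \<open>y X\<close>, where \<open>y\<close> runs over finitely many generators of \<open>F 1\<close>.\<close>

lemma (in filtration) rees_noetherian:
  assumes Noeth: "noetherian_ring R"
    and pow: "\<And>n. F n \<subseteq> F 1 [^]\<^bsub>ideals_set R\<^esub> n"
  shows "noetherian_ring (rees_ring R F)"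
proof -
  interpret N: noetherian_ring R by (rule Noeth)
  interpret U: UP_cring R "UP R" by unfold_locales
  let ?A = "{p \<in> carrier (UP R). \<forall>n. coeff (UP R) p n \<in> F n}"
  have const_mem: "monom (UP R) a 0 \<in> ?A" if "a \<in> carrier R" for a
    using rees_subring(2)[of a 0] that zeroth by simp
  have ex: "\<exists>H\<subseteq>?A. subring H (UP R) \<and> noetherian_ring (UP R\<lparr>carrier := H\<rparr>) \<and>
      (\<forall>a\<in>carrier R. monom (UP R) a 0 \<in> H) \<and> (\<forall>y\<in>Y. monom (UP R) y 1 \<in> H)"
    if "finite Y" "Y \<subseteq> F 1" for Y
    using that
  proof (induction Y rule: finite_induct)
    case empty
    have "(\<lambda>a. monom (UP R) a 0) ` carrier R \<subseteq> ?A" using const_mem by blast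
    then show ?case using U.constants_noetherian(1,2)[OF Noeth]
      by (intro exI[of _ "(\<lambda>a. monom (UP R) a 0) ` carrier R"]) blast
  next
    case (insert y Y)
    then obtain H where H: "H \<subseteq> ?A" "subring H (UP R)" "noetherian_ring (UP R\<lparr>carrier := H\<rparr>)"
      "\<forall>a\<in>carrier R. monom (UP R) a 0 \<in> H" "\<forall>y\<in>Y. monom (UP R) y 1 \<in> H" by auto
    have y: "y \<in> F 1" using insert.prems by blast
    then have yX: "monom (UP R) y 1 \<in> carrier (UP R)" using ideal.Icarr[OF ideals] by (intro U.monom_closed) blast
    let ?H = "poly_values (UP R) H (monom (UP R) y 1)"
    have "?H \<subseteq> ?A" by (rule U.P.poly_values_minimal[OF H(2) yX rees_subring(1) H(1) rees_subring(2)[OF y]])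
    moreover note U.P.poly_values_subring[OF H(2) yX] U.P.poly_values_noetherian[OF H(2) yX H(3)]
      U.P.poly_values_contains[OF H(2) yX]
    ultimately show ?case using H(4,5) by (intro exI[of _ ?H]) blast
  qed
  obtain Y where Y: "Y \<subseteq> carrier R" "finite Y" "F 1 = Idl Y" using N.finetely_gen[OF ideals[of 1]] by blast
  have "Y \<subseteq> F 1" using genideal_self[OF Y(1)] Y(3) by simp
  then obtain H where H: "H \<subseteq> ?A" "subring H (UP R)" "noetherian_ring (UP R\<lparr>carrier := H\<rparr>)"
      "\<forall>a\<in>carrier R. monom (UP R) a 0 \<in> H" "\<forall>y\<in>Y. monom (UP R) y 1 \<in> H" using ex[OF Y(2)] by blast
  let ?K = "\<lambda>n. {y \<in> carrier R. monom (UP R) y n \<in> H}"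
  have K: "ideal (?K n) R" for n
  proof (rule ideal_of_closure)
    show "?K n \<subseteq> carrier R" by blast
    show "\<zero> \<in> ?K n" using subringE(2)[OF H(2)] by simp
    show "a \<oplus> b \<in> ?K n" if "a \<in> ?K n" "b \<in> ?K n" for a b
      using that subringE(7)[OF H(2)] by simp
    show "r \<otimes> y \<in> ?K n" if "r \<in> carrier R" "y \<in> ?K n" for r y
    proof -
      have "monom (UP R) (r \<otimes> y) n = monom (UP R) r 0 \<otimes>\<^bsub>UP R\<^esub> monom (UP R) y n"
        using that by (simp flip: U.monom_mult)
      then show ?thesis using that H(4) subringE(6)[OF H(2)] by auto
    qed
  qed
  have Y1: "F 1 \<subseteq> ?K 1" using genideal_minimal[OF K, of Y 1] Y H(5) by auto
  have powH: "F 1 [^]\<^bsub>ideals_set R\<^esub> n \<subseteq> ?K n" for n :: nat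
  proof (induction n)
    case 0
    then show ?case using H(4) ideal_power_simps(1)[OF ideals] by auto
  next
    case (Suc n)
    have "x \<in> ?K (Suc n)" if "x \<in> (F 1 [^]\<^bsub>ideals_set R\<^esub> n) \<cdot> F 1" for x
      using that
    proof (induction rule: ideal_prod.induct)
      case (prod i j)
      then have ij: "i \<in> ?K n" "j \<in> ?K 1" using Suc Y1 by auto
      then have "monom (UP R) (i \<otimes> j) (Suc n) = monom (UP R) i n \<otimes>\<^bsub>UP R\<^esub> monom (UP R) j 1"
        using U.monom_mult[of i j n 1] by simp
      then show ?case using ij subringE(6)[OF H(2)] by simp
    next
      case (sum s1 s2)
      then show ?case using additive_subgroup.a_closed[OF ideal.axioms(1)[OF K]] by blast
    qed
    moreover have "F 1 [^]\<^bsub>ideals_set R\<^esub> Suc n = (F 1 [^]\<^bsub>ideals_set R\<^esub> n) \<cdot> F 1" by (simp add: ideals_set_def)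
    ultimately show ?case by blast
  qed
  have "?A \<subseteq> H"
  proof
    fix p assume p: "p \<in> ?A"
    show "p \<in> H"
    proof (rule U.poly_mem)
      show "monom (UP R) (coeff (UP R) p i) i \<in> H" for i using p pow powH by blast
    qed (use p subringE[OF H(2)] in auto)
  qed
  then have "H = ?A" using H(1) by blast
  then show ?thesis using H(3) by (simp add: rees_ring_def)
qed

text \<open>
  With \<open>A\<close> the Rees ring, the extended Rees ring is the image of \<open>Psi : A[U] \<rightarrow> Lam = R[X, X\<^sup>-\<^sup>1]\<close>, \<open>U \<mapsto> X\<^sup>-\<^sup>1\<close>, but the proof
  works with primes of \<open>A[U]\<close> itself. A prime \<open>q\<close> of \<open>R\<close> yields \<open>T q\<close>, the preimage of \<open>q Lam\<close>. On top of
  the chain of these primes there is the prime \<open>N\<close> of the polynomials whose constant term with respect to both \<open>X\<close> and \<open>U\<close> lies in \<open>F 1\<close>.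
  It contains \<open>U\<close>, so \<open>pchain_containing\<close> yields a chain whose members contain \<open>U\<close>
  and \<open>T q\<close>. Since \<open>(y X) U - y \<in> T q\<close> for \<open>y \<in> F 1\<close>, these members contain \<open>F 1\<close>, and they contract
  strictly to \<open>A\<close>, as \<open>A[U] = A + U A[U]\<close>.
\<close>

theorem (in filtration) fiber_chain_exists:
  assumes Noeth: "noetherian_ring R" and M: "primeideal (F 1) R"
    and pow: "\<And>n. F n \<subseteq> F 1 [^]\<^bsub>ideals_set R\<^esub> n"
    and C0: "pchain R n q (F 1)"
  shows "\<exists>C. prime_chain (rees_ring R F) n C \<and> (\<lambda>a. monom (UP R) a 0) ` F 1 \<subseteq> C 0"
proof -
  let ?A = "rees_ring R F"
  interpret M: primeideal "F 1" R by (rule M)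
  interpret U: UP_cring R "UP R" by unfold_locales
  interpret A: cring ?A by (rule cring_rees)
  interpret V: UP_cring ?A "UP ?A" by unfold_locales
  define S where "S = {monom (UP R) \<one> k | k. True}"
  have X: "monom (UP R) \<one> k \<in> S" for k by (auto simp: S_def)
  interpret S: mult_set "UP R" S unfolding S_def by (rule U.mult_set_powers)
  define Lam where "Lam = localization (UP R) S"
  interpret Lam: cring Lam unfolding Lam_def by (rule S.cring_localization)
  let ?fr = "fraction (UP R) S"
  let ?X = "\<lambda>k. monom (UP R) \<one> k"
  have XX: "?X k \<otimes>\<^bsub>UP R\<^esub> ?X l = ?X (k + l)" for k l by (simp flip: U.monom_mult)
  have Ac: "a \<in> carrier (UP R)" "coeff (UP R) a n \<in> F n" if "a \<in> carrier ?A" for a n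
    using that by (auto simp: rees_simps)
  have hA: "ring_hom_cring ?A Lam (\<lambda>a. ?fr a \<one>\<^bsub>UP R\<^esub>)"
    using S.fraction_hom unfolding Lam_def[symmetric]
    by (intro ring_hom_cringI A.cring_axioms Lam.cring_axioms) (auto simp: ring_hom_def rees_simps)
  interpret E: UP_pre_univ_prop ?A Lam "\<lambda>a. ?fr a \<one>\<^bsub>UP R\<^esub>" "UP ?A"
    by (intro UP_pre_univ_prop.intro hA V.UP_cring_axioms)
  define s where "s = ?fr \<one>\<^bsub>UP R\<^esub> (?X 1)"
  have sL: "s \<in> carrier Lam" unfolding s_def Lam_def by (intro S.frac_in_carrier X U.UP_one_closed)
  define Psi where "Psi = eval ?A Lam (\<lambda>a. ?fr a \<one>\<^bsub>UP R\<^esub>) s"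
  interpret Psi: ring_hom_cring "UP ?A" Lam Psi
    unfolding Psi_def by (intro ring_hom_cringI V.P.cring_axioms Lam.cring_axioms E.eval_ring_hom sL)
  have spow: "s [^]\<^bsub>Lam\<^esub> i = ?fr \<one>\<^bsub>UP R\<^esub> (?X i)" for i :: nat
  proof (induction i)
    case 0 show ?case by (simp add: Lam_def S.frac_one)
  next
    case (Suc i)
    have "s [^]\<^bsub>Lam\<^esub> Suc i = ?fr \<one>\<^bsub>UP R\<^esub> (?X i) \<otimes>\<^bsub>Lam\<^esub> ?fr \<one>\<^bsub>UP R\<^esub> (?X 1)" using Suc by (simp add: s_def)
    also have "\<dots> = ?fr (\<one>\<^bsub>UP R\<^esub> \<otimes>\<^bsub>UP R\<^esub> \<one>\<^bsub>UP R\<^esub>) (?X i \<otimes>\<^bsub>UP R\<^esub> ?X 1)"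
      unfolding Lam_def by (intro S.frac_mult X U.UP_one_closed)
    finally show ?case by (simp only: XX U.UP_l_one U.UP_one_closed) simp
  qed
  have fr_term: "?fr a \<one>\<^bsub>UP R\<^esub> \<otimes>\<^bsub>Lam\<^esub> s [^]\<^bsub>Lam\<^esub> i = ?fr a (?X i)" if a: "a \<in> carrier ?A" for a and i :: nat
  proof -
    have "?fr a \<one>\<^bsub>UP R\<^esub> \<otimes>\<^bsub>Lam\<^esub> ?fr \<one>\<^bsub>UP R\<^esub> (?X i) = ?fr (a \<otimes>\<^bsub>UP R\<^esub> \<one>\<^bsub>UP R\<^esub>) (\<one>\<^bsub>UP R\<^esub> \<otimes>\<^bsub>UP R\<^esub> ?X i)"
      unfolding Lam_def by (intro S.frac_mult X U.UP_one_closed S.S_one Ac(1)[OF a])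
    then show ?thesis unfolding spow using Ac(1)[OF a] by simp
  qed
  have Psi_monom: "Psi (monom (UP ?A) a i) = ?fr a (?X i)" if "a \<in> carrier ?A" for a i
    unfolding Psi_def using E.eval_monom[OF that sL, of i] fr_term[OF that] by simp
  define qX where "qX q = {f \<in> carrier (UP R). \<forall>n. coeff (UP R) f n \<in> q}" for q
  have qX: "primeideal (qX q) (UP R)" "qX q \<inter> S = {}" if q: "primeideal q R" for q
  proof -
    show "primeideal (qX q) (UP R)" unfolding qX_def by (rule U.primeideal_coeffs[OF q])
    have "?X k \<notin> qX q" for k using primeideal.one_notin[OF q] by (auto simp: qX_def dest: spec[of _ k])
    then show "qX q \<inter> S = {}" by (auto simp: S_def)
  qed
  define T where "T q = {p \<in> carrier (UP ?A). Psi p \<in> S.extension (qX q)}" for q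
  have Tprime: "primeideal (T q) (UP ?A)" if q: "primeideal q R" for q
    unfolding T_def by (rule Psi.primeideal_vimage) (use S.primeideal_extension[OF qX[OF q]] in \<open>simp add: Lam_def\<close>)
  have Tmono: "T q \<subset> T q'" if q: "primeideal q R" "primeideal q' R" "q \<subset> q'" for q q'
  proof -
    have "qX q \<subseteq> qX q'" using q(3) by (auto simp: qX_def)
    then have "T q \<subseteq> T q'" unfolding T_def S.extension_def by blast
    moreover obtain a where a: "a \<in> q'" "a \<notin> q" using q(3) by blast
    have ac: "a \<in> carrier R" by (rule ideal.Icarr[OF primeideal.axioms(1)[OF q(2)] a(1)])
    have aA: "monom (UP R) a 0 \<in> carrier ?A" using rees_subring(2)[of a 0] ac zeroth by (simp add: rees_simps)
    have "monom (UP ?A) (monom (UP R) a 0) 0 \<in> T q'' \<longleftrightarrow> a \<in> q''" if q'': "primeideal q'' R" for q''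
    proof -
      interpret q'': primeideal q'' R by (rule q'')
      have "monom (UP R) a 0 \<in> qX q'' \<longleftrightarrow> a \<in> q''"
        using ac by (auto simp: qX_def dest: spec[of _ 0])
      then show ?thesis unfolding T_def
        using Psi_monom[OF aA, of 0] S.frac_mem_extension[OF qX[OF q''] Ac(1)[OF aA] X[of 0]] V.monom_closed[OF aA] by simp
    qed
    then have "monom (UP ?A) (monom (UP R) a 0) 0 \<in> T q'" "monom (UP ?A) (monom (UP R) a 0) 0 \<notin> T q" using q a by auto
    ultimately show ?thesis by blast
  qed
  have Tchain: "pchain (UP ?A) m (T q) (T q')" if "pchain R m q q'" for m q q'
    using that
  proof (induction m arbitrary: q)
    case 0 then show ?case using Tprime by (simp add: pchain_0)
  next
    case (Suc m)
    obtain q1 where "primeideal q R" "q \<subset> q1" "pchain R m q1 q'" using Suc.prems by (rule pchain_Suc_first)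
    then show ?case using pchain_Cons[OF Tprime Tmono Suc.IH] pchain_prime(1) by blast
  qed
  define N where "N = {p \<in> carrier (UP ?A). coeff (UP ?A) p 0 \<in> {a \<in> carrier ?A. coeff (UP R) a 0 \<in> F 1}}"
  have Nprime: "primeideal N (UP ?A)"
  proof -
    interpret c1: ring_hom_cring ?A R "\<lambda>a. coeff (UP R) a 0"
      using U.const_coeff_hom by (intro ring_hom_cringI A.cring_axioms cring_axioms) (auto simp: ring_hom_def rees_simps)
    interpret c2: ring_hom_cring "UP ?A" ?A "\<lambda>p. coeff (UP ?A) p 0"
      by (intro ring_hom_cringI A.cring_axioms V.P.cring_axioms V.const_coeff_hom)
    show ?thesis unfolding N_def by (intro c2.primeideal_vimage c1.primeideal_vimage M)
  qed
  let ?U = "monom (UP ?A) \<one>\<^bsub>?A\<^esub> 1"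
  have UN: "?U \<in> N" unfolding N_def using A.one_closed additive_subgroup.zero_closed[OF ideal.axioms(1)[OF ideals[of 1]]] A.zero_closed
    by (auto simp: V.coeff_monom[OF A.one_closed] rees_simps(5))
  have UT: "?U \<notin> T (F 1)"
  proof
    assume "?U \<in> T (F 1)"
    then have "?fr \<one>\<^bsub>?A\<^esub> (?X 1) \<in> S.extension (qX (F 1))" unfolding T_def using Psi_monom[OF A.one_closed, of 1] by simp
    then have "\<one>\<^bsub>UP R\<^esub> \<in> qX (F 1)" using S.frac_mem_extension[OF qX[OF M] U.UP_one_closed X[of 1]] by (simp add: rees_simps(4))
    then show False using primeideal.one_notin[OF qX(1)[OF M]] by simp
  qed
  \<comment> \<open>Compare coefficients at \<open>X\<^sup>0\<close> in \<open>Psi p\<close>: the term \<open>a U\<^sup>i\<close> with \<open>i \<ge> 1\<close> contributes the coefficient of \<open>a\<close> at \<open>i\<close>,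
     which belongs to \<open>F i \<subseteq> F 1\<close>. The set \<open>?Z\<close> collects the Laurent polynomials whose coefficients at nonnegative
     exponents belong to \<open>F 1\<close>.\<close>
  have TN: "T (F 1) \<subseteq> N"
  proof
    fix p assume p: "p \<in> T (F 1)"
    then have pc: "p \<in> carrier (UP ?A)" and pE: "Psi p \<in> S.extension (qX (F 1))" by (auto simp: T_def)
    let ?a = "\<lambda>i. coeff (UP ?A) p i"
    have a: "?a i \<in> carrier ?A" for i by (rule V.coeff_closed[OF pc])
    let ?t = "\<lambda>i. ?fr (?a i) (?X i)"
    have tc: "?t i \<in> carrier Lam" for i unfolding Lam_def by (intro S.frac_in_carrier X Ac(1) a)
    let ?Z = "{?fr w (?X k) | w k. w \<in> carrier (UP R) \<and> (\<forall>i\<ge>k. coeff (UP R) w i \<in> F 1)}"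
    have Psi_p: "Psi p = (\<Oplus>\<^bsub>Lam\<^esub>i\<in>{..deg ?A p}. ?t i)"
      unfolding Psi_def V.eval_on_carrier[OF pc]
      by (intro Lam.finsum_cong') (use tc fr_term[OF a] in auto)
    also have "{..deg ?A p} = insert 0 {1..deg ?A p}" by auto
    also have "(\<Oplus>\<^bsub>Lam\<^esub>i\<in>insert 0 {1..deg ?A p}. ?t i) = ?t 0 \<oplus>\<^bsub>Lam\<^esub> (\<Oplus>\<^bsub>Lam\<^esub>i\<in>{1..deg ?A p}. ?t i)"
      by (rule Lam.finsum_insert) (use tc in \<open>auto simp del: U.monom_one\<close>)
    finally have Psi_p: "Psi p = ?t 0 \<oplus>\<^bsub>Lam\<^esub> (\<Oplus>\<^bsub>Lam\<^esub>i\<in>{1..deg ?A p}. ?t i)" .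
    have "(\<Oplus>\<^bsub>Lam\<^esub>i\<in>{1..deg ?A p}. ?t i) \<in> ?Z"
    proof (rule Lam.finsum_mem)
      show "?Z \<subseteq> carrier Lam" unfolding Lam_def using S.frac_in_carrier X by blast
      have "\<zero>\<^bsub>Lam\<^esub> = ?fr \<zero>\<^bsub>UP R\<^esub> (?X 0)" by (simp add: Lam_def S.frac_zero)
      then show "\<zero>\<^bsub>Lam\<^esub> \<in> ?Z"
        using additive_subgroup.zero_closed[OF M.additive_subgroup_axioms]
        by (intro CollectI exI[of _ "\<zero>\<^bsub>UP R\<^esub>"] exI[of _ 0]) auto
    next
      fix x y assume "x \<in> ?Z" "y \<in> ?Z"
      then obtain w k v l where *: "x = ?fr w (?X k)" "w \<in> carrier (UP R)" "\<And>i. i \<ge> k \<Longrightarrow> coeff (UP R) w i \<in> F 1"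
        "y = ?fr v (?X l)" "v \<in> carrier (UP R)" "\<And>i. i \<ge> l \<Longrightarrow> coeff (UP R) v i \<in> F 1" by blast
      let ?w = "w \<otimes>\<^bsub>UP R\<^esub> ?X l \<oplus>\<^bsub>UP R\<^esub> v \<otimes>\<^bsub>UP R\<^esub> ?X k"
      have "x \<oplus>\<^bsub>Lam\<^esub> y = ?fr ?w (?X k \<otimes>\<^bsub>UP R\<^esub> ?X l)"
        unfolding *(1,4) Lam_def by (intro S.frac_add * X)
      then have e: "x \<oplus>\<^bsub>Lam\<^esub> y = ?fr ?w (?X (k + l))" unfolding XX .
      have wc: "?w \<in> carrier (UP R)" using * by simp
      have "coeff (UP R) ?w i \<in> F 1" if "i \<ge> k + l" for i
      proof -
        have "coeff (UP R) w (i - l) \<in> F 1" "coeff (UP R) v (i - k) \<in> F 1" using that *(3)[of "i - l"] *(6)[of "i - k"] by simp_all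
        then have "coeff (UP R) w (i - l) \<oplus> coeff (UP R) v (i - k) \<in> F 1" by (rule M.a_closed)
        then show ?thesis using that *(2,5) by (simp add: U.coeff_mult_power del: U.coeff_mult)
      qed
      then show "x \<oplus>\<^bsub>Lam\<^esub> y \<in> ?Z" using e wc by blast
    next
      fix i assume "i \<in> {1..deg ?A p}"
      then have i: "i \<ge> 1" by simp
      have "coeff (UP R) (?a i) j \<in> F 1" if "j \<ge> i" for j
        using Ac(2)[OF a, of i j] lift_Suc_antimono_le[of F 1 j, OF descending] i that by auto
      then show "?t i \<in> ?Z" using Ac(1)[OF a[of i]] by blast
    qed
    then obtain w k where w: "(\<Oplus>\<^bsub>Lam\<^esub>i\<in>{1..deg ?A p}. ?t i) = ?fr w (?X k)" "w \<in> carrier (UP R)"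
      "\<forall>i\<ge>k. coeff (UP R) w i \<in> F 1" by blast
    have a0: "?a 0 \<in> carrier (UP R)" using Ac(1)[OF a] .
    have "Psi p = ?fr (?a 0 \<otimes>\<^bsub>UP R\<^esub> ?X k \<oplus>\<^bsub>UP R\<^esub> w \<otimes>\<^bsub>UP R\<^esub> ?X 0) (?X 0 \<otimes>\<^bsub>UP R\<^esub> ?X k)"
    proof -
      have "?t 0 \<oplus>\<^bsub>Lam\<^esub> ?fr w (?X k) = ?fr (?a 0 \<otimes>\<^bsub>UP R\<^esub> ?X k \<oplus>\<^bsub>UP R\<^esub> w \<otimes>\<^bsub>UP R\<^esub> ?X 0) (?X 0 \<otimes>\<^bsub>UP R\<^esub> ?X k)"
        unfolding Lam_def by (intro S.frac_add X w(2) a0)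
      then show ?thesis by (simp only: Psi_p w(1))
    qed
    then have "Psi p = ?fr (?a 0 \<otimes>\<^bsub>UP R\<^esub> ?X k \<oplus>\<^bsub>UP R\<^esub> w \<otimes>\<^bsub>UP R\<^esub> ?X 0) (?X k)" unfolding XX by simp
    moreover have c: "?a 0 \<otimes>\<^bsub>UP R\<^esub> ?X k \<oplus>\<^bsub>UP R\<^esub> w \<otimes>\<^bsub>UP R\<^esub> ?X 0 \<in> carrier (UP R)" using a0 w(2) by simp
    ultimately have "?a 0 \<otimes>\<^bsub>UP R\<^esub> ?X k \<oplus>\<^bsub>UP R\<^esub> w \<otimes>\<^bsub>UP R\<^esub> ?X 0 \<in> qX (F 1)"
      using pE S.frac_mem_extension[OF qX[OF M] c X] by simp
    then have "coeff (UP R) (?a 0 \<otimes>\<^bsub>UP R\<^esub> ?X k \<oplus>\<^bsub>UP R\<^esub> w \<otimes>\<^bsub>UP R\<^esub> ?X 0) k \<in> F 1" unfolding qX_def by blast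
    then have 1: "coeff (UP R) (?a 0) 0 \<oplus> coeff (UP R) w k \<in> F 1"
      using a0 w(2) by (simp add: U.coeff_mult_power[OF a0] U.coeff_mult_power[OF w(2), of 0] del: U.coeff_mult U.monom_one)
    have "(coeff (UP R) (?a 0) 0 \<oplus> coeff (UP R) w k) \<ominus> coeff (UP R) w k \<in> F 1"
      using M.minus_mem[OF 1] w(3) by blast
    then have "coeff (UP R) (?a 0) 0 \<in> F 1"
      using add_minus_cancel(2)[of "coeff (UP R) (?a 0) 0" "coeff (UP R) w k"] a0 w(2) by simp
    then show "p \<in> N" unfolding N_def using pc a by blast
  qed
  have "T (F 1) \<subset> N" using TN UN UT by blast
  then have ch: "pchain (UP ?A) (Suc n) (T q) N" using pchain_snoc[OF Tchain[OF C0] Nprime] by blast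
  have AN: "noetherian_ring ?A" by (rule rees_noetherian[OF Noeth pow])
  obtain p' where p': "T q \<subset> p'" "?U \<in> p'" "pchain (UP ?A) n p' N"
    using V.P.pchain_containing[OF V.hilbert_basis[OF AN] ch UN] by blast
  interpret c: ring_hom_cring ?A "UP ?A" "\<lambda>a. monom (UP ?A) a 0"
    by (intro ring_hom_cringI A.cring_axioms V.P.cring_axioms V.const_ring_hom)
  have "pchain ?A n {r \<in> carrier ?A. monom (UP ?A) r 0 \<in> p'} {r \<in> carrier ?A. monom (UP ?A) r 0 \<in> N}"
  proof (rule c.pchain_vimage[OF p'(3)])
    fix I J assume IJ: "primeideal I (UP ?A)" "primeideal J (UP ?A)" "p' \<subseteq> I" "I \<subset> J"
    interpret I: primeideal I "UP ?A" by (rule IJ)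
    interpret J: primeideal J "UP ?A" by (rule IJ)
    obtain x where x: "x \<in> J" "x \<notin> I" using IJ(4) by blast
    have xc: "x \<in> carrier (UP ?A)" using J.Icarr[OF x(1)] .
    let ?c = "monom (UP ?A) (coeff (UP ?A) x 0) 0"
    have cc: "coeff (UP ?A) x 0 \<in> carrier ?A" "?c \<in> carrier (UP ?A)" using V.coeff_closed[OF xc] V.monom_closed by auto
    have d: "x \<ominus>\<^bsub>UP ?A\<^esub> ?c \<in> I" using V.minus_const_mem[OF xc I.ideal_axioms] p'(2) IJ(3) by blast
    have e: "x = (x \<ominus>\<^bsub>UP ?A\<^esub> ?c) \<oplus>\<^bsub>UP ?A\<^esub> ?c" using V.P.add_minus_cancel(3)[OF xc cc(2)] by simp
    have e2: "?c = x \<ominus>\<^bsub>UP ?A\<^esub> (x \<ominus>\<^bsub>UP ?A\<^esub> ?c)" using V.P.minus_minus_cancel[OF xc cc(2)] by simp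
    have "?c \<notin> I" using e d x(2) I.a_closed by metis
    moreover have "x \<ominus>\<^bsub>UP ?A\<^esub> (x \<ominus>\<^bsub>UP ?A\<^esub> ?c) \<in> J" using d IJ(4) x(1) J.minus_mem by blast
    then have "?c \<in> J" using e2 by simp
    ultimately show "\<exists>r\<in>carrier ?A. monom (UP ?A) r 0 \<in> J - I" using cc by blast
  qed
  then obtain C where C: "prime_chain ?A n C" "C 0 = {r \<in> carrier ?A. monom (UP ?A) r 0 \<in> p'}" unfolding pchain_def by blast
  interpret p': primeideal p' "UP ?A" by (rule pchain_prime(1)[OF p'(3)])
  have "monom (UP R) y 0 \<in> C 0" if y: "y \<in> F 1" for y
  proof -
    have yc: "y \<in> carrier R" using y by auto
    have yA: "monom (UP R) y 1 \<in> carrier ?A" "monom (UP R) y 0 \<in> carrier ?A"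
      using rees_subring(2)[OF y] rees_subring(2)[of y 0] zeroth yc by (simp_all add: rees_simps)
    let ?y1 = "monom (UP ?A) (monom (UP R) y 1) 1" and ?y0 = "monom (UP ?A) (monom (UP R) y 0) 0"
    have c: "?y1 \<in> carrier (UP ?A)" "?y0 \<in> carrier (UP ?A)" using yA V.monom_closed by auto
    have "?fr (monom (UP R) y 1) (?X 1) = ?fr (monom (UP R) y 0) (?X 0)"
      using yc by (intro S.frac_eqI X) (auto simp flip: U.monom_mult)
    then have "Psi ?y1 = Psi ?y0" using Psi_monom yA by simp
    then have "Psi (?y1 \<ominus>\<^bsub>UP ?A\<^esub> ?y0) = \<zero>\<^bsub>Lam\<^esub>"
      using c Psi.hom_closed by (simp add: a_minus_def Psi.hom_a_inv Lam.r_neg)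
    moreover have "\<zero>\<^bsub>Lam\<^esub> \<in> S.extension (qX q)"
      using additive_subgroup.zero_closed[OF ideal.axioms(1)[OF primeideal.axioms(1)[OF S.primeideal_extension[OF qX[OF pchain_prime(1)[OF C0]]]]]]
      by (simp add: Lam_def)
    moreover have "?y1 \<ominus>\<^bsub>UP ?A\<^esub> ?y0 \<in> carrier (UP ?A)" using c by simp
    ultimately have "?y1 \<ominus>\<^bsub>UP ?A\<^esub> ?y0 \<in> T q" unfolding T_def by simp
    then have "?y1 \<ominus>\<^bsub>UP ?A\<^esub> ?y0 \<in> p'" using p'(1) by blast
    moreover have "?y1 \<in> p'"
    proof -
      have "?y1 = monom (UP ?A) (monom (UP R) y 1) 0 \<otimes>\<^bsub>UP ?A\<^esub> ?U"
        using V.monom_mult[OF yA(1) A.one_closed, of 0 1] A.r_one[OF yA(1)] by simp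
      then show ?thesis using p'.I_l_closed[OF p'(2)] V.monom_closed[OF yA(1)] by simp
    qed
    ultimately have "?y1 \<ominus>\<^bsub>UP ?A\<^esub> (?y1 \<ominus>\<^bsub>UP ?A\<^esub> ?y0) \<in> p'" using p'.minus_mem by blast
    moreover have "?y1 \<ominus>\<^bsub>UP ?A\<^esub> (?y1 \<ominus>\<^bsub>UP ?A\<^esub> ?y0) = ?y0" by (rule V.P.minus_minus_cancel[OF c])
    ultimately show ?thesis unfolding C(2) using yA(2) by simp
  qed
  then show ?thesis using C(1) by blast
qed

section \<open>Heights and analytic spread\<close>

lemma prime_height_ge: "pchain R n c Q \<Longrightarrow> enat n \<le> prime_height R Q"
  unfolding prime_height_def pchain_def by (intro Sup_upper) blast

lemma prime_height_least: "(\<And>n c. pchain R n c Q \<Longrightarrow> enat n \<le> x) \<Longrightarrow> prime_height R Q \<le> x"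
  unfolding prime_height_def pchain_def by (intro Sup_least) blast

text \<open>A supremum of a nonempty set of extended natural numbers is attained if it is finite.\<close>

lemma prime_height_attained:
  assumes h: "prime_height R Q = enat k" and Q: "primeideal Q R"
  obtains c where "pchain R k c Q"
proof -
  let ?X = "{enat n | n. \<exists>C. prime_chain R n C \<and> C n = Q}"
  have "pchain R 0 Q Q" using Q by (simp add: pchain_0)
  then have ne: "?X \<noteq> {}" unfolding pchain_def by blast
  have "Sup ?X = enat k" using h by (simp add: prime_height_def)
  then have "enat k \<in> ?X"
    using Max_in[of ?X] ne unfolding Sup_enat_def by (auto split: if_splits)
  then show ?thesis using that unfolding pchain_def by blast
qed

lemma prime_height_le_krull_dim: "prime_height R Q \<le> krull_dim R"
  unfolding prime_height_def krull_dim_def by (intro Sup_subset_mono) blast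

lemma prime_height_mono:
  assumes "primeideal Q R" "p \<subseteq> Q" shows "prime_height R p \<le> prime_height R Q"
proof (rule prime_height_least)
  fix n c assume c: "pchain R n c p"
  show "enat n \<le> prime_height R Q"
  proof (cases "p = Q")
    case True then show ?thesis using prime_height_ge[OF c] by simp
  next
    case False
    then have "pchain R (Suc n) c Q" using c assms by (intro pchain_snoc) auto
    then have "enat (Suc n) \<le> prime_height R Q" by (rule prime_height_ge)
    then show ?thesis by (meson Suc_n_not_le_n enat_ord_simps(1) nle_le order_trans)
  qed
qed

lemma prime_height_strict:
  assumes p: "primeideal p R" "prime_height R p = enat k" and Q: "primeideal Q R" "p \<subset> Q"
  shows "enat (Suc k) \<le> prime_height R Q"
proof -
  obtain c where "pchain R k c p" using prime_height_attained[OF p(2,1)] .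
  then show ?thesis using pchain_snoc[OF _ Q] prime_height_ge by blast
qed

lemma (in filtration) analytic_spread_eq:
  assumes "max_ideal R \<subseteq> carrier R"
  shows "analytic_spread R F = Sup {enat n | n. \<exists>C. prime_chain (rees_ring R F) n C \<and>
    (\<lambda>a. monom (UP R) a 0) ` max_ideal R \<subseteq> C 0}"
proof -
  let ?g = "(\<lambda>a. monom (UP R) a 0) ` max_ideal R"
  interpret A: cring "rees_ring R F" by (rule cring_rees)
  have g: "?g \<subseteq> carrier (rees_ring R F)"
    using rees_subring(2)[of _ 0] zeroth assms by (auto simp: rees_simps)
  have "Idl\<^bsub>rees_ring R F\<^esub> ?g \<subseteq> C 0 \<longleftrightarrow> ?g \<subseteq> C 0" if "prime_chain (rees_ring R F) n C" for n C
  proof -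
    have "ideal (C 0) (rees_ring R F)" using that by (auto simp: prime_chain_def intro: primeideal.axioms(1))
    then show ?thesis using A.Idl_subset_ideal[OF _ g] by blast
  qed
  then show ?thesis
    unfolding analytic_spread_def krull_dim_def A.quot_prime_chain[OF A.genideal_ideal[OF g]] by meson
qed

lemma (in cring) pchain_extend_at:
  assumes Q: "primeideal Q R" and C: "pchain R n q Q"
  shows "pchain (localization_at R Q) n (extend_at R Q q) (extend_at R Q Q)"
proof -
  interpret S: mult_set R "carrier R - Q" by (rule mult_set_prime[OF Q])
  have "pchain (localization_at R Q) n (extend_at R Q q) (extend_at R Q q')" if "pchain R n q q'" "q' \<subseteq> Q" for q q' n
    using that
  proof (induction n arbitrary: q)
    case 0
    then show ?case using primeideal_extend_at(1)[OF Q] by (simp add: pchain_0)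
  next
    case (Suc n)
    obtain q1 where q1: "primeideal q R" "q \<subset> q1" "pchain R n q1 q'" using Suc.prems(1) by (rule pchain_Suc_first)
    have pr: "primeideal q1 R" and sub: "q \<subseteq> Q" "q1 \<subseteq> Q"
      using pchain_prime(1)[OF q1(3)] pchain_subset[OF q1(3)] q1(2) Suc.prems(2) by auto
    obtain a where a: "a \<in> q1" "a \<notin> q" using q1(2) by blast
    have ac: "a \<in> carrier R" by (rule ideal.Icarr[OF primeideal.axioms(1)[OF pr] a(1)])
    have "extend_at R Q q \<subseteq> extend_at R Q q1"
      unfolding extend_at_eq[OF Q primeideal.axioms(1)[OF pr]] extend_at_eq[OF Q primeideal.axioms(1)[OF q1(1)]]
      using q1(2) by blast
    moreover have "extend_at R Q q \<noteq> extend_at R Q q1"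
      using primeideal_extend_at(2)[OF Q pr sub(2) ac S.S_one] primeideal_extend_at(2)[OF Q q1(1) sub(1) ac S.S_one] a by blast
    ultimately show ?case
      using pchain_Cons[OF primeideal_extend_at(1)[OF Q q1(1) sub(1)]] Suc.IH[OF q1(3) Suc.prems(2)] by blast
  qed
  then show ?thesis using C by blast
qed

context incomparable_primes
begin

lemma localize_F_1:
  assumes p: "p \<in> W" shows "localize_filtration R F p 1 = extend_at R p p"
proof -
  interpret p: primeideal p R by (rule prime[OF p])
  interpret S: mult_set R "carrier R - p" by (rule mult_set_prime[OF prime[OF p]])
  have "extend_at R p I \<subseteq> extend_at R p p"
    unfolding extend_at_eq[OF prime[OF p] ideal_I] extend_at_eq[OF prime[OF p] p.ideal_axioms] using p by (auto simp: I_def)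
  moreover have "extend_at R p p \<subseteq> extend_at R p I"
  proof
    fix x assume "x \<in> extend_at R p p"
    then obtain a s where a: "a \<in> p" "s \<in> carrier R - p" "x = fraction R (carrier R - p) a s"
      unfolding extend_at_eq[OF prime[OF p] p.ideal_axioms] by blast
    have "a \<in> saturation R p I" using a saturation_I[OF p] by simp
    then obtain t where t: "t \<in> carrier R - p" "t \<otimes> a \<in> I" unfolding saturation_def by blast
    have "x = fraction R (carrier R - p) (t \<otimes> a) (t \<otimes> s)"
      unfolding a(3) using a(1,2) t S.S_mult[OF t(1) a(2)] by (intro S.frac_eqI) (auto simp: m_ac)
    then show "x \<in> extend_at R p I"
      unfolding extend_at_eq[OF prime[OF p] ideal_I] using t(2) S.S_mult[OF t(1) a(2)] by blast
  qed
  ultimately show ?thesis unfolding localize_filtration_def F_1 by blast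
qed

text \<open>Equality holds, but this inclusion is what makes the Rees ring over the localization finitely generated.\<close>

lemma localize_F_pow:
  assumes p: "p \<in> W"
  shows "localize_filtration R F p n \<subseteq> extend_at R p p [^]\<^bsub>ideals_set (localization_at R p)\<^esub> n"
proof
  let ?L = "localization_at R p"
  interpret p: primeideal p R by (rule prime[OF p])
  interpret S: mult_set R "carrier R - p" by (rule mult_set_prime[OF prime[OF p]])
  interpret L: cring ?L by (rule cring_localization_at[OF prime[OF p]])
  let ?fr = "fraction R (carrier R - p)"
  have LS: "?L = localization R (carrier R - p)" by (simp add: localization_at_def)
  let ?E = "\<lambda>n. extend_at R p p [^]\<^bsub>ideals_set ?L\<^esub> (n::nat)"
  have Eid: "ideal (?E n) ?L" for n by (rule L.ideal_power[OF ideal_extend_at[OF prime[OF p] p.ideal_axioms]])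
  have pw: "?fr b \<one> \<in> ?E n" if "b \<in> pow n" for b n
    using that
  proof (induction n arbitrary: b)
    case 0
    then show ?case using S.frac_in_carrier[OF _ S.S_one, of b] pow_simps(1) by (simp add: ideals_set_def LS)
  next
    case (Suc n)
    have ES: "?E (Suc n) = ideal_prod ?L (?E n) (extend_at R p p)" by (simp add: ideals_set_def)
    have "b \<in> pow n \<cdot> I" using Suc.prems pow_simps(3)[of n 1] pow_simps(2) by simp
    then show ?case
    proof (induction rule: ideal_prod.induct)
      case (prod i j)
      have ij: "i \<in> carrier R" "j \<in> carrier R" "j \<in> p"
        using prod ideal.Icarr[OF ideal_pow] ideal.Icarr[OF ideal_I] p by (auto simp: I_def)
      have "?fr (i \<otimes> j) \<one> = ?fr i \<one> \<otimes>\<^bsub>?L\<^esub> ?fr j \<one>"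
        unfolding LS using S.frac_mult[OF ij(1) S.S_one ij(2) S.S_one] by simp
      moreover have "?fr j \<one> \<in> extend_at R p p"
        using primeideal_extend_at(2)[OF prime[OF p] prime[OF p] order_refl ij(2) S.S_one] ij(3) by simp
      ultimately show ?case unfolding ES using Suc.IH[OF prod(1)] by (metis ideal_prod.prod)
    next
      case (sum s1 s2)
      have c: "s1 \<in> carrier R" "s2 \<in> carrier R" using sum(1,2) ideal_prod_in_carrier[OF ideal_pow ideal_I] by blast+
      have "?fr (s1 \<oplus> s2) \<one> = ?fr s1 \<one> \<oplus>\<^bsub>?L\<^esub> ?fr s2 \<one>"
        unfolding LS using S.frac_add[OF c(1) S.S_one c(2) S.S_one] c by simp
      then show ?case using sum(3,4) additive_subgroup.a_closed[OF ideal.axioms(1)[OF Eid]] by metis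
    qed
  qed
  fix x assume "x \<in> localize_filtration R F p n"
  then obtain a s where a: "a \<in> F n" "s \<in> carrier R - p" "x = ?fr a s"
    unfolding localize_filtration_def extend_at_eq[OF prime[OF p] F.ideals] by blast
  have "a \<in> saturation R p (pow n)" using a(1) p by (simp add: symbolic_power_eq)
  then obtain t where t: "a \<in> carrier R" "t \<in> carrier R - p" "t \<otimes> a \<in> pow n" unfolding saturation_def by blast
  note ts = S.S_mult[OF t(2) a(2)]
  have c: "t \<otimes> a \<in> carrier R" using t by simp
  have "x = ?fr (\<one> \<otimes> (t \<otimes> a)) ((t \<otimes> s) \<otimes> \<one>)"
    unfolding a(3) using a(2) t ts by (intro S.frac_eqI) (auto simp: m_ac)
  also have "\<dots> = ?fr \<one> (t \<otimes> s) \<otimes>\<^bsub>?L\<^esub> ?fr (t \<otimes> a) \<one>"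
    unfolding LS by (rule S.frac_mult[OF one_closed ts c S.S_one, symmetric])
  finally have x: "x = ?fr \<one> (t \<otimes> s) \<otimes>\<^bsub>?L\<^esub> ?fr (t \<otimes> a) \<one>" .
  have "?fr \<one> (t \<otimes> s) \<in> carrier ?L" unfolding LS by (rule S.frac_in_carrier[OF one_closed ts])
  then show "x \<in> ?E n" unfolding x by (rule ideal.I_l_closed[OF Eid pw[OF t(3)]])
qed

lemma analytic_spread_localize:
  assumes Q: "primeideal Q R"
  shows "analytic_spread (localization_at R Q) (localize_filtration R F Q) =
    Sup {enat n | n. \<exists>C. prime_chain (rees_ring (localization_at R Q) (localize_filtration R F Q)) n C \<and>
    (\<lambda>a. monom (UP (localization_at R Q)) a 0) ` max_ideal (localization_at R Q) \<subseteq> C 0}"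
  using filtration.analytic_spread_eq[OF F.filtration_localize[OF Q]] max_ideal_localization_at[OF Q]
    additive_subgroup.a_subset[OF ideal.axioms(1)[OF maximalideal.axioms(1)]] by metis

theorem analytic_spread_le:
  assumes "domain R" "noetherian_ring R" "primeideal Q R" "I \<subseteq> Q"
  shows "analytic_spread (localization_at R Q) (localize_filtration R F Q) \<le> prime_height R Q"
  unfolding analytic_spread_localize[OF assms(3)]
proof (rule Sup_least, clarify)
  fix n C
  assume C: "prime_chain (rees_ring (localization_at R Q) (localize_filtration R F Q)) n C"
    "(\<lambda>a. monom (UP (localization_at R Q)) a 0) ` max_ideal (localization_at R Q) \<subseteq> C 0"
  then show "enat n \<le> prime_height R Q" using fiber_chain_bound(1)[OF assms C] prime_height_ge by blast
qed

theorem analytic_spread_less: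
  assumes "domain R" "noetherian_ring R" "primeideal Q R" "I \<subseteq> Q" "Q \<notin> W" and fin: "prime_height R Q \<noteq> \<infinity>"
  shows "analytic_spread (localization_at R Q) (localize_filtration R F Q) < prime_height R Q"
proof -
  obtain k where k: "prime_height R Q = enat k" using fin by auto
  obtain p where p: "p \<in> W" "p \<subseteq> Q" using prime_contains_member[OF assms(3,4)] .
  have "pchain R 0 p p" using prime[OF p(1)] by (simp add: pchain_0)
  then have "pchain R 1 p Q" using pchain_snoc[of R 0 p p Q] p assms(3,5) by auto
  then have k1: "k \<ge> 1" using prime_height_ge k by fastforce
  have "analytic_spread (localization_at R Q) (localize_filtration R F Q) \<le> enat (k - 1)"
    unfolding analytic_spread_localize[OF assms(3)]
  proof (rule Sup_least, clarify)
    fix n C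
    assume C: "prime_chain (rees_ring (localization_at R Q) (localize_filtration R F Q)) n C"
      "(\<lambda>a. monom (UP (localization_at R Q)) a 0) ` max_ideal (localization_at R Q) \<subseteq> C 0"
    then have "enat (Suc n) \<le> enat k" using fiber_chain_bound(2)[OF assms(1-4) C assms(5)] prime_height_ge k by metis
    then show "enat n \<le> enat (k - 1)" by simp
  qed
  also have "enat (k - 1) < prime_height R Q" using k k1 by simp
  finally show ?thesis .
qed

theorem analytic_spread_ge:
  assumes p: "p \<in> W" and Noeth: "noetherian_ring (localization_at R p)"
  shows "prime_height R p \<le> analytic_spread (localization_at R p) (localize_filtration R F p)"
proof (rule prime_height_least)
  fix n c assume c: "pchain R n c p"
  let ?L = "localization_at R p" and ?G = "localize_filtration R F p"
  interpret G: filtration ?L ?G by (rule F.filtration_localize[OF prime[OF p]])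
  note G1 = localize_F_1[OF p]
  have "\<exists>C. prime_chain (rees_ring ?L ?G) n C \<and> (\<lambda>a. monom (UP ?L) a 0) ` ?G 1 \<subseteq> C 0"
  proof (rule G.fiber_chain_exists[OF Noeth])
    show "primeideal (?G 1) ?L" unfolding G1 by (rule primeideal_extend_at(1)[OF prime[OF p] prime[OF p] order_refl])
    show "?G n \<subseteq> ?G 1 [^]\<^bsub>ideals_set ?L\<^esub> n" for n unfolding G1 by (rule localize_F_pow[OF p])
    show "pchain ?L n (extend_at R p c) (?G 1)" unfolding G1 by (rule pchain_extend_at[OF prime[OF p] c])
  qed
  then show "enat n \<le> analytic_spread ?L ?G"
    unfolding analytic_spread_localize[OF prime[OF p]] G1 max_ideal_localization_at(1)[OF prime[OF p]]
    by (intro Sup_upper) blast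
qed

end

theorem proposition1p10:
  fixes R :: "('a, 'b) ring_scheme" (structure)
    and d r :: nat and h :: enat
    and P :: "nat \<Rightarrow> 'a set" and I :: "'a set"
  assumes "local_ring R" and "domain R"
    and "krull_dim R = enat d"
    and "r \<ge> 1"
    and "\<And>i. i \<in> {1..r} \<Longrightarrow> primeideal (P i) R"
    and "\<And>i. i \<in> {1..r} \<Longrightarrow> prime_height R (P i) = h"
    and "\<And>i. i \<in> {1..r} \<Longrightarrow> regular_local_ring (localization_at R (P i))"
    and "I = (\<Inter>i\<in>{1..r}. P i)"
  shows "(\<forall>Q. primeideal Q R \<and> I \<subseteq> Q \<and> Q \<notin> P ` {1..r} \<longrightarrow>
            analytic_spread (localization_at R Q)
              (localize_filtration R (symbolic_power R I) Q) < prime_height R Q)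
       \<and> (\<forall>i\<in>{1..r}.
            analytic_spread (localization_at R (P i))
              (localize_filtration R (symbolic_power R I) (P i)) = prime_height R (P i) \<and>
            prime_height R (P i) = ideal_height R I)"
proof -
  interpret local_ring R by (rule assms(1))
  interpret domain R by (rule assms(2))
  let ?W = "P ` {1..r}"
  have fin: "prime_height R Q \<noteq> \<infinity>" for Q
    using prime_height_le_krull_dim[of R Q] assms(3) by (cases "prime_height R Q") simp_all
  have hW: "prime_height R p = h" if "p \<in> ?W" for p using that assms(6) by blast
  have pW: "primeideal p R" if "p \<in> ?W" for p using that assms(5) by blast
  interpret W: incomparable_primes R ?W I
  proof (intro incomparable_primes.intro incomparable_primes_axioms.intro)
    show "cring R" by (rule cring_axioms)
    show "finite ?W" by simp
    show "?W \<noteq> {}" using assms(4) by simp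
    show "primeideal p R" if "p \<in> ?W" for p by (rule pW[OF that])
    show "I = \<Inter> ?W" by (rule assms(8))
    fix p p' assume pp: "p \<in> ?W" "p' \<in> ?W" "p \<subseteq> p'"
    show "p = p'"
    proof (rule ccontr)
      assume "p \<noteq> p'"
      then have "p \<subset> p'" using pp by blast
      obtain k where k: "h = enat k" using fin[of p] hW[OF pp(1)] by auto
      have "enat (Suc k) \<le> prime_height R p'"
        using prime_height_strict[OF pW[OF pp(1)] _ pW[OF pp(2)] \<open>p \<subset> p'\<close>] hW[OF pp(1)] k by simp
      then show False using hW[OF pp(2)] k by simp
    qed
  qed
  have N: "noetherian_ring R" by (rule noetherian_ring_axioms)
  have less: "analytic_spread (localization_at R Q) (localize_filtration R (symbolic_power R I) Q) < prime_height R Q"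
    if "primeideal Q R" "I \<subseteq> Q" "Q \<notin> ?W" for Q
    by (rule W.analytic_spread_less[OF domain_axioms N that fin])
  have eq: "analytic_spread (localization_at R p) (localize_filtration R (symbolic_power R I) p) = prime_height R p"
    if p: "p \<in> ?W" for p
  proof (rule antisym)
    have "I \<subseteq> p" using p W.I_def by blast
    then show "analytic_spread (localization_at R p) (localize_filtration R (symbolic_power R I) p) \<le> prime_height R p"
      by (rule W.analytic_spread_le[OF domain_axioms N pW[OF p]])
    have "regular_local_ring (localization_at R p)" using p assms(7) by blast
    then have "noetherian_ring (localization_at R p)"
      by (intro local_ring.axioms(2) regular_local_ring.axioms(1))
    then show "prime_height R p \<le> analytic_spread (localization_at R p) (localize_filtration R (symbolic_power R I) p)"
      by (rule W.analytic_spread_ge[OF p])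
  qed
  have height: "prime_height R p = ideal_height R I" if p: "p \<in> ?W" for p
    unfolding ideal_height_def
  proof (rule antisym)
    show "prime_height R p \<le> (INF Q\<in>{Q. primeideal Q R \<and> I \<subseteq> Q}. prime_height R Q)"
    proof (rule INF_greatest)
      fix Q assume "Q \<in> {Q. primeideal Q R \<and> I \<subseteq> Q}"
      then have Q: "primeideal Q R" "I \<subseteq> Q" by auto
      obtain p' where "p' \<in> ?W" "p' \<subseteq> Q" using W.prime_contains_member[OF Q] .
      then show "prime_height R p \<le> prime_height R Q" using prime_height_mono[OF Q(1)] hW p by metis
    qed
    show "(INF Q\<in>{Q. primeideal Q R \<and> I \<subseteq> Q}. prime_height R Q) \<le> prime_height R p"
      using pW[OF p] W.I_def p by (intro INF_lower) blast
  qed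
  show ?thesis using less eq height by blast
qed

end
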